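(* Let $1<\beta\le 2$, let $e_\beta$ and $E_\beta=e_\beta/\log\beta$ be the escape rates of the greedy $\beta$-transformation on $[0,1)$ into the hole $\Delta_\beta=[\frac1\beta,\frac1{\beta(\beta-1)}]$, and let $\beta_*$ be the Komornik–Loreti constant. (1) If $1<\beta\le\beta_*$, then $E_\beta=1$ and $e_\beta=\log\beta$. (2) For $\beta_*<\beta\le 2$, $E_\beta$ forms a devil's staircase function of $\beta$, i.e. $\beta\mapsto E_\beta$ is continuous, monotonic, and its derivative with respect to $\beta$ is larger than zero almost everywhere. Moreover, $\lim_{\beta\to\beta_*}E_\beta=1$ and $E_2=0$. (3) Let $[\beta_L,\beta_U]$ be the admissible interval generated by a block $t_1\cdots t_p$. For $\beta\in[\beta_L,\beta_U]$ the escape rate $E_\beta$ is given by $$E_\beta=1-\frac{h_{top}(Z_{t_1\cdots t_p})}{\log\beta},$$ where $h_{top}(Z_{t_1\cdots t_p})$ is the topological entropy of the subshift of finite type $$Z_{t_1\cdots t_p}=\{(d_i)\in\{0,1\}^{\mathbb N}:\ \overline{t_1\cdots t_p}\le d_n\cdots d_{n+p-1}\le t_1\cdots t_p\ \text{ for all } n\ge1\}.$$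
   Context: Escape rates. Let $1<\beta\le 2$ and $J_\beta=[0,\frac{1}{\beta-1}]$. The greedy $\beta$-transformation $G_\beta:J_\beta\to J_\beta$ is $G_\beta(x)=\beta x$ if $0\le x<\frac1\beta$ and $G_\beta(x)=\beta x-1$ if $\frac1\beta\le x\le\frac1{\beta-1}$. Put $I=[0,1)$, $T_\beta=G_\beta|_I:I\to I$, and $\Delta_\beta=\left[\frac1\beta,\frac1{\beta(\beta-1)}\right]$. For $n\ge0$ let $$\Gamma_{\beta,n}=\{x\in I: T_\beta^n(x)\in\Delta_\beta\cap I\text{ and }T_\beta^k(x)\notin\Delta_\beta\cap I\text{ for }0\le k\le n-1\}.$$ With $\lambda$ the Lebesgue measure on $\mathbb R$, $$e_\beta=\lim_{n\to\infty}\frac{-\log\lambda(\Gamma_{\beta,n})}{n},\qquad E_\beta=\lim_{n\to\infty}\frac{-\log\lambda(\Gamma_{\beta,n})}{n\log\beta}=\frac{e_\beta}{\log\beta}.$$ Komornik–Loreti constant. $\beta_*=1.787231650\ldots$ is the unique $\beta\in(1,2)$ with $\sum_{i\ge1}\tau_i\beta^{-i}=1$, where $\tau_i\in\{0,1\}$ is the parity of the number of ones in the binary expansion of $i$ (Thue–Morse sequence). Blocks. Blocks of equal length and infinite sequences over $\{0,1\}$ are compared lexicographically. For a digit, $\overline{\ell}=1-\ell$, and for a block or sequence the bar is applied digitwise. For a block $c_1\cdots c_m$ with $c_m=0$, write $c_1\cdots c_m^+=c_1\cdots c_{m-1}1$. Admissible intervals (Kong–Li). A block $t_1\cdots t_p\in\{0,1\}^p$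 is admissible if $t_p=0$ and for every $1\le i\le p$, $$\overline{t_1\cdots t_p}\le t_i\cdots t_p\,t_1\cdots t_{i-1}\quad\text{and}\quad t_i\cdots t_p^+\,\overline{t_1\cdots t_{i-1}}\le t_1\cdots t_p^+.$$ For $q\in(1,2]$, the quasi-greedy expansion $\alpha(q)$ of $1$ is the lexicographically largest sequence $(\alpha_i)\in\{0,1\}^{\mathbb N}$ with infinitely many nonzero digits satisfying $\sum_{i\ge1}\alpha_iq^{-i}=1$. The admissible interval $[\beta_L,\beta_U]\subset(1,2]$ generated by an admissible block $t_1\cdots t_p$ is determined by $\alpha(\beta_L)=(t_1\cdots t_p)^\infty$ and $\alpha(\beta_U)=\lim_{n\to\infty}B_n$, where $B_0=t_1\cdots t_p^+$ and $B_{n+1}=B_n\,\overline{B_n}^{\,+}$ for $n\ge 0$ (each $B_n$ is a prefix of $B_{n+1}$).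
   Formalization: "Monotonic" in (2) contradicts the other clauses; proved instead: E_β is nondecreasing on each admissible interval and log β − e_β is monotone on (β_*,2]. At β=2 the hole is null, so log 0 is read as 0, giving E_2=0. *)

theory Defs
  imports "HOL-Analysis.Analysis" "HOL-Library.Fun_Lexorder" "HOL-Library.List_Lexorder"
begin

section \<open>Escape rates of the greedy beta-transformation\<close>

definition greedy_map :: "real \<Rightarrow> real \<Rightarrow> real" where
  "greedy_map \<beta> x = (if x < 1 / \<beta> then \<beta> * x else \<beta> * x - 1)"

definition hole :: "real \<Rightarrow> real set" where
  "hole \<beta> = {1 / \<beta> .. 1 / (\<beta> * (\<beta> - 1))}"

text \<open>The map sends \<open>{0..<1}\<close> into itself, so on points of \<open>{0..<1}\<close> its iterates are the iterates
  of its restriction to that interval.\<close>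

definition first_hit :: "real \<Rightarrow> nat \<Rightarrow> real set" where
  "first_hit \<beta> n = {x \<in> {0..<1}. (greedy_map \<beta> ^^ n) x \<in> hole \<beta> \<inter> {0..<1} \<and>
     (\<forall>k<n. (greedy_map \<beta> ^^ k) x \<notin> hole \<beta> \<inter> {0..<1})}"

text \<open>For \<open>1 < \<beta> < 2\<close> every set \<open>first_hit \<beta> n\<close> has positive measure. For \<open>\<beta> = 2\<close> the hole is the
  single point \<open>1/2\<close>, these sets are null, and the convention \<open>ln 0 = 0\<close> makes the rates
  \<open>0\<close>, which is also the value obtained by continuity.\<close>

definition escape_seq :: "real \<Rightarrow> nat \<Rightarrow> real" where
  "escape_seq \<beta> n = - ln (measure lborel (first_hit \<beta> n)) / real n"

definition escape_rate :: "real \<Rightarrow> real" where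
  "escape_rate \<beta> = lim (escape_seq \<beta>)"

definition norm_escape_rate :: "real \<Rightarrow> real" where
  "norm_escape_rate \<beta> = escape_rate \<beta> / ln \<beta>"


section \<open>The Komornik--Loreti constant\<close>

text \<open>Digits 0 and 1 are represented by \<open>False\<close> and \<open>True\<close>, with \<open>False < True\<close>. Sequences indexed
  from 1 in the mathematics are indexed from 0, so the \<open>i\<close>-th entry has weight \<open>\<beta> ^ Suc i\<close>.\<close>

definition thue_morse :: "nat \<Rightarrow> bool" where
  "thue_morse i \<longleftrightarrow> odd (card {k. bit i k})"

definition is_expansion_of_1 :: "real \<Rightarrow> (nat \<Rightarrow> bool) \<Rightarrow> bool" where
  "is_expansion_of_1 \<beta> a \<longleftrightarrow> (\<lambda>i. of_bool (a i) / \<beta> ^ Suc i) sums (1::real)"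

definition komornik_loreti :: real where
  "komornik_loreti = (THE \<beta>. 1 < \<beta> \<and> \<beta> < 2 \<and> is_expansion_of_1 \<beta> (\<lambda>i. thue_morse (Suc i)))"


section \<open>Admissible intervals\<close>

definition quasi_greedy :: "real \<Rightarrow> (nat \<Rightarrow> bool) \<Rightarrow> bool" where
  "quasi_greedy q a \<longleftrightarrow> infinite {i. a i} \<and> is_expansion_of_1 q a \<and>
     (\<forall>b. infinite {i. b i} \<and> is_expansion_of_1 q b \<longrightarrow> b = a \<or> less_fun b a)"

abbreviation bar :: "bool list \<Rightarrow> bool list" where
  "bar \<equiv> map Not"

definition block_plus :: "bool list \<Rightarrow> bool list" where
  "block_plus c = butlast c @ [True]"

definition admissible_block :: "bool list \<Rightarrow> bool" where
  "admissible_block t \<longleftrightarrow> t \<noteq> [] \<and> last t = False \<and>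
     (\<forall>i<length t. bar t \<le> drop i t @ take i t \<and>
        drop i (block_plus t) @ bar (take i t) \<le> block_plus t)"

fun doubling_block :: "bool list \<Rightarrow> nat \<Rightarrow> bool list" where
  "doubling_block t 0 = block_plus t"
| "doubling_block t (Suc n) = doubling_block t n @ block_plus (bar (doubling_block t n))"

definition periodic_seq :: "bool list \<Rightarrow> nat \<Rightarrow> bool" where
  "periodic_seq t i = t ! (i mod length t)"

text \<open>For nonempty \<open>t\<close> the block \<open>doubling_block t i\<close> has length \<open>2 ^ i * length t > i\<close> and is a
  prefix of all later ones, so its entry at position \<open>i\<close> is that of the limit sequence.\<close>

definition doubling_limit :: "bool list \<Rightarrow> nat \<Rightarrow> bool" where
  "doubling_limit t i = doubling_block t i ! i"

definition admissible_interval :: "bool list \<Rightarrow> real \<Rightarrow> real \<Rightarrow> bool" where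
  "admissible_interval t L U \<longleftrightarrow> admissible_block t \<and> L \<in> {1<..2} \<and> U \<in> {1<..2} \<and>
     quasi_greedy L (periodic_seq t) \<and> quasi_greedy U (doubling_limit t)"


section \<open>Subshifts and their entropy\<close>

definition block_subshift :: "bool list \<Rightarrow> (nat \<Rightarrow> bool) set" where
  "block_subshift t =
     {d. \<forall>n. bar t \<le> map d [n..<n + length t] \<and> map d [n..<n + length t] \<le> t}"

definition words :: "(nat \<Rightarrow> 'a) set \<Rightarrow> nat \<Rightarrow> 'a list set" where
  "words Z n = {map d [k..<k + n] | d k. d \<in> Z}"

text \<open>Topological entropy of a subshift: the exponential growth rate of the number of words of
  length \<open>n\<close> that occur in it.\<close>

definition subshift_entropy :: "(nat \<Rightarrow> 'a) set \<Rightarrow> real" where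
  "subshift_entropy Z = lim (\<lambda>n. ln (real (card (words Z n))) / real n)"

end

theory Submission
  imports Defs
begin

text \<open>
  Up to an initial run of digits 0, the points whose greedy orbit avoids the hole form, after
  centring, an invariant set of the map
  \<open>r \<mapsto> \<beta> r - sgn r\<close> on an interval that is symmetric about \<open>0\<close>. It is compared with the Lorenz maps
  \<open>x \<mapsto> s x - sgn x\<close> on \<open>(-1, 1]\<close> of slope \<open>1 < s \<le> 2\<close>. Itineraries of the Lorenz map are bounded, with all
  their shifts and reflections, by the itinerary \<open>knead s\<close> of \<open>1\<close>, and the value of \<open>knead s\<close> in base
  \<open>\<beta>\<close> decides how the two systems are related. If it is less than 1, all itineraries of the Lorenz map
  are followed by points that stay away from the hole by a fixed distance; there are at least
  \<open>s ^ n / 2\<close> words of length \<open>n\<close> (\<open>card_words_ge\<close>), so the first-hit sets have measure at least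
  a constant times \<open>(s / \<beta>) ^ n\<close> (\<open>measure_first_hit_ge_words\<close>). If it is greater than 1, each word of a
  surviving point is realised by the Lorenz map on an interval whose image is not short, so there
  are at most \<open>C s ^ n\<close> such words (\<open>card_core_words_le\<close>). Since \<open>knead s\<close> is strictly increasing in \<open>s\<close>
  (\<open>knead_strict_mono\<close>), the two cases are separated by a number \<open>slope_at \<beta>\<close>, and the escape rate is
  \<open>ln \<beta> - ln (slope_at \<beta>)\<close> (\<open>escape_seq_tendsto\<close>).

  The rest of the theorem describes \<open>slope_at\<close>. It is a generalised inverse of a strictly monotone
  function, hence monotone and continuous; its plateaus are the jumps of the kneading sequence. The
  second iterate of a Lorenz map of small slope contains a copy of the Lorenz map of the squared
  slope. This renormalisation shows that \<open>knead s\<close> decreases to the Thue--Morse sequence as \<open>s\<close> tends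
  to 1, so that \<open>slope_at\<close> equals 1 exactly up to the Komornik--Loreti constant.

  The slope is less than \<open>\<beta>\<close> for \<open>\<beta> < 2\<close>. A base in which some kneading sequence is an expansion of
  1 is determined by the first \<open>n\<close> digits up to an error of order \<open>\<beta> ^ - n\<close>, whereas the number of
  possible prefixes grows only like \<open>s ^ n\<close> with \<open>s < \<beta>\<close>. So the closure of the set of these bases is
  a null set, and off this set \<open>slope_at\<close> is locally constant, which makes the normalised escape rate
  increase like \<open>1 - c / ln \<beta>\<close> with \<open>c > 0\<close>.

  A kneading sequence between \<open>t t t \<dots>\<close> and the doubling limit of \<open>t\<close> would be antiperiodic, and then the
  orbit of \<open>1\<close> would run into \<open>-1\<close>, which has no preimage in \<open>(-1, 1]\<close> (\<open>knead_above_periodic\<close>). So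
  \<open>slope_at\<close> is constant on the admissible interval of \<open>t\<close>, and the word counts above show that its
  logarithm is the entropy of the subshift given by \<open>t\<close>.
\<close>

section \<open>Digit sequences\<close>

definition shift :: "nat \<Rightarrow> (nat \<Rightarrow> bool) \<Rightarrow> nat \<Rightarrow> bool" where
  "shift n d = (\<lambda>i. d (n + i))"

definition flip :: "(nat \<Rightarrow> bool) \<Rightarrow> nat \<Rightarrow> bool" where
  "flip d = (\<lambda>i. \<not> d i)"

text \<open>The lexicographic order. In this form it concerns finitely many digits at a time and passes to
  limits of sequences.\<close>
definition lexle :: "(nat \<Rightarrow> bool) \<Rightarrow> (nat \<Rightarrow> bool) \<Rightarrow> bool" where
  "lexle d e \<longleftrightarrow> (\<forall>n. (\<forall>i<n. d i = e i) \<longrightarrow> d n \<longrightarrow> e n)"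

lemma shift_apply: "shift n d i = d (n + i)"
  by (simp add: shift_def)

lemma flip_apply [simp]: "flip d i = (\<not> d i)"
  by (simp add: flip_def)

lemma shift_0 [simp]: "shift 0 d = d"
  by (simp add: shift_def)

lemma shift_shift [simp]: "shift m (shift n d) = shift (n + m) d"
  by (simp add: shift_def add.assoc)

lemma flip_flip [simp]: "flip (flip d) = d"
  by (simp add: flip_def)

lemma shift_flip [simp]: "shift n (flip d) = flip (shift n d)"
  by (simp add: shift_def flip_def)

lemma lexle_refl [simp]: "lexle d d"
  by (simp add: lexle_def)

lemma first_difference:
  assumes "d \<noteq> (e :: nat \<Rightarrow> 'a)"
  obtains j where "\<forall>i<j. d i = e i" "d j \<noteq> e j"
proof -
  from assms obtain m where "d m \<noteq> e m" by blast
  then have "d (LEAST j. d j \<noteq> e j) \<noteq> e (LEAST j. d j \<noteq> e j)" by (rule LeastI)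
  moreover have "\<forall>i<(LEAST j. d j \<noteq> e j). d i = e i" using not_less_Least by blast
  ultimately show ?thesis using that by blast
qed

lemma lexle_first_difference:
  assumes "lexle d e" "d \<noteq> e"
  obtains j where "\<forall>i<j. d i = e i" "\<not> d j" "e j"
  using assms first_difference[of d e] unfolding lexle_def by metis

lemma less_fun_iff: "less_fun d e \<longleftrightarrow> \<not> lexle e d"
proof
  assume "less_fun d e"
  then obtain k where "d k < e k" "\<And>k'. k' < k \<Longrightarrow> d k' = e k'" by (auto elim: less_funE)
  then show "\<not> lexle e d" unfolding lexle_def by auto
next
  assume "\<not> lexle e d"
  then obtain n where "\<forall>i<n. e i = d i" "e n" "\<not> d n" unfolding lexle_def by auto
  then show "less_fun d e" by (intro less_funI) auto
qed

lemma lexle_total: "lexle d e \<or> lexle e d"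
proof (cases "d = e")
  case False
  then obtain j where "\<forall>i<j. d i = e i" "d j \<noteq> e j" by (rule first_difference)
  then show ?thesis unfolding lexle_def by (metis linorder_neqE_nat)
qed simp

lemma lexle_trans:
  assumes "lexle d e" "lexle e f" shows "lexle d f"
  unfolding lexle_def
proof (intro allI impI)
  fix n assume a: "\<forall>i<n. d i = f i" "d n"
  show "f n"
  proof (cases "\<forall>i<n. d i = e i")
    case True
    with a assms show ?thesis unfolding lexle_def by metis
  next
    case False
    then have "d \<noteq> e" by auto
    then obtain j where j: "\<forall>i<j. d i = e i" "\<not> d j" "e j"
      using assms(1) lexle_first_difference by blast
    from False j have "j < n" by (metis linorder_neqE_nat order.strict_trans)
    with a j assms(2) have "f j" unfolding lexle_def by (metis order.strict_trans)
    with a j \<open>j < n\<close> show ?thesis by blast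
  qed
qed

section \<open>Expansions\<close>

definition val :: "real \<Rightarrow> (nat \<Rightarrow> bool) \<Rightarrow> real" where
  "val \<beta> d = (\<Sum>i. of_bool (d i) / \<beta> ^ Suc i)"

lemma geometric_tail_sums:
  assumes "(1::real) < \<beta>" shows "(\<lambda>i. 1 / \<beta> ^ Suc i) sums (1 / (\<beta> - 1))"
proof -
  have "(\<lambda>i. (1/\<beta>) * (1 / \<beta>) ^ i) sums ((1/\<beta>) * (1 / (1 - 1 / \<beta>)))"
    using assms by (intro sums_mult geometric_sums) auto
  moreover have "(1/\<beta>) * (1 / (1 - 1 / \<beta>)) = 1 / (\<beta> - 1)" using assms by (simp add: field_simps)
  ultimately show ?thesis by (simp add: power_one_over)
qed

lemma val_summable:
  assumes "1 < \<beta>" shows "summable (\<lambda>i. of_bool (d i) / \<beta> ^ Suc i :: real)"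
  by (rule summable_comparison_test'[OF sums_summable[OF geometric_tail_sums[OF assms]], of 0])
     (use assms in \<open>auto simp: divide_simps\<close>)

lemma val_sums: "1 < \<beta> \<Longrightarrow> (\<lambda>i. of_bool (d i) / \<beta> ^ Suc i :: real) sums val \<beta> d"
  unfolding val_def by (rule summable_sums[OF val_summable])

lemma is_expansion_iff: "1 < \<beta> \<Longrightarrow> is_expansion_of_1 \<beta> d \<longleftrightarrow> val \<beta> d = 1"
  unfolding is_expansion_of_1_def using val_sums sums_unique2 by metis

lemma val_nonneg: "1 < \<beta> \<Longrightarrow> 0 \<le> val \<beta> d"
  unfolding val_def by (rule suminf_nonneg[OF val_summable]) auto

lemma val_flip: assumes "1 < \<beta>" shows "val \<beta> (flip d) = 1 / (\<beta> - 1) - val \<beta> d"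
proof -
  have "(\<lambda>i. 1 / \<beta> ^ Suc i - of_bool (d i) / \<beta> ^ Suc i) sums (1 / (\<beta> - 1) - val \<beta> d)"
    by (intro sums_diff geometric_tail_sums val_sums assms)
  moreover have "(\<lambda>i. 1 / \<beta> ^ Suc i - of_bool (d i) / \<beta> ^ Suc i) = (\<lambda>i. of_bool (flip d i) / \<beta> ^ Suc i)"
    by (auto simp: fun_eq_iff)
  ultimately show ?thesis using val_sums[OF assms, of "flip d"] sums_unique2 by fastforce
qed

lemma val_le_total: "1 < \<beta> \<Longrightarrow> val \<beta> d \<le> 1 / (\<beta> - 1)"
  using val_nonneg[of \<beta> "flip d"] val_flip[of \<beta> d] by simp

lemma val_unfold: assumes "1 < \<beta>" shows "val \<beta> d = (of_bool (d 0) + val \<beta> (shift 1 d)) / \<beta>"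
proof -
  have "val \<beta> d = (\<Sum>i. of_bool (d (Suc i)) / \<beta> ^ Suc (Suc i)) + of_bool (d 0) / \<beta>"
    using suminf_split_head[OF val_summable[OF assms, of d]] unfolding val_def by simp
  also have "(\<Sum>i. of_bool (d (Suc i)) / \<beta> ^ Suc (Suc i)) = (\<Sum>i. of_bool (shift 1 d i) / \<beta> ^ Suc i / \<beta>)"
    by (simp add: mult.commute shift_apply)
  also have "\<dots> = val \<beta> (shift 1 d) / \<beta>"
    unfolding val_def by (rule suminf_divide[OF val_summable[OF assms]])
  finally show ?thesis by (simp add: add_divide_distrib)
qed

lemma val_shift_Suc:
  assumes "1 < \<beta>" shows "val \<beta> (shift (Suc i) d) = \<beta> * val \<beta> (shift i d) - of_bool (d i)"
  using val_unfold[OF assms, of "shift i d"] assms by (simp add: field_simps shift_apply)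

text \<open>Two orbits of an affine recurrence that read the same digits separate at the exponential
  rate of the slope; nearly all arguments below compare two orbits in this way.\<close>

lemma orbit_diff:
  fixes y z :: "nat \<Rightarrow> real"
  assumes "\<And>i. i < n \<Longrightarrow> y (Suc i) = \<beta> * y i - c i" "\<And>i. i < n \<Longrightarrow> z (Suc i) = \<beta> * z i - c i"
  shows "y n - z n = \<beta> ^ n * (y 0 - z 0)"
  using assms
proof (induction n)
  case (Suc n)
  then have "y n - z n = \<beta> ^ n * (y 0 - z 0)" by simp
  moreover have "y (Suc n) - z (Suc n) = \<beta> * (y n - z n)"
    using Suc.prems(1)[of n] Suc.prems(2)[of n] by (simp add: algebra_simps)
  ultimately show ?case by simp
qed simp

lemma expanding_bounded_eq_0:
  fixes x :: real
  assumes "1 < \<beta>" "\<And>n. \<beta> ^ n * \<bar>x\<bar> \<le> M" shows "x = 0"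
proof (rule ccontr)
  assume "x \<noteq> 0"
  obtain n where "M / \<bar>x\<bar> < \<beta> ^ n" using real_arch_pow[OF assms(1)] by blast
  with assms(2)[of n] \<open>x \<noteq> 0\<close> show False by (simp add: field_simps)
qed

text \<open>By expansivity, two bounded orbits that read the same digits coincide.\<close>
lemma val_unique:
  assumes "1 < \<beta>" "\<And>i. y (Suc i) = \<beta> * y i - of_bool (d i)" "\<And>i. \<bar>y i\<bar> \<le> M"
  shows "y 0 = val \<beta> d"
proof -
  have "\<beta> ^ n * \<bar>y 0 - val \<beta> d\<bar> \<le> M + 1 / (\<beta> - 1)" for n
  proof -
    have "y n - val \<beta> (shift n d) = \<beta> ^ n * (y 0 - val \<beta> (shift 0 d))"
      using orbit_diff[of n y \<beta> "\<lambda>i. of_bool (d i)" "\<lambda>i. val \<beta> (shift i d)"]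
        assms(2) val_shift_Suc[OF assms(1)] by simp
    then have "\<beta> ^ n * \<bar>y 0 - val \<beta> d\<bar> = \<bar>y n - val \<beta> (shift n d)\<bar>"
      using assms(1) by (simp add: abs_mult)
    also have "\<dots> \<le> \<bar>y n\<bar> + \<bar>val \<beta> (shift n d)\<bar>" by simp
    also have "\<dots> \<le> M + 1 / (\<beta> - 1)"
      using assms(3) val_nonneg[OF assms(1)] val_le_total[OF assms(1)] by (intro add_mono) auto
    finally show ?thesis .
  qed
  then show ?thesis using expanding_bounded_eq_0[OF assms(1)] by fastforce
qed

lemma val_agree:
  assumes "1 < \<beta>" "\<And>i. i < n \<Longrightarrow> d i = e i"
  shows "val \<beta> (shift n d) - val \<beta> (shift n e) = \<beta> ^ n * (val \<beta> d - val \<beta> e)"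
  using orbit_diff[of n "\<lambda>i. val \<beta> (shift i d)" \<beta> "\<lambda>i. of_bool (d i)" "\<lambda>i. val \<beta> (shift i e)"]
    assms val_shift_Suc[OF assms(1)] by simp

lemma val_pos: assumes "1 < \<beta>" "d i" shows "0 < val \<beta> d"
  unfolding val_def
  by (rule suminf_pos2[OF val_summable[OF assms(1)], of _ i]) (use assms in auto)

lemma val_antimono:
  assumes "1 < \<beta>" "\<beta> \<le> \<beta>'" shows "val \<beta>' d \<le> val \<beta> d"
  unfolding val_def
  by (intro suminf_le val_summable) (use assms in \<open>auto simp: power_mono divide_simps simp del: power_Suc\<close>)

text \<open>Monotonicity in the base, applied to the flipped sequence, gives a modulus of continuity that
  does not depend on the digits.\<close>
lemma val_diff_le:
  assumes "1 < \<beta>" "\<beta> \<le> \<beta>'" shows "val \<beta> d - val \<beta>' d \<le> 1 / (\<beta> - 1) - 1 / (\<beta>' - 1)"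
  using val_antimono[OF assms, of "flip d"] val_flip[of \<beta> d] val_flip[of \<beta>' d] assms by simp

text \<open>The first digit alone already makes the value drop at a definite rate.\<close>

lemma val_diff_ge:
  assumes "1 < \<beta>" "\<beta> \<le> \<beta>'" "d 0" shows "1 / \<beta> - 1 / \<beta>' \<le> val \<beta> d - val \<beta>' d"
proof -
  have "val \<beta>' (shift 1 d) / \<beta>' \<le> val \<beta> (shift 1 d) / \<beta>"
    using val_antimono[OF assms(1,2)] val_nonneg[of \<beta>] assms by (intro frac_le) auto
  then show ?thesis
    using val_unfold[of \<beta> d] val_unfold[of \<beta>' d] assms by (simp add: add_divide_distrib)
qed

lemma val_strict_antimono:
  assumes "1 < \<beta>" "\<beta> < \<beta>'" "d 0" shows "val \<beta>' d < val \<beta> d"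
  using val_diff_ge[of \<beta> \<beta>' d] assms frac_less2[of 1 1 \<beta> \<beta>'] by simp

lemma isCont_val: assumes "1 < \<beta>" shows "isCont (\<lambda>\<beta>. val \<beta> d) \<beta>"
proof -
  have "((\<lambda>x. \<bar>1 / (x - 1) - 1 / (\<beta> - 1)\<bar>) \<longlongrightarrow> \<bar>1 / (\<beta> - 1) - 1 / (\<beta> - 1)\<bar>) (at \<beta>)"
    using assms by (intro tendsto_intros) auto
  then have lim: "((\<lambda>x. \<bar>1 / (x - 1) - 1 / (\<beta> - 1)\<bar>) \<longlongrightarrow> 0) (at \<beta>)" by simp
  have "\<forall>\<^sub>F x in at \<beta>. 1 < x"
    using order_tendstoD(1)[OF tendsto_ident_at assms] .
  then have "\<forall>\<^sub>F x in at \<beta>. norm (val x d - val \<beta> d) \<le> \<bar>1 / (x - 1) - 1 / (\<beta> - 1)\<bar>"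
  proof eventually_elim
    case (elim x)
    show ?case
      using val_diff_le[of x \<beta> d] val_diff_le[of \<beta> x d] val_antimono[of x \<beta> d] val_antimono[of \<beta> x d] assms elim
      unfolding real_norm_def by (cases "x \<le> \<beta>") linarith+
  qed
  then have "((\<lambda>x. val x d - val \<beta> d) \<longlongrightarrow> 0) (at \<beta>)"
    using lim by (rule Lim_null_comparison)
  then show ?thesis unfolding isCont_def by (rule LIM_zero_cancel)
qed

text \<open>A possible excess over 1 shrinks under iteration: where \<open>d\<close> first differs from \<open>k\<close> it has the
  digit 0 instead of 1, so the excess of \<open>d\<close> is at most \<open>1 / \<beta>\<close> times that of a later shift.\<close>
lemma val_le_1_of_lexle:
  assumes "1 < \<beta>" "\<And>n. lexle (shift n d) k" "val \<beta> k \<le> 1"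
  shows "val \<beta> (shift n d) \<le> 1"
proof -
  have bd: "val \<beta> (shift n d) \<le> 1 + (1/\<beta>) ^ m / (\<beta> - 1)" for n m
  proof (induction m arbitrary: n)
    case 0
    show ?case using val_le_total[OF assms(1), of "shift n d"] by simp
  next
    case (Suc m)
    show ?case
    proof (cases "shift n d = k")
      case True
      then show ?thesis using assms(1,3) by (simp add: add_increasing2)
    next
      case False
      then obtain j where j: "\<forall>i<j. shift n d i = k i" "\<not> shift n d j" "k j"
        using lexle_first_difference assms(2) by blast
      have "\<not> shift (n + j) d 0" using j(2) by (simp add: shift_apply)
      then have "val \<beta> (shift (n + j) d) \<le> (1 + (1/\<beta>) ^ m / (\<beta> - 1)) / \<beta>"
        using val_unfold[OF assms(1), of "shift (n + j) d"] Suc.IH[of "n + j + 1"] assms(1)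
        by (simp add: divide_right_mono)
      moreover have "1 / \<beta> \<le> val \<beta> (shift j k)"
        using val_unfold[OF assms(1), of "shift j k"] j(3) val_nonneg[OF assms(1)] assms(1)
        by (simp add: divide_right_mono shift_apply)
      ultimately have "\<beta> ^ j * (val \<beta> (shift n d) - val \<beta> k) \<le> (1/\<beta>) ^ m / (\<beta> - 1) / \<beta>"
        using val_agree[OF assms(1), of j "shift n d" k] j(1) by (simp add: add_divide_distrib)
      moreover have "val \<beta> (shift n d) - val \<beta> k \<le> max 0 (\<beta> ^ j * (val \<beta> (shift n d) - val \<beta> k))"
        using assms(1) mult_right_mono[of 1 "\<beta> ^ j" "val \<beta> (shift n d) - val \<beta> k"]
        by (cases "val \<beta> (shift n d) \<le> val \<beta> k") auto
      moreover have "0 \<le> (1/\<beta>) ^ m / (\<beta> - 1) / \<beta>" using assms(1) by simp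
      ultimately have "val \<beta> (shift n d) - val \<beta> k \<le> (1/\<beta>) ^ m / (\<beta> - 1) / \<beta>" by linarith
      then show ?thesis using assms(3) by (simp add: mult.commute)
    qed
  qed
  have "(\<lambda>m. 1 + (1/\<beta>) ^ m / (\<beta> - 1)) \<longlonglongrightarrow> 1 + 0 / (\<beta> - 1)"
    using assms(1) by (intro tendsto_intros LIMSEQ_power_zero) auto
  then have "(\<lambda>m. 1 + (1/\<beta>) ^ m / (\<beta> - 1)) \<longlonglongrightarrow> 1" by simp
  then show ?thesis by (rule LIMSEQ_le_const) (use bd in blast)
qed

lemma val_diff_first_difference:
  assumes "1 < \<beta>" "\<forall>i<j. d i = k i" "\<not> d j" "k j"
  shows "\<beta> ^ Suc j * (val \<beta> k - val \<beta> d) = 1 + val \<beta> (shift (Suc j) k) - val \<beta> (shift (Suc j) d)"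
proof -
  have "\<beta> ^ Suc j * (val \<beta> k - val \<beta> d) = \<beta> * (val \<beta> (shift j k) - val \<beta> (shift j d))"
    using val_agree[OF assms(1), of j k d] assms(2) by simp
  then show ?thesis
    using val_shift_Suc[OF assms(1), of j k] val_shift_Suc[OF assms(1), of j d] assms(3,4)
    by (simp add: right_diff_distrib)
qed

text \<open>For arbitrary digit sequences and \<open>\<beta> < 2\<close>, values need not respect the lexicographic order. It is
  the bound on all shifts of \<open>d\<close> that makes them do so.\<close>
lemma val_mono_lexle:
  assumes "1 < \<beta>" "\<And>n. lexle (shift n d) k" "val \<beta> k \<le> 1"
  shows "val \<beta> d \<le> val \<beta> k"
proof (cases "d = k")
  case False
  then obtain j where j: "\<forall>i<j. d i = k i" "\<not> d j" "k j"
    using lexle_first_difference assms(2)[of 0] by auto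
  have "0 \<le> \<beta> ^ Suc j * (val \<beta> k - val \<beta> d)"
    unfolding val_diff_first_difference[OF assms(1) j]
    using val_le_1_of_lexle[OF assms, of "Suc j"] val_nonneg[OF assms(1), of "shift (Suc j) k"] by simp
  then show ?thesis using assms(1) zero_less_power[of \<beta> "Suc j"]
    by (simp add: zero_le_mult_iff del: power_Suc zero_less_power)
qed simp

lemma val_strict_mono_lexle:
  assumes "1 < \<beta>" "\<And>n. lexle (shift n d) k" "val \<beta> k \<le> 1" "d \<noteq> k" "\<And>n. \<exists>i. k (n + i)"
  shows "val \<beta> d < val \<beta> k"
proof -
  obtain j where j: "\<forall>i<j. d i = k i" "\<not> d j" "k j"
    using lexle_first_difference assms(2)[of 0] assms(4) by auto
  obtain i where "shift (Suc j) k i" using assms(5)[of "Suc j"] by (auto simp: shift_apply)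
  then have "0 < val \<beta> (shift (Suc j) k)" by (rule val_pos[OF assms(1)])
  then have "0 < \<beta> ^ Suc j * (val \<beta> k - val \<beta> d)"
    unfolding val_diff_first_difference[OF assms(1) j]
    using val_le_1_of_lexle[OF assms(1-3), of "Suc j"] by simp
  then show ?thesis using assms(1) by (simp add: zero_less_mult_iff del: power_Suc)
qed

section \<open>Symmetric Lorenz maps and their kneading sequences\<close>

definition sgd :: "bool \<Rightarrow> real" where "sgd b = (if b then 1 else -1)"

text \<open>At the discontinuity the left branch is used. So \<open>0\<close> is mapped to \<open>1\<close>, and the map sends the
  half-open interval \<open>(-1, 1]\<close> to itself without attaining \<open>-1\<close>.\<close>
definition lorenz :: "real \<Rightarrow> real \<Rightarrow> real" where
  "lorenz s x = s * x - sgd (0 < x)"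

definition crit :: "real \<Rightarrow> nat \<Rightarrow> real" where "crit s i = (lorenz s ^^ i) 1"

definition itin :: "real \<Rightarrow> real \<Rightarrow> nat \<Rightarrow> bool" where
  "itin s x i \<longleftrightarrow> 0 < (lorenz s ^^ i) x"

definition knead :: "real \<Rightarrow> nat \<Rightarrow> bool" where "knead s = itin s 1"

text \<open>The constraint is symmetric under reflection: both \<open>d\<close> and \<open>flip d\<close> have all shifts at most \<open>k\<close>.\<close>
definition sym_shift :: "(nat \<Rightarrow> bool) \<Rightarrow> (nat \<Rightarrow> bool) set" where
  "sym_shift k = {d. \<forall>n. lexle (shift n d) k \<and> lexle (flip (shift n d)) k}"

lemma sgd_simps [simp]: "sgd True = 1" "sgd False = -1" "sgd (\<not> b) = - sgd b"
  by (auto simp: sgd_def)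

lemma lorenz_range:
  assumes "1 < s" "s \<le> 2" "-1 < x" "x \<le> 1"
  shows "-1 < lorenz s x \<and> lorenz s x \<le> 1"
proof (cases "0 < x")
  case True
  then have "s * x \<le> 2 * 1" using assms by (intro mult_mono) auto
  moreover have "0 < s * x" using True assms by simp
  ultimately show ?thesis using True by (simp add: lorenz_def sgd_def)
next
  case False
  then have "s * x \<le> 0" using assms by (simp add: mult_nonneg_nonpos)
  moreover have "s * (- x) < 2"
  proof -
    have "s * (-x) \<le> 2 * (-x)" using False assms by (intro mult_right_mono) auto
    then show ?thesis using assms by simp
  qed
  ultimately show ?thesis using False by (simp add: lorenz_def sgd_def)
qed

lemma lorenz_iter_range:
  assumes "1 < s" "s \<le> 2" "-1 < x" "x \<le> 1"
  shows "-1 < (lorenz s ^^ n) x \<and> (lorenz s ^^ n) x \<le> 1"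
  by (induction n) (use assms lorenz_range in auto)

lemma lorenz_iter_Suc: "(lorenz s ^^ Suc n) x = s * (lorenz s ^^ n) x - sgd (itin s x n)"
  by (simp add: lorenz_def itin_def)

lemma crit_0 [simp]: "crit s 0 = 1" by (simp add: crit_def)

lemma crit_Suc: "crit s (Suc i) = s * crit s i - sgd (knead s i)"
  unfolding crit_def knead_def by (rule lorenz_iter_Suc)

lemma knead_iff: "knead s i \<longleftrightarrow> 0 < crit s i"
  by (simp add: knead_def crit_def itin_def)

lemma crit_range: "1 < s \<Longrightarrow> s \<le> 2 \<Longrightarrow> -1 < crit s i \<and> crit s i \<le> 1"
  unfolding crit_def by (rule lorenz_iter_range) auto

lemma knead_0 [simp]: "knead s 0" by (simp add: knead_iff)

lemma shift_itin: "shift n (itin s x) = itin s ((lorenz s ^^ n) x)"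
  by (simp add: fun_eq_iff itin_def shift_apply funpow_add add.commute[of n])

lemma lexle_itin:
  assumes "1 < s" "x \<le> y" shows "lexle (itin s x) (itin s y)"
  unfolding lexle_def
proof (intro allI impI)
  fix n assume a: "\<forall>i<n. itin s x i = itin s y i" "itin s x n"
  have "(lorenz s ^^ n) y - (lorenz s ^^ n) x = s ^ n * (y - x)"
    using orbit_diff[of n "\<lambda>i. (lorenz s ^^ i) y" s "\<lambda>i. sgd (itin s x i)" "\<lambda>i. (lorenz s ^^ i) x"] a(1)
    by (simp add: lorenz_iter_Suc del: funpow.simps(2))
  moreover have "0 \<le> s ^ n * (y - x)" using assms by simp
  ultimately show "itin s y n" using a(2) unfolding itin_def by linarith
qed

text \<open>The reflected bound compares the orbit of \<open>x\<close> with the mirror image of the orbit of \<open>1\<close>.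
  That mirror image starts at \<open>- 1\<close> and uses the opposite convention at the discontinuity, which
  is harmless because \<open>- 1 < x\<close> is strict.\<close>

lemma lexle_flip_itin:
  assumes "1 < s" "-1 < x" shows "lexle (flip (itin s x)) (knead s)"
  unfolding lexle_def
proof (intro allI impI)
  fix n assume a: "\<forall>i<n. flip (itin s x) i = knead s i" "flip (itin s x) n"
  have "sgd (knead s i) = - sgd (itin s x i)" if "i < n" for i
  proof -
    have "knead s i = (\<not> itin s x i)" using a(1) that by (metis flip_apply)
    then show ?thesis by simp
  qed
  then have "(lorenz s ^^ n) x - (- crit s n) = s ^ n * ((lorenz s ^^ 0) x - (- crit s 0))"
    by (intro orbit_diff[of n _ s "\<lambda>i. sgd (itin s x i)"]) (auto simp: lorenz_iter_Suc crit_Suc simp del: funpow.simps)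
  then have "(lorenz s ^^ n) x + crit s n = s ^ n * (x + 1)" by simp
  moreover have "0 < s ^ n * (x + 1)" using assms by simp
  ultimately show "knead s n" using a(2) by (simp add: itin_def knead_iff)
qed

lemma itin_in_sym_shift:
  assumes "1 < s" "s \<le> 2" "-1 < x" "x \<le> 1"
  shows "itin s x \<in> sym_shift (knead s)"
  unfolding sym_shift_def knead_def[symmetric]
  using lorenz_iter_range[OF assms] assms(1)
  by (simp add: shift_itin lexle_flip_itin) (simp add: knead_def lexle_itin)

lemma knead_in_sym_shift: "1 < s \<Longrightarrow> s \<le> 2 \<Longrightarrow> knead s \<in> sym_shift (knead s)"
  using itin_in_sym_shift[of s 1] by (simp add: knead_def)

text \<open>The substitution \<open>y = (x + 1 / (s - 1)) / 2\<close> turns the digits \<open>-1\<close> and \<open>1\<close> of the Lorenz map into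
  \<open>0\<close> and \<open>1\<close>.\<close>
lemma val_knead:
  assumes "1 < s" "s \<le> 2"
  shows "val s (shift n (knead s)) = (crit s n + 1 / (s - 1)) / 2"
proof -
  define y where "y i = (crit s (n + i) + 1 / (s - 1)) / 2" for i
  have "y (Suc i) = s * y i - of_bool (shift n (knead s) i)" for i
  proof -
    have "sgd b = 2 * of_bool b - 1" for b by (simp add: sgd_def)
    then have "y (Suc i) = s * y i - of_bool (knead s (n + i)) + (1 + 1 / (s - 1) - s * (1 / (s - 1))) / 2"
      unfolding y_def add_Suc_right crit_Suc by (simp add: field_simps)
    moreover have "1 + 1 / (s - 1) - s * (1 / (s - 1)) = 0" using assms by (simp add: field_simps)
    ultimately show ?thesis by (simp add: shift_apply)
  qed
  moreover have "\<bar>y i\<bar> \<le> (1 + 1 / (s - 1)) / 2" for i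
    using crit_range[OF assms, of "n + i"] assms unfolding y_def
    by (simp add: abs_le_iff add_pos_nonneg add_increasing)
  ultimately have "y 0 = val s (shift n (knead s))" using assms by (intro val_unique)
  then show ?thesis by (simp add: y_def)
qed

lemma knead_infinite:
  assumes "1 < s" "s \<le> 2" shows "\<exists>i. knead s (n + i)"
proof (rule ccontr)
  assume "\<not> ?thesis"
  then have "val s (shift n (knead s)) = 0" by (simp add: val_def shift_apply)
  moreover have "1 \<le> 1 / (s - 1)" using assms by simp
  ultimately show False using val_knead[OF assms, of n] crit_range[OF assms, THEN conjunct1, of n] by simp
qed

subsection \<open>Monotonicity\<close>

text \<open>As long as the digits agree, the difference of the two critical orbits satisfies
  \<open>D (i + 1) = a * D i + (b - a) * crit b i\<close>. Once it exceeds \<open>(b - a) / (a - 1)\<close> it grows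
  exponentially, so the digits have to differ, and then the larger orbit has the larger digit.\<close>

lemma knead_less_of_escape:
  assumes s: "1 < a" "a < b" "b \<le> 2"
    and start: "\<And>j. j \<le> m \<Longrightarrow> (\<forall>i<j. knead a i = knead b i) \<Longrightarrow> crit a j \<le> crit b j"
    and large: "(\<forall>i<m. knead a i = knead b i) \<Longrightarrow> (b - a) / (a - 1) < crit b m - crit a m"
  shows "\<not> lexle (knead b) (knead a)"
proof -
  have step: "crit b (Suc j) - crit a (Suc j) = a * (crit b j - crit a j) + (b - a) * crit b j"
    if "knead a j = knead b j" for j
    using that by (simp add: crit_Suc algebra_simps)
  have grow: "(b - a) / (a - 1) + a ^ i * (crit b m - crit a m - (b - a) / (a - 1)) \<le> crit b (m + i) - crit a (m + i)"
    if "\<forall>l<m + i. knead a l = knead b l" for i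
    using that
  proof (induction i)
    case (Suc i)
    have c: "- (b - a) \<le> (b - a) * crit b (m + i)"
      using crit_range[of b "m + i"] s mult_left_mono[of "-1" "crit b (m+i)" "b - a"] by simp
    have "a * ((b - a) / (a - 1) + a ^ i * (crit b m - crit a m - (b - a) / (a - 1)))
        \<le> a * (crit b (m + i) - crit a (m + i))"
      using Suc s by (intro mult_left_mono) auto
    moreover have "a * ((b - a) / (a - 1)) - (b - a) = (b - a) / (a - 1)"
      using s by (simp add: field_simps)
    ultimately show ?case using c step[of "m + i"] Suc.prems by (simp add: algebra_simps)
  qed simp
  have ne: "knead a \<noteq> knead b"
  proof
    assume eq: "knead a = knead b"
    define g where "g = crit b m - crit a m - (b - a) / (a - 1)"
    have "0 < g" using large eq by (simp add: g_def)
    have "a ^ i * \<bar>g\<bar> \<le> 2" for i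
    proof -
      have "0 \<le> (b - a) / (a - 1)" using s by simp
      moreover have "(b - a) / (a - 1) + a ^ i * g \<le> crit b (m + i) - crit a (m + i)"
        using grow[of i] eq by (simp add: g_def)
      moreover have "crit b (m + i) \<le> 1" "- 1 < crit a (m + i)"
        using crit_range s by auto
      ultimately show ?thesis using \<open>0 < g\<close> by simp
    qed
    then have "g = 0" using expanding_bounded_eq_0 s(1) by blast
    then show False using \<open>0 < g\<close> by simp
  qed
  then obtain j where j: "\<forall>i<j. knead a i = knead b i" "knead a j \<noteq> knead b j"
    by (rule first_difference)
  have "crit a j \<le> crit b j"
  proof (cases "j \<le> m")
    case True
    then show ?thesis using start j by blast
  next
    case False
    then obtain i where i: "j = m + i" using le_Suc_ex nat_le_linear by blast
    have "0 \<le> (b - a) / (a - 1)" using s by simp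
    moreover have "0 \<le> a ^ i * (crit b m - crit a m - (b - a) / (a - 1))"
      using large j(1) False s by (intro mult_nonneg_nonneg) auto
    ultimately show ?thesis using grow[of i] j(1) i by simp
  qed
  then have "\<not> knead a j \<and> knead b j" using j(2) by (auto simp: knead_iff)
  then show ?thesis unfolding lexle_def using j(1) by fastforce
qed

text \<open>For slopes between \<open>sqrt 2\<close> and \<open>2\<close> the threshold is passed after three or four steps. Three steps
  fall just short of it when both slopes are near \<open>sqrt 2\<close>, but then \<open>crit b 3 = (b - 1)\<^sup>2 (b + 1)\<close> is
  nonnegative and the fourth step is enough.\<close>
lemma knead_less_upper:
  assumes s: "2 \<le> a ^ 2" "1 < a" "a < b" "b \<le> 2"
  shows "\<not> lexle (knead b) (knead a)"
proof -
  have a: "1.414 \<le> a"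
  proof (rule ccontr)
    assume "\<not> 1.414 \<le> a"
    then have "a * a < 1.414 * 1.414" using s by (intro mult_strict_mono) auto
    then show False using s by (simp add: power2_eq_square)
  qed
  have step: "crit b (Suc j) - crit a (Suc j) = a * (crit b j - crit a j) + (b - a) * crit b j"
    if "knead a j = knead b j" for j
    using that by (simp add: crit_Suc algebra_simps)
  have crit_a_1: "crit a 1 = a - 1" using crit_Suc[of a 0] by simp
  have c1: "crit b 1 = b - 1" using crit_Suc[of b 0] by simp
  have c2: "crit b 2 = b * (b - 1) - 1" using crit_Suc[of b 1] c1 s by (simp add: knead_iff numeral_2_eq_2)
  have d1: "crit b 1 - crit a 1 = (b - a) * 1" using step[of 0] by simp
  have d2: "crit b 2 - crit a 2 = (b - a) * (a + b - 1)" if "\<forall>i<2. knead a i = knead b i"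
  proof -
    have "crit b 2 - crit a 2 = a * (crit b 1 - crit a 1) + (b - a) * crit b 1"
      using step[of 1] that by (simp add: numeral_2_eq_2)
    then show ?thesis unfolding c1 crit_a_1 by (simp add: algebra_simps)
  qed
  have d3: "crit b 3 - crit a 3 = (b - a) * (a * (a + b - 1) + (b * (b - 1) - 1))" if "\<forall>i<3. knead a i = knead b i"
  proof -
    have "crit b 3 - crit a 3 = a * (crit b 2 - crit a 2) + (b - a) * crit b 2"
      using step[of 2] that by (simp add: numeral_3_eq_3 numeral_2_eq_2)
    also have "crit b 2 - crit a 2 = (b - a) * (a + b - 1)" using that d2 by simp
    finally show ?thesis unfolding c2 by (simp add: algebra_simps)
  qed
  have p2: "0 \<le> (b - a) * (a + b - 1)" using s by (intro mult_nonneg_nonneg) auto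
  have lowq: "b * (b - 1) - 1 \<ge> a * (a - 1) - 1" using s by (intro diff_right_mono mult_mono) auto
  have q3: "a * (a + b - 1) + (b * (b - 1) - 1) \<ge> 2.16"
  proof -
    have "a * (a + b - 1) \<ge> a * (a + a - 1)" using s by (intro mult_left_mono) auto
    moreover have "a * (a + a - 1) + (a * (a - 1) - 1) = 3 * a^2 - 2 * a - 1"
      by (simp add: power2_eq_square algebra_simps)
    moreover have "3 * a^2 - 2 * a - 1 \<ge> 2.16"
    proof -
      have "0 \<le> (a - 1.414) * (3 * a + 2.242)" using a by (intro mult_nonneg_nonneg) auto
      then have "3 * a^2 - 2 * a - 3.170188 \<ge> 0" by (simp add: power2_eq_square algebra_simps)
      then show ?thesis by simp
    qed
    ultimately show ?thesis using lowq by linarith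
  qed
  have p3: "0 \<le> (b - a) * (a * (a + b - 1) + (b * (b - 1) - 1))"
    using s q3 by (intro mult_nonneg_nonneg) auto
  have e1: "crit a 1 \<le> crit b 1" unfolding c1 crit_a_1 using s by simp
  have e2: "crit a 2 \<le> crit b 2" if "\<forall>i<2. knead a i = knead b i"
    using d2[OF that] p2 by linarith
  have e3: "crit a 3 \<le> crit b 3" if "\<forall>i<3. knead a i = knead b i"
    using d3[OF that] p3 by linarith
  have inv: "1 / (a - 1) \<le> 2.4155" using a by (simp add: field_simps)
  have quot: "(b - a) / (a - 1) < (b - a) * q" if "1 / (a - 1) < q" for q
    using that s mult_strict_left_mono[of "1 / (a - 1)" q "b - a"] by simp
  show ?thesis
  proof (cases "b < 1.5")
    case True
    have c3: "crit b 3 = b * (b * (b - 1) - 1) + 1"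
    proof -
      have "b * (b - 1) \<le> 1.5 * (0.5)" using True s by (intro mult_mono) auto
      then show ?thesis using crit_Suc[of b 2] c2 by (simp add: knead_iff numeral_3_eq_3 numeral_2_eq_2)
    qed
    have c3': "0 \<le> crit b 3"
    proof -
      have "b * (b * (b - 1) - 1) + 1 = (b - 1)^2 * (b + 1)" by (simp add: power2_eq_square algebra_simps)
      then show ?thesis using c3 s by simp
    qed
    have d4: "crit b 4 - crit a 4 = (b - a) * (a * (a * (a + b - 1) + (b * (b - 1) - 1)) + crit b 3)"
      if "\<forall>i<4. knead a i = knead b i"
    proof -
      have "crit b 3 - crit a 3 = (b - a) * (a * (a + b - 1) + (b * (b - 1) - 1))" using that d3 by simp
      moreover have "crit b 4 - crit a 4 = a * (crit b 3 - crit a 3) + (b - a) * crit b 3"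
        using step[of 3] that by (simp add: eval_nat_numeral)
      ultimately show ?thesis by (simp only: distrib_left mult.left_commute)
    qed
    have q4: "1 / (a - 1) < a * (a * (a + b - 1) + (b * (b - 1) - 1)) + crit b 3"
    proof -
      have "1.414 * 2.16 \<le> a * (a * (a + b - 1) + (b * (b - 1) - 1))"
        using a q3 by (intro mult_mono) auto
      moreover have "1 / (a - 1) < 1.414 * 2.16" by (rule le_less_trans[OF inv]) simp
      ultimately show ?thesis using c3' by linarith
    qed
    have p4: "0 \<le> (b - a) * (a * (a * (a + b - 1) + (b * (b - 1) - 1)) + crit b 3)"
    proof -
      have "0 \<le> a * (a * (a + b - 1) + (b * (b - 1) - 1))"
        using s q3 by (intro mult_nonneg_nonneg[of a]) auto
      then show ?thesis using s c3' by (intro mult_nonneg_nonneg[of "b - a"] add_nonneg_nonneg) auto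
    qed
    have e4: "crit a 4 \<le> crit b 4" if "\<forall>i<4. knead a i = knead b i"
      using d4[OF that] p4 by linarith
    show ?thesis
    proof (rule knead_less_of_escape[where m = 4])
      fix j :: nat assume "j \<le> 4" "\<forall>i<j. knead a i = knead b i"
      moreover from this have "j = 0 \<or> j = 1 \<or> j = 2 \<or> j = 3 \<or> j = 4" by linarith
      ultimately show "crit a j \<le> crit b j" using e1 e2 e3 e4 by (elim disjE) auto
    qed (use s d4 quot[OF q4] in auto)
  next
    case False
    have q3': "1 / (a - 1) < a * (a + b - 1) + (b * (b - 1) - 1)"
    proof -
      have "1.414 * (1.414 + 1.5 - 1) \<le> a * (a + b - 1)" using a s False by (intro mult_mono) auto
      moreover have "1.5 * 0.5 \<le> b * (b - 1)" using False by (intro mult_mono) auto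
      ultimately show ?thesis using inv by simp
    qed
    show ?thesis
    proof (rule knead_less_of_escape[where m = 3])
      fix j :: nat assume "j \<le> 3" "\<forall>i<j. knead a i = knead b i"
      moreover from this have "j = 0 \<or> j = 1 \<or> j = 2 \<or> j = 3" by linarith
      ultimately show "crit a j \<le> crit b j" using e1 e2 e3 by (elim disjE) auto
    qed (use s d3 quot[OF q3'] in auto)
  qed
qed

subsection \<open>Renormalisation\<close>

text \<open>Near the discontinuity the second iterate of the map of slope \<open>s\<close> is a copy of the map of
  slope \<open>s ^ 2\<close>, scaled by \<open>s - 1\<close>; every second point of the critical orbit lies in that copy.\<close>

lemma crit_renormalise:
  assumes "1 < s" "s ^ 2 \<le> 2"
  shows "crit s (2 * j + 1) = (s - 1) * crit (s ^ 2) j"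
    and "crit s (2 * j + 2) = s * ((s - 1) * crit (s ^ 2) j) - sgd (knead (s ^ 2) j)"
    and "knead s (2 * j + 1) = knead (s ^ 2) j"
    and "knead s (2 * j + 2) \<longleftrightarrow> \<not> knead (s ^ 2) j"
proof -
  have s2: "1 < s ^ 2" using assms(1) by simp
  have small: "s * (s - 1) < 1"
  proof -
    have "s * (s - 1) = s ^ 2 - s" by (simp add: power2_eq_square algebra_simps)
    then show ?thesis using assms by linarith
  qed
  have nxt: "knead s (2 * j + 1) = knead (s ^ 2) j \<and>
      crit s (2 * j + 2) = s * ((s - 1) * crit (s ^ 2) j) - sgd (knead (s ^ 2) j) \<and>
      (knead s (2 * j + 2) \<longleftrightarrow> \<not> knead (s ^ 2) j)"
    if "crit s (2 * j + 1) = (s - 1) * crit (s ^ 2) j" for j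
  proof -
    have k1: "knead s (2 * j + 1) = knead (s ^ 2) j"
      using that assms by (simp add: knead_iff zero_less_mult_iff)
    have c2: "crit s (2 * j + 2) = s * ((s - 1) * crit (s ^ 2) j) - sgd (knead (s ^ 2) j)"
      using crit_Suc[of s "2 * j + 1"] that k1 by simp
    have "\<bar>s * ((s - 1) * crit (s ^ 2) j)\<bar> < 1"
    proof -
      have "\<bar>s * ((s - 1) * crit (s ^ 2) j)\<bar> = (s * (s - 1)) * \<bar>crit (s ^ 2) j\<bar>"
        using assms by (simp add: abs_mult)
      also have "\<dots> \<le> (s * (s - 1)) * 1"
        using crit_range[OF s2 assms(2), of j] assms(1) by (intro mult_left_mono) auto
      finally show ?thesis using small by simp
    qed
    then have "knead s (2 * j + 2) \<longleftrightarrow> \<not> knead (s ^ 2) j"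
      using c2 by (auto simp: knead_iff[of s] sgd_def split: if_splits)
    with k1 c2 show ?thesis by blast
  qed
  have main: "crit s (2 * j + 1) = (s - 1) * crit (s ^ 2) j" for j
  proof (induction j)
    case 0
    show ?case using crit_Suc[of s 0] by simp
  next
    case (Suc j)
    have c2: "crit s (2 * j + 2) = s * ((s - 1) * crit (s ^ 2) j) - sgd (knead (s ^ 2) j)"
      and k2: "knead s (2 * j + 2) \<longleftrightarrow> \<not> knead (s ^ 2) j"
      using nxt[OF Suc.IH] by blast+
    have "crit s (2 * Suc j + 1) = s * crit s (2 * j + 2) - sgd (knead s (2 * j + 2))"
      using crit_Suc[of s "2 * j + 2"] by simp
    also have "\<dots> = (s - 1) * (s ^ 2 * crit (s ^ 2) j - sgd (knead (s ^ 2) j))"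
      unfolding c2 k2 sgd_simps by (simp add: power2_eq_square algebra_simps)
    finally show ?case by (simp add: crit_Suc)
  qed
  show "crit s (2 * j + 1) = (s - 1) * crit (s ^ 2) j"
    and "crit s (2 * j + 2) = s * ((s - 1) * crit (s ^ 2) j) - sgd (knead (s ^ 2) j)"
    and "knead s (2 * j + 1) = knead (s ^ 2) j"
    and "knead s (2 * j + 2) \<longleftrightarrow> \<not> knead (s ^ 2) j"
    using main nxt by blast+
qed

lemma nat_cases_renormalise:
  fixes n :: nat
  obtains "n = 0" | j where "n = 2 * j + 1" | j where "n = 2 * j + 2"
  by (cases n) (auto, metis Suc_eq_plus1 add_2_eq_Suc' dvd_def odd_two_times_div_two_succ even_Suc)

lemma knead_less_renormalise:
  assumes "1 < a" "a ^ 2 \<le> 2" "1 < b" "b ^ 2 \<le> 2"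
    and "\<not> lexle (knead (b ^ 2)) (knead (a ^ 2))"
  shows "\<not> lexle (knead b) (knead a)"
proof -
  obtain n where n: "\<forall>i<n. knead (b ^ 2) i = knead (a ^ 2) i" "knead (b ^ 2) n" "\<not> knead (a ^ 2) n"
    using assms(5) unfolding lexle_def by blast
  have "knead b i = knead a i" if "i < 2 * n + 1" for i
    by (rule nat_cases_renormalise[of i]) (use that n(1) crit_renormalise(3,4) assms(1-4) in auto)
  moreover have "knead b (2 * n + 1)" "\<not> knead a (2 * n + 1)"
    using n crit_renormalise(3) assms(1-4) by auto
  ultimately show ?thesis unfolding lexle_def by blast
qed

text \<open>Squaring both slopes leads to larger slopes with the same order of kneading sequences. If the
  squares lie on different sides of 2, the slope \<open>sqrt 2\<close> is inserted between the two.\<close>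
lemma knead_less_iter:
  assumes "1 < a" "a < b" "b \<le> 2" "2 \<le> a ^ (2 ^ Suc n)"
  shows "\<not> lexle (knead b) (knead a)"
  using assms
proof (induction n arbitrary: a b)
  case 0
  then show ?case using knead_less_upper by simp
next
  case (Suc n)
  have sq: "x < y \<Longrightarrow> 1 < x \<Longrightarrow> x ^ 2 < y ^ 2" for x y :: real
    by (rule power_strict_mono) auto
  have "(a ^ 2) ^ (2 ^ Suc n) = a ^ (2 ^ Suc (Suc n))" by (simp flip: power_mult)
  then have pw: "2 \<le> (a ^ 2) ^ (2 ^ Suc n)" using Suc.prems(4) by (simp only:)
  have a2: "1 < a ^ 2" using Suc.prems(1) by simp
  consider "2 \<le> a ^ 2" | "b ^ 2 \<le> 2" | "a ^ 2 < 2" "2 < b ^ 2" by linarith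
  then show ?case
  proof cases
    case 1
    then show ?thesis using knead_less_upper Suc.prems by blast
  next
    case 2
    then have "\<not> lexle (knead (b ^ 2)) (knead (a ^ 2))"
      using Suc.IH[OF a2 sq[OF Suc.prems(2,1)] _ pw] by blast
    moreover have "a ^ 2 \<le> 2" using 2 sq[OF Suc.prems(2,1)] by linarith
    ultimately show ?thesis
      using knead_less_renormalise[of a b] 2 Suc.prems(1,2) by linarith
  next
    case 3
    have r: "1 < sqrt 2" "a < sqrt 2" "sqrt 2 < b" "sqrt 2 ^ 2 = 2"
      using 3 Suc.prems real_less_rsqrt[of a 2] real_less_lsqrt[of b 2] by auto
    have "\<not> lexle (knead (sqrt 2 ^ 2)) (knead (a ^ 2))"
      using Suc.IH[OF a2 _ _ pw, of "sqrt 2 ^ 2"] 3 r(4) by linarith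
    then have "\<not> lexle (knead (sqrt 2)) (knead a)"
      using knead_less_renormalise[of a "sqrt 2"] Suc.prems(1) 3 r by linarith
    moreover have "\<not> lexle (knead b) (knead (sqrt 2))"
      using knead_less_upper[of "sqrt 2" b] r Suc.prems(3) by linarith
    ultimately show ?thesis using lexle_trans lexle_total by blast
  qed
qed

theorem knead_strict_mono:
  assumes "1 < a" "a < b" "b \<le> 2"
  shows "\<not> lexle (knead b) (knead a)"
proof -
  obtain n where "2 < a ^ n" using real_arch_pow[OF assms(1)] by blast
  moreover have "n \<le> 2 ^ Suc n" using less_exp[of "Suc n"] by simp
  ultimately have "2 \<le> a ^ (2 ^ Suc n)" using assms(1) power_increasing[of n "2 ^ Suc n" a] by linarith
  then show ?thesis using knead_less_iter assms by blast
qed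

subsection \<open>The Thue--Morse sequence as the limit of kneading sequences\<close>

definition tm :: "nat \<Rightarrow> bool" where "tm i = thue_morse (Suc i)"

lemma thue_morse_even: "thue_morse (2 * n) = thue_morse n"
proof -
  have "{k. bit (2 * n) k} = Suc ` {k. bit n k}"
  proof (intro set_eqI)
    fix k show "k \<in> {k. bit (2 * n) k} \<longleftrightarrow> k \<in> Suc ` {k. bit n k}"
      by (cases k) (auto simp: bit_0 bit_Suc)
  qed
  then show ?thesis unfolding thue_morse_def by (simp add: card_image)
qed

lemma thue_morse_odd: "thue_morse (2 * n + 1) \<longleftrightarrow> \<not> thue_morse n"
proof -
  have "{k. bit (2 * n + 1) k} = insert 0 (Suc ` {k. bit n k})"
  proof (intro set_eqI)
    fix k show "k \<in> {k. bit (2 * n + 1) k} \<longleftrightarrow> k \<in> insert 0 (Suc ` {k. bit n k})"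
      by (cases k) (auto simp: bit_0 bit_Suc)
  qed
  moreover have "finite {k. bit n k}"
  proof (rule finite_subset)
    show "{k. bit n k} \<subseteq> {..<n}"
    proof
      fix k assume "k \<in> {k. bit n k}"
      then have "n div 2 ^ k \<noteq> 0" by (auto simp: bit_iff_odd dest: odd_pos)
      then have "2 ^ k \<le> n" by (metis div_less not_le)
      then have "k < n" using less_exp[of k] by linarith
      then show "k \<in> {..<n}" by simp
    qed
  qed simp
  ultimately show ?thesis unfolding thue_morse_def by (simp add: card_image)
qed

lemma tm_0 [simp]: "tm 0"
proof -
  have "{k. bit (0::nat) k} = {}" by (auto simp: bit_iff_odd)
  then have "\<not> thue_morse 0" unfolding thue_morse_def by (simp only: card.empty) simp
  then show ?thesis using thue_morse_odd[of 0] by (simp add: tm_def)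
qed

lemma tm_odd: "tm (2 * j + 1) = tm j"
  using thue_morse_even[of "Suc j"] by (simp add: tm_def)

lemma tm_even: "tm (2 * j + 2) = (\<not> tm j)"
  using thue_morse_odd[of "Suc j"] by (simp add: tm_def)

text \<open>Repeated square roots of the full slope 2.\<close>
definition slope :: "nat \<Rightarrow> real" where "slope i = 2 powr (1 / 2 ^ i)"

lemma slope_range: "1 < slope i" "slope i \<le> 2"
proof -
  show "1 < slope i" by (simp add: slope_def)
  have "(2::real) powr (1 / 2 ^ i) \<le> 2 powr 1" by (intro powr_mono) auto
  then show "slope i \<le> 2" by (simp add: slope_def)
qed

lemma slope_square: "slope (Suc i) ^ 2 = slope i"
  by (simp add: slope_def power2_eq_square flip: powr_add)

lemma slope_tendsto: "slope \<longlonglongrightarrow> 1"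
proof -
  have "(\<lambda>i. (2::real) powr ((1/2) ^ i)) \<longlonglongrightarrow> 2 powr 0"
    by (intro tendsto_intros LIMSEQ_power_zero) auto
  then show ?thesis by (simp add: slope_def[abs_def] power_one_over)
qed

text \<open>The sequence \<open>tm\<close> satisfies the renormalisation recursion of kneading sequences with itself on both
  sides, so each square root doubles the length of the agreement.\<close>
lemma knead_slope: "i < 2 ^ n \<Longrightarrow> knead (slope n) i = tm i"
proof (induction n arbitrary: i)
  case (Suc n)
  have r: "1 < slope (Suc n)" "slope (Suc n) ^ 2 \<le> 2"
    using slope_range slope_square by auto
  show ?case
    by (rule nat_cases_renormalise[of i])
      (use Suc crit_renormalise(3,4)[OF r] tm_odd tm_even in \<open>auto simp: slope_square\<close>)
qed simp

text \<open>The kneading sequences of slopes tending to 1 converge to \<open>tm\<close>, and they are below \<open>knead s\<close> as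
  soon as the slope is below \<open>s\<close>.\<close>
lemma tm_less_knead:
  assumes "1 < s" "s \<le> 2"
  shows "lexle (shift n tm) (knead s)" and "tm \<noteq> knead s"
proof -
  have le: "lexle (shift n tm) (knead t)" if "1 < t" "t \<le> 2" for n t
    unfolding lexle_def
  proof (intro allI impI)
    fix m assume a: "\<forall>i<m. shift n tm i = knead t i" "shift n tm m"
    have "\<forall>\<^sub>F i in sequentially. slope i < t"
      using order_tendstoD(2)[OF slope_tendsto] that by blast
    then obtain i where i: "i \<ge> n + m + 1" "slope i < t"
      unfolding eventually_sequentially by (metis max.cobounded1 max.cobounded2)
    have "n + m + 1 < 2 ^ i" using i(1) less_exp[of i] by linarith
    then have "shift n (knead (slope i)) l = shift n tm l" if "l \<le> m" for l
      using knead_slope[of "n + l" i] that by (simp add: shift_apply)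
    moreover have "lexle (shift n (knead (slope i))) (knead t)"
    proof -
      have "lexle (shift n (knead (slope i))) (knead (slope i))"
        using knead_in_sym_shift[OF slope_range] by (simp add: sym_shift_def)
      moreover have "lexle (knead (slope i)) (knead t)"
        using knead_strict_mono[OF slope_range(1) i(2) that(2)] lexle_total by blast
      ultimately show ?thesis by (rule lexle_trans)
    qed
    ultimately show "knead t m" using a unfolding lexle_def by (metis less_imp_le_nat order_refl)
  qed
  then show "lexle (shift n tm) (knead s)" using assms .
  obtain t where t: "1 < t" "t < s" using dense assms(1) by blast
  then have "lexle tm (knead t)" using le[of t 0] assms by simp
  then show "tm \<noteq> knead s" using knead_strict_mono[OF t assms(2)] by auto
qed

section \<open>Counting words\<close>

lemma disjoint_intervals_count:
  fixes a :: "'a \<Rightarrow> real" and l :: real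
  assumes "finite W" "0 \<le> l" "M \<in> fmeasurable lborel"
    and "\<And>w. w \<in> W \<Longrightarrow> {a w<..<a w + l} \<subseteq> M"
    and "\<And>w w' x. w \<in> W \<Longrightarrow> w' \<in> W \<Longrightarrow> x \<in> {a w<..<a w + l} \<Longrightarrow> x \<in> {a w'<..<a w' + l} \<Longrightarrow> w = w'"
  shows "card W * l \<le> measure lborel M"
proof -
  have "measure lborel (\<Union>w\<in>W. {a w<..<a w + l}) = (\<Sum>w\<in>W. measure lborel {a w<..<a w + l})"
  proof (rule measure_finite_Union)
    show "disjoint_family_on (\<lambda>w. {a w<..<a w + l}) W"
      unfolding disjoint_family_on_def using assms(5) by (intro ballI impI equals0I) blast
  qed (use assms(1,2) in auto)
  moreover have "measure lborel (\<Union>w\<in>W. {a w<..<a w + l}) \<le> measure lborel M"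
    using assms(1,3,4) by (intro measure_mono_fmeasurable) auto
  ultimately show ?thesis using assms(2) by simp
qed

lemma class_cover:
  fixes M :: "real set" and r :: real
  assumes "\<And>x. x \<in> M \<Longrightarrow> (f x :: 'a) \<in> W" "\<And>x y. x \<in> M \<Longrightarrow> y \<in> M \<Longrightarrow> f x = f y \<Longrightarrow> \<bar>x - y\<bar> \<le> r"
  shows "\<exists>c :: 'a \<Rightarrow> real. M \<subseteq> (\<Union>w\<in>W. {c w - r..c w + r})"
proof -
  define c where "c w = (SOME x. x \<in> M \<and> f x = w)" for w
  have "x \<in> {c (f x) - r..c (f x) + r}" if "x \<in> M" for x
  proof -
    have "c (f x) \<in> M \<and> f (c (f x)) = f x"
      unfolding c_def using that someI[of "\<lambda>y. y \<in> M \<and> f y = f x" x] by blast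
    then have "\<bar>x - c (f x)\<bar> \<le> r" using assms(2) that by metis
    then show ?thesis by auto
  qed
  then show ?thesis using assms(1) by blast
qed

lemma class_count:
  fixes M :: "real set" and r :: real
  assumes "finite W" "0 \<le> r" "M \<in> sets lborel"
    and "\<And>x. x \<in> M \<Longrightarrow> f x \<in> W" "\<And>x y. x \<in> M \<Longrightarrow> y \<in> M \<Longrightarrow> f x = f y \<Longrightarrow> \<bar>x - y\<bar> \<le> r"
  shows "measure lborel M \<le> card W * (2 * r)"
proof -
  obtain c :: "_ \<Rightarrow> real" where c: "M \<subseteq> (\<Union>w\<in>W. {c w - r..c w + r})"
    using class_cover[of M f W r] assms(4,5) by metis
  have fm: "(\<Union>w\<in>W. {c w - r..c w + r}) \<in> fmeasurable lborel"
    using assms(1,2) by (intro fmeasurable.finite_UN) (auto simp: fmeasurable_def)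
  have "measure lborel M \<le> measure lborel (\<Union>w\<in>W. {c w - r..c w + r})"
    using c assms(3) fm by (rule measure_mono_fmeasurable)
  also have "\<dots> \<le> (\<Sum>w\<in>W. measure lborel {c w - r..c w + r})"
    using assms(1) by (intro measure_UNION_le) auto
  also have "\<dots> = card W * (2 * r)" using assms(2) by simp
  finally show ?thesis .
qed

lemma finite_words: "finite (words Z n :: bool list set)"
  by (rule finite_subset[OF _ finite_lists_length_eq[of "UNIV :: bool set" n]]) (auto simp: words_def)

lemma words_prefix: "d \<in> Z \<Longrightarrow> map d [0..<n] \<in> words Z n"
  unfolding words_def by (auto intro!: exI[of _ d] exI[of _ 0])

text \<open>Two points with the same first \<open>n\<close> digits are at most \<open>2 / s ^ n\<close> apart, since their distance is
  multiplied by \<open>s ^ n\<close> within an interval of length 2.\<close>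
lemma card_words_ge:
  assumes "1 < s" "s \<le> 2" shows "s ^ n / 2 \<le> card (words (sym_shift (knead s)) n)"
proof -
  have "measure lborel {-1<..1::real} \<le> card (words (sym_shift (knead s)) n) * (2 * (2 / s ^ n))"
  proof (rule class_count[where f = "\<lambda>x. map (itin s x) [0..<n]"])
    fix x :: real assume "x \<in> {-1<..1}"
    then show "map (itin s x) [0..<n] \<in> words (sym_shift (knead s)) n"
      using itin_in_sym_shift[OF assms] by (intro words_prefix) auto
  next
    fix x y :: real assume xy: "x \<in> {-1<..1}" "y \<in> {-1<..1}"
      and eq: "map (itin s x) [0..<n] = map (itin s y) [0..<n]"
    then have "itin s x i = itin s y i" if "i < n" for i
      using that by auto
    then have "(lorenz s ^^ n) y - (lorenz s ^^ n) x = s ^ n * (y - x)"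
      using orbit_diff[of n "\<lambda>i. (lorenz s ^^ i) y" s "\<lambda>i. sgd (itin s x i)" "\<lambda>i. (lorenz s ^^ i) x"]
      by (simp add: lorenz_iter_Suc del: funpow.simps(2))
    then have "s ^ n * \<bar>x - y\<bar> = \<bar>(lorenz s ^^ n) y - (lorenz s ^^ n) x\<bar>"
      using assms by (simp add: abs_mult abs_minus_commute)
    also have "\<dots> \<le> 2"
    proof -
      have "-1 < (lorenz s ^^ n) x" "(lorenz s ^^ n) x \<le> 1" "-1 < (lorenz s ^^ n) y" "(lorenz s ^^ n) y \<le> 1"
        using lorenz_iter_range[OF assms] xy by auto
      then show ?thesis by linarith
    qed
    finally show "\<bar>x - y\<bar> \<le> 2 / s ^ n" using assms by (simp add: field_simps)
  qed (use assms in \<open>auto intro: finite_words\<close>)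
  then show ?thesis using assms by (simp add: field_simps)
qed

text \<open>The core is the interval \<open>[1 / (\<beta> - 1) - 1, 1]\<close>, which is invariant under the reflection
  \<open>y \<mapsto> 1 / (\<beta> - 1) - y\<close>. The endpoints belong to it, so that sequences bounded by an expansion of 1
  also give core orbits.\<close>
definition core_orbit :: "real \<Rightarrow> bool list \<Rightarrow> (nat \<Rightarrow> real) \<Rightarrow> bool" where
  "core_orbit \<beta> u y \<longleftrightarrow> (\<forall>i\<le>length u. 1 / (\<beta> - 1) - 1 \<le> y i \<and> y i \<le> 1) \<and>
     (\<forall>i<length u. y (Suc i) = \<beta> * y i - of_bool (u ! i))"

definition core_words :: "real \<Rightarrow> nat \<Rightarrow> bool list set" where
  "core_words \<beta> n = {u. length u = n \<and> (\<exists>y. core_orbit \<beta> u y)}"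

lemma finite_core_words: "finite (core_words \<beta> n)"
  by (rule finite_subset[OF _ finite_lists_length_eq[of "UNIV :: bool set" n]]) (auto simp: core_words_def)

lemma core_orbit_bar:
  assumes "1 < \<beta>" "core_orbit \<beta> u y"
  shows "core_orbit \<beta> (bar u) (\<lambda>i. 1 / (\<beta> - 1) - y i)"
proof -
  have "1 / (\<beta> - 1) - (\<beta> * y i - of_bool b) = \<beta> * (1 / (\<beta> - 1) - y i) - of_bool (\<not> b)" for i b
    using assms(1) by (simp add: field_simps)
  then show ?thesis using assms(2) unfolding core_orbit_def by auto
qed

lemma words_sym_shift_core:
  assumes "1 < \<beta>" "val \<beta> k \<le> 1" shows "words (sym_shift k) n \<subseteq> core_words \<beta> n"
proof
  fix u assume "u \<in> words (sym_shift k) n"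
  then obtain d m where u: "u = map d [m..<m + n]" and d: "d \<in> sym_shift k"
    unfolding words_def by blast
  have up: "val \<beta> (shift i d) \<le> 1" for i
    using d unfolding sym_shift_def by (intro val_le_1_of_lexle[OF assms(1) _ assms(2)]) auto
  have "val \<beta> (shift i (flip d)) \<le> 1" for i
    using d unfolding sym_shift_def by (intro val_le_1_of_lexle[OF assms(1) _ assms(2)]) auto
  then have fl: "val \<beta> (flip (shift i d)) \<le> 1" for i by simp
  have low: "1 / (\<beta> - 1) - 1 \<le> val \<beta> (shift i d)" for i
    using val_flip[OF assms(1), of "shift i d"] fl[of i] by linarith
  have "core_orbit \<beta> u (\<lambda>i. val \<beta> (shift (m + i) d))"
    using up low val_shift_Suc[OF assms(1)] unfolding core_orbit_def u by simp
  then show "u \<in> core_words \<beta> n" unfolding core_words_def u by auto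
qed

lemma core_match:
  assumes "1 < \<beta>" "core_orbit \<beta> u y" "i + l \<le> length u" "\<forall>j<l. u ! (i + j) = k j"
  shows "val \<beta> (shift l k) - y (i + l) = \<beta> ^ l * (val \<beta> k - y i)"
  using orbit_diff[of l "\<lambda>j. val \<beta> (shift j k)" \<beta> "\<lambda>j. of_bool (k j)" "\<lambda>j. y (i + j)"]
    assms val_shift_Suc[OF assms(1)] unfolding core_orbit_def by auto

text \<open>A core orbit starts at a point of size at most 1. So if \<open>k\<close> has value greater than 1, the agreement
  with \<open>k\<close> ends after boundedly many digits.\<close>
lemma core_match_bound:
  assumes "1 < \<beta>" "core_orbit \<beta> u y" "i + l \<le> length u" "\<forall>j<l. u ! (i + j) = k j"
  shows "\<beta> ^ l * (val \<beta> k - 1) \<le> 1"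
proof -
  have y: "y i \<le> 1" "1 / (\<beta> - 1) - 1 \<le> y (i + l)" using assms(2,3) unfolding core_orbit_def by auto
  have "\<beta> ^ l * (val \<beta> k - 1) \<le> \<beta> ^ l * (val \<beta> k - y i)"
    using y(1) assms(1) by (intro mult_left_mono) auto
  also have "\<dots> \<le> 1"
    using core_match[OF assms] y(2) val_le_total[OF assms(1), of "shift l k"] by linarith
  finally show ?thesis .
qed

text \<open>Common digits preserve the order of the two points, and within the core the digits 0 and 1 are
  read on the left and on the right of the hole.\<close>
lemma core_first_difference:
  assumes "1 < \<beta>" "1 < val \<beta> k" "core_orbit \<beta> u y" "i + l < length u"
    and "\<forall>j<l. u ! (i + j) = k j" "u ! (i + l) \<noteq> k l"
  shows "k l" "\<not> u ! (i + l)"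
proof -
  have y: "y i \<le> 1" "1 / (\<beta> - 1) - 1 \<le> y (Suc (i + l))"
    "y (Suc (i + l)) = \<beta> * y (i + l) - of_bool (u ! (i + l))"
    using assms(3,4) unfolding core_orbit_def by (meson Suc_leI add_leD1 less_imp_le_nat)+
  have "val \<beta> (shift l k) - y (i + l) = \<beta> ^ l * (val \<beta> k - y i)"
    using core_match[OF assms(1,3) _ assms(5)] assms(4) by simp
  moreover have "0 < \<beta> ^ l * (val \<beta> k - y i)" using assms(1,2) y(1) by simp
  ultimately have "\<beta> * y (i + l) < \<beta> * val \<beta> (shift l k)" using assms(1) by simp
  moreover have "\<beta> * val \<beta> (shift l k) \<le> 1 / (\<beta> - 1) + of_bool (k l)"
    using val_shift_Suc[OF assms(1), of l k] val_le_total[OF assms(1), of "shift (Suc l) k"] by simp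
  ultimately have "of_bool (u ! (i + l)) < (1 :: real) + of_bool (k l)" using y(2,3) by linarith
  then show "k l" "\<not> u ! (i + l)" using assms(6) by (auto split: if_splits)
qed

text \<open>The inverse branch along the word \<open>u\<close> of an iterate of the Lorenz map.\<close>
definition pull :: "real \<Rightarrow> bool list \<Rightarrow> real \<Rightarrow> real" where
  "pull s u z = foldr (\<lambda>b x. (x + sgd b) / s) u z"

text \<open>If a suffix of length \<open>l\<close> agrees with the kneading sequence, then after reading \<open>u\<close> the Lorenz map
  cannot be to the right of \<open>crit s l\<close>.\<close>
definition suffix_match :: "(nat \<Rightarrow> bool) \<Rightarrow> bool list \<Rightarrow> nat \<Rightarrow> bool" where
  "suffix_match k u l \<longleftrightarrow> l \<le> length u \<and> (\<forall>j<l. u ! (length u - l + j) = k j)"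

lemma pull_drop_Suc:
  "i < length u \<Longrightarrow> pull s (drop i u) z = (pull s (drop (Suc i) u) z + sgd (u ! i)) / s"
  by (simp add: pull_def flip: Cons_nth_drop_Suc)

lemma pull_step:
  "0 < s \<Longrightarrow> i < length u \<Longrightarrow> pull s (drop (Suc i) u) z = s * pull s (drop i u) z - sgd (u ! i)"
  by (simp add: pull_drop_Suc)

lemma pull_affine: "pull s u z = pull s u w + (z - w) / s ^ length u"
proof (induction u)
  case (Cons b u)
  have "pull s (b # u) z = (pull s u z + sgd b) / s" by (simp add: pull_def)
  also have "\<dots> = (pull s u w + sgd b) / s + (z - w) / s ^ length u / s"
    unfolding Cons.IH by (simp add: add_divide_distrib)
  finally show ?case by (simp add: pull_def mult.commute)
qed (simp add: pull_def)

lemma pull_bar: "pull s (bar u) (- z) = - pull s u z"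
proof (induction u)
  case (Cons b u)
  have "(- x - sgd b) / s = - ((x + sgd b) / s)" for x
    by (simp add: add_divide_distrib diff_divide_distrib)
  with Cons show ?case by (simp add: pull_def)
qed (simp add: pull_def)

text \<open>The digits read from position \<open>i\<close> on may agree with the kneading sequence up to the end of the
  word; then the point is below 1 because \<open>z\<close> is below the corresponding point of the critical orbit.
  Otherwise they first differ by a 0 in place of a 1, and at that time the point is on the left of the
  discontinuity and the critical orbit on the right of it.\<close>
lemma pull_less_1:
  assumes "1 < \<beta>" "1 < val \<beta> (knead s)" "core_orbit \<beta> u y" "1 < s"
    and z: "\<And>l. suffix_match (knead s) u l \<Longrightarrow> z < crit s l"
  shows "i \<le> length u \<Longrightarrow> pull s (drop i u) z < 1"
proof (induction "length u - i" arbitrary: i rule: less_induct)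
  case less
  note split = orbit_diff[where y = "\<lambda>j. pull s (drop (i + j) u) z" and z = "crit s"
      and c = "\<lambda>j. sgd (knead s j)" and \<beta> = s]
  show ?case
  proof (cases "\<forall>j<length u - i. u ! (i + j) = knead s j")
    case True
    then have "z < crit s (length u - i)"
      using less.prems by (intro z) (auto simp: suffix_match_def)
    moreover have "pull s (drop (i + (length u - i)) u) z - crit s (length u - i)
        = s ^ (length u - i) * (pull s (drop (i + 0) u) z - crit s 0)"
      using True assms(4) by (intro split) (auto simp: pull_step crit_Suc)
    moreover have "pull s (drop (i + (length u - i)) u) z = z"
      using less.prems by (simp add: pull_def)
    ultimately have "s ^ (length u - i) * (pull s (drop i u) z - 1) < 0" by simp
    then show ?thesis using assms(4) by (simp add: mult_less_0_iff)
  next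
    case False
    define l where "l = (LEAST j. j < length u - i \<and> u ! (i + j) \<noteq> knead s j)"
    from False have "\<exists>j. j < length u - i \<and> u ! (i + j) \<noteq> knead s j" by blast
    then have l: "l < length u - i \<and> u ! (i + l) \<noteq> knead s l"
      unfolding l_def by (rule LeastI_ex)
    have eq: "u ! (i + j) = knead s j" if "j < l" for j
      using that l not_less_Least[of j "\<lambda>j. j < length u - i \<and> u ! (i + j) \<noteq> knead s j"]
      unfolding l_def by auto
    have il: "i + l < length u" using l by linarith
    have dig: "knead s l" "\<not> u ! (i + l)"
      using core_first_difference[OF assms(1-3) il _ conjunct2[OF l]] eq by auto
    have "pull s (drop (Suc (i + l)) u) z < 1"
      using l by (intro less.hyps) auto
    then have "pull s (drop (i + l) u) z < 0"
      using pull_drop_Suc[of "i + l" u s z] l dig assms(4) by (simp add: divide_less_0_iff)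
    moreover have "0 < crit s l" using dig by (simp add: knead_iff)
    moreover have "pull s (drop (i + l) u) z - crit s l = s ^ l * (pull s (drop (i + 0) u) z - crit s 0)"
      using eq assms(4) l by (intro split) (auto simp: pull_step crit_Suc)
    ultimately have "s ^ l * (pull s (drop i u) z - 1) < 0" by simp
    then show ?thesis using assms(4) by (simp add: mult_less_0_iff)
  qed
qed

text \<open>The shorter of the two matches lies inside the longer one. Hence the points to be compared arise
  from \<open>-1\<close> and an earlier point of the critical orbit by reading the same digits.\<close>
lemma suffix_match_opposite:
  assumes "1 < s" "s \<le> 2" "suffix_match (knead s) u l" "suffix_match (knead s) (bar u) l'"
  shows "0 < crit s l + crit s l'"
proof -
  have main: "0 < crit s l + crit s l'"
    if m: "suffix_match (knead s) u l" "suffix_match (knead s) (bar u) l'" and le: "l' \<le> l" for u l l'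
  proof -
    have "knead s (l - l' + j) = (\<not> knead s j)" if "j < l'" for j
    proof -
      have "length u - l + (l - l' + j) = length u - l' + j" "length u - l' + j < length u"
        using m le that unfolding suffix_match_def by auto
      moreover have "u ! (length u - l + (l - l' + j)) = knead s (l - l' + j)"
        using m(1)[unfolded suffix_match_def, THEN conjunct2, rule_format, of "l - l' + j"] le that by simp
      moreover have "(\<not> u ! (length u - l' + j)) = knead s j"
        using m(2)[unfolded suffix_match_def, THEN conjunct2, rule_format, of j] that calculation(2) by simp
      ultimately show ?thesis by metis
    qed
    then have "crit s (l - l' + l') - (- crit s l') = s ^ l' * (crit s (l - l' + 0) - (- crit s 0))"
      by (intro orbit_diff[where c = "\<lambda>j. sgd (knead s (l - l' + j))"]) (auto simp: crit_Suc)
    moreover have "0 < s ^ l' * (crit s (l - l') + 1)"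
      using crit_range[OF assms(1,2), of "l - l'"] assms(1) by (intro mult_pos_pos) auto
    ultimately show ?thesis using le by simp
  qed
  have "bar (bar u) = u" by (simp add: comp_def)
  then show ?thesis
    using main[OF assms(3,4)] main[OF assms(4), of l] assms(3) by (cases "l' \<le> l") auto
qed

text \<open>Each core word is realised by the map of slope \<open>s\<close> on an interval: the image interval after
  reading the word is bounded by those points of the critical orbit, and their mirror images, that
  the suffixes of the word lead to. Because \<open>1 < val \<beta> (knead s)\<close>, only suffixes of bounded length
  matter, so these images have length bounded below.\<close>

proposition card_core_words_le:
  fixes \<beta> s :: real
  assumes "1 < \<beta>" "1 < s" "s \<le> 2" "1 < val \<beta> (knead s)"
  shows "\<exists>C>0. \<forall>n. card (core_words \<beta> n) \<le> C * s ^ n"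
proof -
  define k where "k = knead s"
  obtain L where L: "1 / (val \<beta> k - 1) < \<beta> ^ L" using real_arch_pow[OF assms(1)] by blast
  define D where "D = insert 2 ((\<lambda>(l, l'). crit s l + crit s l') ` ({..L} \<times> {..L}) \<inter> {0<..})"
  define \<delta> where "\<delta> = Min D"
  have finD: "finite D" by (simp add: D_def)
  then have \<delta>: "0 < \<delta>" unfolding \<delta>_def by (subst Min_gr_iff) (auto simp: D_def)
  define A where "A u = Min (crit s ` {l. suffix_match k u l})" for u
  have fin: "finite {l. suffix_match k u l}" for u
    by (rule finite_subset[of _ "{..length u}"]) (auto simp: suffix_match_def)
  have ne: "suffix_match k u 0" for u by (simp add: suffix_match_def)
  have A_le: "A u \<le> crit s l" if "suffix_match k u l" for u l
    unfolding A_def using fin that by (intro Min_le) auto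
  have A_in: "\<exists>l. suffix_match k u l \<and> A u = crit s l" for u
    using Min_in[of "crit s ` {l. suffix_match k u l}"] fin[of u] ne[of u] unfolding A_def by blast
  have short: "l \<le> L" if "core_orbit \<beta> u y" "suffix_match k u l" for u y l
  proof (rule ccontr)
    assume "\<not> l \<le> L"
    have "\<beta> ^ l * (val \<beta> k - 1) \<le> 1"
      using core_match_bound[OF assms(1) that(1), of "length u - l" l k] that(2)
      unfolding suffix_match_def by auto
    moreover have "\<beta> ^ L \<le> \<beta> ^ l" using \<open>\<not> l \<le> L\<close> assms(1) by (intro power_increasing) auto
    moreover have "0 < val \<beta> k - 1" using assms(4) by (simp add: k_def)
    ultimately have "\<beta> ^ L * (val \<beta> k - 1) \<le> 1"
      using mult_right_mono[of "\<beta> ^ L" "\<beta> ^ l" "val \<beta> k - 1"] by linarith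
    then have "\<beta> ^ L \<le> 1 / (val \<beta> k - 1)"
      using \<open>0 < val \<beta> k - 1\<close> by (simp add: pos_le_divide_eq)
    then show False using L by simp
  qed
  have gap: "\<delta> \<le> A u + A (bar u)" if u: "core_orbit \<beta> u y" for u y
  proof -
    obtain l l' where l: "suffix_match k u l" "A u = crit s l" "suffix_match k (bar u) l'" "A (bar u) = crit s l'"
      using A_in by metis
    have "0 < crit s l + crit s l'" using suffix_match_opposite[OF assms(2,3), of u l l'] l unfolding k_def by blast
    moreover have "l \<le> L" "l' \<le> L" using short[OF u l(1)] short[OF core_orbit_bar[OF assms(1) u] l(3)] by auto
    ultimately have "A u + A (bar u) \<in> D" unfolding D_def l(2,4) by force
    then show ?thesis unfolding \<delta>_def using finD by simp
  qed
  have range: "\<bar>pull s (drop i u) z\<bar> < 1"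
    if u: "core_orbit \<beta> u y" and z: "- A (bar u) < z" "z < A u" and i: "i \<le> length u" for u y z i
  proof -
    have "pull s (drop i u) z < 1"
      using A_le z(2) i by (intro pull_less_1[OF assms(1,4) u assms(2)]) (auto simp: k_def intro: less_le_trans)
    moreover have "pull s (drop i (bar u)) (- z) < 1"
    proof (rule pull_less_1[OF assms(1,4) core_orbit_bar[OF assms(1) u] assms(2)])
      fix l assume "suffix_match (knead s) (bar u) l"
      then have "A (bar u) \<le> crit s l" using A_le unfolding k_def by blast
      then show "- z < crit s l" using z(1) by linarith
    qed (use i in simp)
    ultimately show ?thesis using pull_bar[of s "drop i u" z] by (simp add: drop_map)
  qed
  have "card (core_words \<beta> n) \<le> 2 / \<delta> * s ^ n" for n
  proof -
    define a where "a u = pull s u (- A (bar u))" for u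
    have pre: "\<exists>z. x = pull s u z \<and> - A (bar u) < z \<and> z < A u"
      if u: "u \<in> core_words \<beta> n" and x: "x \<in> {a u<..<a u + \<delta> / s ^ n}" for u x
    proof (intro exI conjI)
      obtain y where y: "core_orbit \<beta> u y" and len: "length u = n" using u unfolding core_words_def by blast
      define z where "z = - A (bar u) + (x - a u) * s ^ n"
      show "x = pull s u z"
        using pull_affine[of s u z "- A (bar u)"] assms(2) unfolding a_def[symmetric] z_def len by simp
      have "0 < (x - a u) * s ^ n" using x assms(2) by simp
      then show "- A (bar u) < z" unfolding z_def by simp
      have "(x - a u) * s ^ n < \<delta>" using x assms(2) by (simp add: field_simps)
      then show "z < A u" using gap[OF y] unfolding z_def by simp
    qed
    have "card (core_words \<beta> n) * (\<delta> / s ^ n) \<le> measure lborel {-1<..<1::real}"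
    proof (rule disjoint_intervals_count[where a = a])
      fix u assume u: "u \<in> core_words \<beta> n"
      then obtain y where y: "core_orbit \<beta> u y" unfolding core_words_def by blast
      show "{a u<..<a u + \<delta> / s ^ n} \<subseteq> {-1<..<1}"
      proof
        fix x assume "x \<in> {a u<..<a u + \<delta> / s ^ n}"
        then obtain z where "x = pull s u z" "- A (bar u) < z" "z < A u" using pre[OF u] by blast
        then show "x \<in> {-1<..<1}" using range[OF y, of z 0] by auto
      qed
    next
      fix u u' x
      assume u: "u \<in> core_words \<beta> n" "u' \<in> core_words \<beta> n"
        and x: "x \<in> {a u<..<a u + \<delta> / s ^ n}" "x \<in> {a u'<..<a u' + \<delta> / s ^ n}"
      obtain z where z: "x = pull s u z" "- A (bar u) < z" "z < A u" using pre[OF u(1) x(1)] by blast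
      obtain z' where z': "x = pull s u' z'" "- A (bar u') < z'" "z' < A u'" using pre[OF u(2) x(2)] by blast
      obtain y where y: "core_orbit \<beta> u y" and len: "length u = n" using u unfolding core_words_def by blast
      obtain y' where y': "core_orbit \<beta> u' y'" and len': "length u' = n" using u unfolding core_words_def by blast
      show "u = u'"
      proof (rule ccontr)
        assume "u \<noteq> u'"
        then have "\<exists>i. i < n \<and> u ! i \<noteq> u' ! i" using len len' by (auto simp: list_eq_iff_nth_eq)
        define i where "i = (LEAST i. i < n \<and> u ! i \<noteq> u' ! i)"
        have i: "i < n \<and> u ! i \<noteq> u' ! i"
          unfolding i_def using \<open>\<exists>i. i < n \<and> u ! i \<noteq> u' ! i\<close> by (rule LeastI_ex)
        have "u ! j = u' ! j" if "j < i" for j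
          using that i not_less_Least[of j "\<lambda>i. i < n \<and> u ! i \<noteq> u' ! i"] unfolding i_def by auto
        then have "pull s (drop i u) z - pull s (drop i u') z' = s ^ i * (pull s (drop 0 u) z - pull s (drop 0 u') z')"
          using i len len' assms(2) by (intro orbit_diff[where c = "\<lambda>j. sgd (u ! j)"]) (auto simp: pull_step)
        then have eq: "pull s (drop i u) z = pull s (drop i u') z'" using z(1) z'(1) by simp
        have sgn: "0 < pull s (drop i v) w \<longleftrightarrow> v ! i"
          if "i < length v" "\<bar>pull s (drop (Suc i) v) w\<bar> < 1" for v w
          using pull_drop_Suc[OF that(1), of s w] that(2) assms(2)
          by (cases "v ! i") (auto simp: zero_less_divide_iff)
        have "u ! i = u' ! i"
          using sgn[of u z] sgn[of u' z'] eq i len len' range[OF y z(2,3)] range[OF y' z'(2,3)] by auto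
        then show False using i by blast
      qed
    qed (use \<delta> assms(2) in \<open>auto simp: finite_core_words fmeasurable_def\<close>)
    then have "card (core_words \<beta> n) * (\<delta> / s ^ n) \<le> 2" by simp
    then show ?thesis using \<delta> assms(2) by (simp add: field_simps)
  qed
  moreover have "0 < 2 / \<delta>" using \<delta> by simp
  ultimately show ?thesis by blast
qed

section \<open>First hits of the hole\<close>

lemma greedy_map_range:
  assumes "1 < \<beta>" "\<beta> \<le> 2" "x \<in> {0..<1}" shows "greedy_map \<beta> x \<in> {0..<1}"
proof -
  have "\<beta> * x < \<beta> * 1" using assms by (intro mult_strict_left_mono) auto
  then have "\<beta> * x < 2" using assms(2) by linarith
  then show ?thesis using assms by (auto simp: greedy_map_def field_simps)
qed

lemma greedy_iter_range:
  assumes "1 < \<beta>" "\<beta> \<le> 2" "x \<in> {0..<1}" shows "(greedy_map \<beta> ^^ n) x \<in> {0..<1}"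
proof (induction n)
  case (Suc n)
  then show ?case using greedy_map_range[OF assms(1,2)] by simp
qed (use assms in simp)

lemma first_hit_sets [measurable]: "first_hit \<beta> n \<in> sets borel"
proof -
  have [measurable]: "greedy_map \<beta> \<in> borel_measurable borel"
    unfolding greedy_map_def[abs_def] by measurable
  have [measurable]: "(greedy_map \<beta> ^^ k) \<in> borel_measurable borel" for k
    by (induction k) (auto intro!: measurable_compose[of _ borel _ "greedy_map \<beta>"] simp: comp_def id_def)
  have [measurable]: "hole \<beta> \<in> sets borel" unfolding hole_def by measurable
  have "{x \<in> space borel. x \<in> {0..<1} \<and> (greedy_map \<beta> ^^ n) x \<in> hole \<beta> \<inter> {0..<1} \<and>
      (\<forall>k\<in>{..<n}. (greedy_map \<beta> ^^ k) x \<notin> hole \<beta> \<inter> {0..<1})} \<in> sets borel"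
    by measurable
  then show ?thesis by (simp add: first_hit_def Ball_def)
qed

lemma first_hit_fmeasurable [simp]: "first_hit \<beta> n \<in> fmeasurable lborel"
proof (rule fmeasurableI2)
  show "{0..1::real} \<in> fmeasurable lborel" by (auto simp: fmeasurable_def)
  show "first_hit \<beta> n \<subseteq> {0..1}" unfolding first_hit_def by auto
qed simp

lemma first_hit_Suc:
  assumes "x \<in> {0..<1}" "greedy_map \<beta> x \<in> {0..<1}" "x \<notin> hole \<beta>"
  shows "x \<in> first_hit \<beta> (Suc n) \<longleftrightarrow> greedy_map \<beta> x \<in> first_hit \<beta> n"
proof -
  have "(\<forall>k<Suc n. (greedy_map \<beta> ^^ k) x \<notin> hole \<beta> \<inter> {0..<1}) \<longleftrightarrow>
      (\<forall>k<n. (greedy_map \<beta> ^^ k) (greedy_map \<beta> x) \<notin> hole \<beta> \<inter> {0..<1})"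
    using assms(3) by (simp add: All_less_Suc2 funpow_swap1)
  then show ?thesis using assms by (simp add: first_hit_def funpow_swap1)
qed

lemma first_hit_add:
  assumes "1 < \<beta>" "\<beta> \<le> 2" "x \<in> {0..<1}" "\<And>k. k < n \<Longrightarrow> (greedy_map \<beta> ^^ k) x \<notin> hole \<beta>"
  shows "x \<in> first_hit \<beta> (n + m) \<longleftrightarrow> (greedy_map \<beta> ^^ n) x \<in> first_hit \<beta> m"
  using assms(3,4)
proof (induction n arbitrary: x)
  case (Suc n)
  have "x \<in> first_hit \<beta> (Suc (n + m)) \<longleftrightarrow> greedy_map \<beta> x \<in> first_hit \<beta> (n + m)"
    using Suc.prems(1) Suc.prems(2)[of 0] greedy_map_range[OF assms(1,2)] by (intro first_hit_Suc) auto
  also have "\<dots> \<longleftrightarrow> (greedy_map \<beta> ^^ n) (greedy_map \<beta> x) \<in> first_hit \<beta> m"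
    using Suc.prems(1) Suc.prems(2)[of "Suc k" for k] greedy_map_range[OF assms(1,2)]
    by (intro Suc.IH) (auto simp: funpow_swap1)
  finally show ?case by (simp add: funpow_swap1)
qed simp

subsection \<open>Upper bound\<close>

definition hit_word :: "real \<Rightarrow> nat \<Rightarrow> real \<Rightarrow> bool list" where
  "hit_word \<beta> n x = map (\<lambda>i. \<not> (greedy_map \<beta> ^^ i) x < 1 / \<beta>) [0..<n]"

lemma greedy_iter_Suc:
  "0 < \<beta> \<Longrightarrow> (greedy_map \<beta> ^^ Suc i) x = \<beta> * (greedy_map \<beta> ^^ i) x - of_bool (\<not> (greedy_map \<beta> ^^ i) x < 1 / \<beta>)"
  by (simp add: greedy_map_def)

lemma hit_word_diff:
  assumes "0 < \<beta>" "hit_word \<beta> n x = hit_word \<beta> n y"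
  shows "(greedy_map \<beta> ^^ n) x - (greedy_map \<beta> ^^ n) y = \<beta> ^ n * (x - y)"
proof -
  have "(greedy_map \<beta> ^^ n) x - (greedy_map \<beta> ^^ n) y = \<beta> ^ n * ((greedy_map \<beta> ^^ 0) x - (greedy_map \<beta> ^^ 0) y)"
  proof (rule orbit_diff[where c = "\<lambda>i. of_bool (\<not> (greedy_map \<beta> ^^ i) x < 1 / \<beta>)"])
    fix i assume i: "i < n"
    have "(\<not> (greedy_map \<beta> ^^ i) x < 1 / \<beta>) = (\<not> (greedy_map \<beta> ^^ i) y < 1 / \<beta>)"
      using arg_cong[OF assms(2), of "\<lambda>l. l ! i"] i by (simp add: hit_word_def)
    then show "(greedy_map \<beta> ^^ Suc i) y = \<beta> * (greedy_map \<beta> ^^ i) y - of_bool (\<not> (greedy_map \<beta> ^^ i) x < 1 / \<beta>)"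
      using greedy_iter_Suc[of \<beta> i y] assms(1) by simp
  qed (use assms(1) in \<open>intro greedy_iter_Suc, simp\<close>)
  then show ?thesis by simp
qed

text \<open>Points on the right of the hole are mapped into the core, and points of the core on the left of
  the hole are not moved to the left.\<close>
lemma avoid_hole_core:
  assumes "1 < \<beta>" "\<beta> \<le> 2" "x \<in> {0..<1}" "x \<notin> hole \<beta>" "\<not> x < 1 / \<beta> \<or> 1 / (\<beta> - 1) - 1 \<le> x"
  shows "1 / (\<beta> - 1) - 1 \<le> greedy_map \<beta> x"
proof (cases "x < 1 / \<beta>")
  case True
  then have "1 / (\<beta> - 1) - 1 \<le> 1 * x" using assms(5) by simp
  also have "1 * x \<le> \<beta> * x" using assms by (intro mult_right_mono) auto
  finally show ?thesis using True by (simp add: greedy_map_def)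
next
  case False
  then have "1 / (\<beta> * (\<beta> - 1)) < x" using assms(4) by (simp add: hole_def)
  then have "\<beta> * (1 / (\<beta> * (\<beta> - 1))) \<le> \<beta> * x" using assms(1) by (intro mult_left_mono) auto
  moreover have "\<beta> * (1 / (\<beta> * (\<beta> - 1))) = 1 / (\<beta> - 1)" using assms(1) by (simp add: field_simps)
  ultimately show ?thesis using False by (simp add: greedy_map_def)
qed

text \<open>Until its first digit 1 the orbit may be below the core; afterwards it stays in the core until it
  hits the hole.\<close>
lemma hit_word_cases:
  assumes "1 < \<beta>" "\<beta> \<le> 2" "x \<in> first_hit \<beta> n"
  shows "hit_word \<beta> n x \<in> insert (replicate n False)
    (\<Union>j<n. (\<lambda>u. replicate j False @ True # u) ` core_words \<beta> (n - 1 - j))"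
proof -
  define y where "y i = (greedy_map \<beta> ^^ i) x" for i
  define w where "w i \<longleftrightarrow> \<not> y i < 1 / \<beta>" for i
  have y01: "y i \<in> {0..<1}" for i
    unfolding y_def using assms by (intro greedy_iter_range) (auto simp: first_hit_def)
  have avoid: "y i \<notin> hole \<beta>" if "i < n" for i
    using assms(3) that y01[of i] unfolding first_hit_def y_def by auto
  have ySuc: "y (Suc i) = \<beta> * y i - of_bool (w i)" for i
    unfolding y_def w_def using assms(1) by (intro greedy_iter_Suc) auto
  have hw: "hit_word \<beta> n x = map w [0..<n]" unfolding hit_word_def w_def y_def ..
  show ?thesis
  proof (cases "\<exists>j<n. w j")
    case False
    then have "map w [0..<n] = replicate n False" by (intro nth_equalityI) auto
    then show ?thesis unfolding hw by simp
  next
    case True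
    define j where "j = (LEAST j. j < n \<and> w j)"
    have j: "j < n \<and> w j" unfolding j_def using LeastI_ex[OF True] .
    have before: "\<not> w i" if "i < j" for i
      using that j not_less_Least[of i "\<lambda>j. j < n \<and> w j"] unfolding j_def by auto
    have lower: "1 / (\<beta> - 1) - 1 \<le> y (Suc j + i)" if "Suc j + i \<le> n" for i
      using that
    proof (induction i)
      case 0
      have "1 / (\<beta> - 1) - 1 \<le> greedy_map \<beta> (y j)"
        using j y01 avoid by (intro avoid_hole_core[OF assms(1,2)]) (auto simp: w_def)
      then show ?case by (simp add: y_def)
    next
      case (Suc i)
      have "1 / (\<beta> - 1) - 1 \<le> greedy_map \<beta> (y (Suc j + i))"
        using Suc y01 avoid[of "Suc j + i"] by (intro avoid_hole_core[OF assms(1,2)]) auto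
      then show ?case by (simp add: y_def)
    qed
    define u where "u = map (\<lambda>i. w (Suc j + i)) [0..<n - 1 - j]"
    have "core_orbit \<beta> u (\<lambda>i. y (Suc j + i))"
      unfolding core_orbit_def
    proof (intro conjI allI impI)
      fix i assume "i \<le> length u"
      then show "1 / (\<beta> - 1) - 1 \<le> y (Suc j + i)" using j by (intro lower) (auto simp: u_def)
      show "y (Suc j + i) \<le> 1" using y01[of "Suc j + i"] by simp
    next
      fix i assume "i < length u"
      then show "y (Suc j + Suc i) = \<beta> * y (Suc j + i) - of_bool (u ! i)"
        using ySuc[of "Suc j + i"] by (simp add: u_def)
    qed
    then have u: "u \<in> core_words \<beta> (n - 1 - j)" unfolding core_words_def u_def by auto
    have "map w [0..<n] = replicate j False @ True # u"
    proof (intro nth_equalityI)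
      show "length (map w [0..<n]) = length (replicate j False @ True # u)" using j by (simp add: u_def)
      fix i assume "i < length (map w [0..<n])"
      then have "i < n" by simp
      consider "i < j" | "i = j" | l where "i = Suc (j + l)"
        by (metis linorder_neqE_nat less_imp_Suc_add)
      then show "map w [0..<n] ! i = (replicate j False @ True # u) ! i"
        using j before \<open>i < n\<close> by cases (auto simp: nth_append u_def)
    qed
    then show ?thesis unfolding hw using u j by blast
  qed
qed

text \<open>Points with the same word differ by at most \<open>1 / \<beta> ^ n\<close>, and after the position of the first
  digit 1 the words are core words.\<close>
proposition measure_first_hit_le:
  fixes \<beta> s C :: real
  assumes "1 < \<beta>" "\<beta> \<le> 2" "1 < s" "0 < C" "\<And>n. card (core_words \<beta> n) \<le> C * s ^ n"
  shows "measure lborel (first_hit \<beta> n) \<le> (1 + n * (C * s ^ n)) * (2 / \<beta> ^ n)"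
proof -
  define W where "W = insert (replicate n False)
    (\<Union>j<n. (\<lambda>u. replicate j False @ True # u) ` core_words \<beta> (n - 1 - j))"
  have finW: "finite W" unfolding W_def by (auto simp: finite_core_words)
  have le: "measure lborel (first_hit \<beta> n) \<le> card W * (2 * (1 / \<beta> ^ n))"
  proof (rule class_count[where f = "hit_word \<beta> n"])
    fix x y assume xy: "x \<in> first_hit \<beta> n" "y \<in> first_hit \<beta> n" "hit_word \<beta> n x = hit_word \<beta> n y"
    have "(greedy_map \<beta> ^^ n) x - (greedy_map \<beta> ^^ n) y = \<beta> ^ n * (x - y)"
      using hit_word_diff xy(3) assms(1) by simp
    moreover have "(greedy_map \<beta> ^^ n) x \<in> {0..<1}" "(greedy_map \<beta> ^^ n) y \<in> {0..<1}"
      using xy(1,2) unfolding first_hit_def by auto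
    ultimately have "\<beta> ^ n * \<bar>x - y\<bar> \<le> 1"
      using assms(1) abs_mult[of "\<beta> ^ n" "x - y"] by auto
    then show "\<bar>x - y\<bar> \<le> 1 / \<beta> ^ n" using assms(1) by (simp add: field_simps)
  qed (use assms hit_word_cases finW in \<open>auto simp: W_def\<close>)
  have "card W \<le> 1 + n * (C * s ^ n)"
  proof -
    have "card W \<le> 1 + card (\<Union>j<n. (\<lambda>u. replicate j False @ True # u) ` core_words \<beta> (n - 1 - j))"
      unfolding W_def by (simp add: card_insert_le_m1 card_insert_if finite_core_words)
    also have "\<dots> \<le> 1 + (\<Sum>j<n. card (core_words \<beta> (n - 1 - j)))"
      by (intro add_left_mono order.trans[OF card_UN_le] sum_mono card_image_le finite_core_words) simp
    finally have "card W \<le> 1 + (\<Sum>j<n. real (card (core_words \<beta> (n - 1 - j))))"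
      by (simp flip: of_nat_sum of_nat_Suc)
    also have "(\<Sum>j<n. real (card (core_words \<beta> (n - 1 - j)))) \<le> (\<Sum>j<n. C * s ^ n)"
    proof (intro sum_mono)
      fix j
      have "real (card (core_words \<beta> (n - 1 - j))) \<le> C * s ^ (n - 1 - j)" by (rule assms(5))
      also have "\<dots> \<le> C * s ^ n" using assms(3,4) by (intro mult_left_mono power_increasing) auto
      finally show "real (card (core_words \<beta> (n - 1 - j))) \<le> C * s ^ n" .
    qed
    finally show ?thesis by simp
  qed
  then have "card W * (2 * (1 / \<beta> ^ n)) \<le> (1 + n * (C * s ^ n)) * (2 * (1 / \<beta> ^ n))"
    using assms(1) by (intro mult_right_mono) auto
  then show ?thesis using le by simp
qed

subsection \<open>Lower bound\<close>

text \<open>Prefixing the digit 0 delays the first hit by one step.\<close>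

lemma measure_first_hit_Suc:
  assumes "1 < \<beta>" "\<beta> \<le> 2"
  shows "measure lborel (first_hit \<beta> n) \<le> \<beta> * measure lborel (first_hit \<beta> (Suc n))"
proof -
  define S where "S = (\<lambda>x. 0 + (1 / \<beta>) *\<^sub>R x) ` first_hit \<beta> n"
  have S: "S = (\<lambda>x. \<beta> * x) -` first_hit \<beta> n \<inter> space borel"
    using assms(1) by (force simp: S_def image_iff)
  have [measurable]: "S \<in> sets borel"
    unfolding S by (rule measurable_sets[OF _ first_hit_sets]) simp
  have sub: "S \<subseteq> first_hit \<beta> (Suc n)"
  proof
    fix x assume "x \<in> S"
    then have \<beta>x: "\<beta> * x \<in> first_hit \<beta> n" unfolding S by simp
    then have "0 \<le> \<beta> * x" "\<beta> * x < 1" unfolding first_hit_def by auto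
    then have x: "0 \<le> x" "x < 1 / \<beta>" using assms(1) by (auto simp: zero_le_mult_iff field_simps)
    moreover have "1 / \<beta> < 1" using assms(1) by simp
    ultimately have "x \<in> {0..<1}" by auto
    then show "x \<in> first_hit \<beta> (Suc n)"
      using first_hit_Suc[of x \<beta> n] x \<beta>x \<open>0 \<le> \<beta> * x\<close> \<open>\<beta> * x < 1\<close> by (simp add: greedy_map_def hole_def)
  qed
  have "measure lebesgue S = (1 / \<beta>) * measure lebesgue (first_hit \<beta> n)"
    unfolding S_def using measure_lebesgue_affine[of "1 / \<beta>" 0 "first_hit \<beta> n"] assms(1) by simp
  then have "measure lborel S = (1 / \<beta>) * measure lborel (first_hit \<beta> n)"
    by (simp add: measure_completion)
  moreover have "measure lborel S \<le> measure lborel (first_hit \<beta> (Suc n))"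
    using sub by (intro measure_mono_fmeasurable) auto
  ultimately have "(1 / \<beta>) * measure lborel (first_hit \<beta> n) \<le> measure lborel (first_hit \<beta> (Suc n))" by simp
  then have "\<beta> * ((1 / \<beta>) * measure lborel (first_hit \<beta> n)) \<le> \<beta> * measure lborel (first_hit \<beta> (Suc n))"
    using assms(1) by (intro mult_left_mono) auto
  then show ?thesis using assms(1) by simp
qed

lemma measure_first_hit_add:
  assumes "1 < \<beta>" "\<beta> \<le> 2"
  shows "measure lborel (first_hit \<beta> n) \<le> \<beta> ^ m * measure lborel (first_hit \<beta> (n + m))"
proof (induction m)
  case (Suc m)
  have "\<beta> ^ m * measure lborel (first_hit \<beta> (n + m)) \<le> \<beta> ^ m * (\<beta> * measure lborel (first_hit \<beta> (Suc (n + m))))"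
    using measure_first_hit_Suc[OF assms] assms(1) by (intro mult_left_mono) auto
  then show ?case using Suc by (simp add: mult_ac)
qed simp

text \<open>An interval that meets the hole in a set of small measure loses only a small end piece to it,
  because it cannot contain the hole; what remains is mapped injectively and is expanded by a
  definite factor. Intervals cannot outgrow the unit interval, so this stops after boundedly many
  steps.\<close>

lemma interval_hits_hole:
  assumes \<beta>: "1 < \<beta>" "\<beta> < 2" and \<epsilon>: "0 < \<epsilon>"
  shows "\<exists>K \<delta>. 0 < \<delta> \<and> (\<forall>p q. 0 \<le> p \<longrightarrow> q \<le> 1 \<longrightarrow> \<epsilon> \<le> q - p \<longrightarrow>
    (\<exists>k\<le>K. \<exists>p' q'. p \<le> p' \<and> q' \<le> q \<and> \<delta> \<le> q' - p' \<and> {p'<..<q'} \<subseteq> first_hit \<beta> k))"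
proof -
  define h1 where "h1 = 1 / \<beta>"
  define h2 where "h2 = min 1 (1 / (\<beta> * (\<beta> - 1)))"
  have h1: "0 < h1" "h1 < 1" "\<beta> * h1 = 1" using \<beta> by (auto simp: h1_def)
  have h12: "h1 < h2"
  proof -
    have "\<beta> * (\<beta> - 1) < \<beta> * 1" using \<beta> by (intro mult_strict_left_mono) auto
    then have "1 / \<beta> < 1 / (\<beta> * (\<beta> - 1))" using \<beta> by (intro divide_strict_left_mono) auto
    then show ?thesis using h1 by (simp add: h1_def h2_def)
  qed
  have inside: "x \<in> first_hit \<beta> 0" if "h1 < x" "x < h2" for x
  proof -
    have "0 < x" using that h1 by linarith
    then show ?thesis using that by (auto simp: first_hit_def hole_def h1_def h2_def)
  qed
  \<comment> \<open>chosen such that an interval of length at least \<open>\<epsilon>\<close> that loses a piece of length \<open>\<delta>\<close> is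
    still stretched by the factor \<open>\<gamma>\<close>, half-way between 1 and \<open>\<beta>\<close>\<close>
  define \<delta> where "\<delta> = min (h2 - h1) (\<epsilon> * (\<beta> - 1) / (2 * \<beta>))"
  have \<delta>: "0 < \<delta>" using h12 \<beta> \<epsilon> by (simp add: \<delta>_def)
  have \<delta>\<epsilon>: "\<delta> < \<epsilon>"
  proof -
    have "\<epsilon> * (\<beta> - 1) < \<epsilon> * (2 * \<beta>)" using \<beta> \<epsilon> by (intro mult_strict_left_mono) auto
    then have "\<epsilon> * (\<beta> - 1) / (2 * \<beta>) < \<epsilon>" using \<beta> by (simp add: field_simps)
    then show ?thesis by (simp add: \<delta>_def)
  qed
  define \<gamma> where "\<gamma> = (1 + \<beta>) / 2"
  have \<gamma>: "1 < \<gamma>" using \<beta> by (simp add: \<gamma>_def)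
  have expand: "\<gamma> * L \<le> \<beta> * (L - \<delta>)" if "\<epsilon> \<le> L" for L
  proof -
    have "\<delta> \<le> \<epsilon> * (\<beta> - 1) / (2 * \<beta>)" by (simp add: \<delta>_def)
    also have "\<dots> \<le> L * (\<beta> - 1) / (2 * \<beta>)" using that \<beta> by (intro divide_right_mono mult_right_mono) auto
    finally have "\<beta> * \<delta> \<le> \<beta> * (L * (\<beta> - 1) / (2 * \<beta>))" using \<beta> by (intro mult_left_mono) auto
    also have "\<beta> * (L * (\<beta> - 1) / (2 * \<beta>)) = L * (\<beta> - 1) / 2" using \<beta> by simp
    finally show ?thesis by (simp add: \<gamma>_def field_simps)
  qed
  have main: "\<exists>k\<le>m. \<exists>p' q'. p \<le> p' \<and> q' \<le> q \<and> \<delta> / \<beta> ^ k \<le> q' - p' \<and> {p'<..<q'} \<subseteq> first_hit \<beta> k"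
    if "0 \<le> p" "q \<le> 1" "\<epsilon> \<le> q - p" "1 \<le> \<gamma> ^ m * (q - p)" for p q m
    using that
  proof (induction m arbitrary: p q)
    case 0
    then have "p \<le> h1" "h2 \<le> q" using h1 by (auto simp: h2_def)
    moreover have "{h1<..<h2} \<subseteq> first_hit \<beta> 0" using inside by auto
    moreover have "\<delta> \<le> h2 - h1" by (simp add: \<delta>_def)
    ultimately show ?case by (intro exI[of _ 0] conjI exI[of _ h1] exI[of _ h2]) auto
  next
    case (Suc m)
    define a where "a = max p h1"
    define b where "b = min q h2"
    show ?case
    proof (cases "\<delta> \<le> b - a")
      case True
      have "{a<..<b} \<subseteq> first_hit \<beta> 0"
        using inside by (auto simp: a_def b_def)
      then show ?thesis using True
        by (intro exI[of _ 0] conjI exI[of _ a] exI[of _ b]) (auto simp: a_def b_def)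
    next
      case small: False
      have len: "\<gamma> ^ m * (\<gamma> * (q - p)) \<ge> 1" using Suc.prems(4) by (simp add: mult_ac)
      have "1 * (q - p) \<le> \<gamma> * (q - p)"
        using Suc.prems(3) \<gamma> \<epsilon> by (intro mult_right_mono) auto
      then have "\<epsilon> \<le> \<gamma> * (q - p)" using Suc.prems(3) by simp
      note grown = order.trans[OF this]
      have long: "1 \<le> \<gamma> ^ m * M" if "\<gamma> * (q - p) \<le> M" for M
      proof -
        have "\<gamma> ^ m * (\<gamma> * (q - p)) \<le> \<gamma> ^ m * M" using that \<gamma> by (intro mult_left_mono) auto
        then show ?thesis using len by linarith
      qed
      consider "q < h2" | "h1 < p" "h2 \<le> q"
        using small unfolding a_def b_def \<delta>_def by linarith
      then show ?thesis
      proof cases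
        case 1
        define r where "r = min q h1"
        have r: "q - p - \<delta> \<le> r - p" "r \<le> h1" "r \<le> q"
          using 1 small Suc.prems(3) \<delta>\<epsilon> \<delta> unfolding a_def b_def r_def by auto
        have M: "\<gamma> * (q - p) \<le> \<beta> * r - \<beta> * p"
          using expand[OF Suc.prems(3)] mult_left_mono[OF r(1), of \<beta>] \<beta> by (simp add: right_diff_distrib)
        have "\<beta> * r \<le> \<beta> * h1" using r \<beta> by (intro mult_left_mono) auto
        then obtain k p' q' where k: "k \<le> m" "\<beta> * p \<le> p'" "q' \<le> \<beta> * r" "\<delta> / \<beta> ^ k \<le> q' - p'" "{p'<..<q'} \<subseteq> first_hit \<beta> k"
          using Suc.IH[of "\<beta> * p" "\<beta> * r", OF _ _ grown[OF M] long[OF M]] Suc.prems(1) \<beta> h1(3) by auto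
        have "{p' / \<beta><..<q' / \<beta>} \<subseteq> first_hit \<beta> (Suc k)"
        proof
          fix x assume x: "x \<in> {p' / \<beta><..<q' / \<beta>}"
          then have \<beta>x: "p' < \<beta> * x" "\<beta> * x < q'" using \<beta> by (auto simp: field_simps)
          then have "\<beta> * p < \<beta> * x" "\<beta> * x < \<beta> * r" using k(2,3) by linarith+
          then have "p < x" "x < h1" using \<beta> r(2) by auto
          moreover from this have "x \<in> {0..<1}" using Suc.prems(1) h1(2) by auto
          moreover have "\<beta> * x \<in> first_hit \<beta> k" using k(5) \<beta>x by auto
          ultimately show "x \<in> first_hit \<beta> (Suc k)"
            using first_hit_Suc[of x \<beta> k] Suc.prems(1) h1 greedy_map_range[of \<beta> x] \<beta>
            by (simp add: greedy_map_def hole_def h1_def)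
        qed
        moreover have "\<delta> / \<beta> ^ Suc k \<le> q' / \<beta> - p' / \<beta>"
          using divide_right_mono[OF k(4), of \<beta>] \<beta> by (simp add: diff_divide_distrib mult.commute)
        moreover have "p \<le> p' / \<beta>" using k(2) \<beta> by (simp add: field_simps)
        moreover have "q' / \<beta> \<le> r" using k(3) \<beta> by (simp add: field_simps)
        ultimately show ?thesis using k(1) r(3)
          by (intro exI[of _ "Suc k"] conjI exI[of _ "p' / \<beta>"] exI[of _ "q' / \<beta>"]) auto
      next
        case 2
        define r where "r = max p h2"
        have r: "q - p - \<delta> \<le> q - r" "h2 \<le> r" "p \<le> r"
          using 2 small Suc.prems(3) \<delta>\<epsilon> \<delta> unfolding a_def b_def r_def by auto
        then have "r < q" using Suc.prems(3) \<delta>\<epsilon> by linarith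
        then have h2: "h2 = 1 / (\<beta> * (\<beta> - 1))" using r(2) Suc.prems(2) unfolding h2_def by linarith
        have M: "\<gamma> * (q - p) \<le> (\<beta> * q - 1) - (\<beta> * r - 1)"
          using expand[OF Suc.prems(3)] mult_left_mono[OF r(1), of \<beta>] \<beta> by (simp add: right_diff_distrib)
        have "\<beta> * h1 \<le> \<beta> * r" "\<beta> * q \<le> \<beta> * 1" using r h12 \<beta> Suc.prems(2) by (auto intro!: mult_left_mono)
        then have "0 \<le> \<beta> * r - 1" "\<beta> * q - 1 \<le> 1" using \<beta> h1(3) by linarith+
        then obtain k p' q' where k: "k \<le> m" "\<beta> * r - 1 \<le> p'" "q' \<le> \<beta> * q - 1" "\<delta> / \<beta> ^ k \<le> q' - p'" "{p'<..<q'} \<subseteq> first_hit \<beta> k"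
          using Suc.IH[of "\<beta> * r - 1" "\<beta> * q - 1", OF _ _ grown[OF M] long[OF M]] by blast
        have "{(p' + 1) / \<beta><..<(q' + 1) / \<beta>} \<subseteq> first_hit \<beta> (Suc k)"
        proof
          fix x assume x: "x \<in> {(p' + 1) / \<beta><..<(q' + 1) / \<beta>}"
          then have \<beta>x: "p' < \<beta> * x - 1" "\<beta> * x - 1 < q'" using \<beta> by (auto simp: field_simps)
          then have "\<beta> * r < \<beta> * x" "\<beta> * x < \<beta> * q" using k(2,3) by linarith+
          then have "r < x" "x < q" using \<beta> by auto
          then have "0 \<le> x" "x < 1" and "\<not> x < h1" "h2 < x"
            using h1(1) h12 r(2) Suc.prems(2) by linarith+
          then have x01: "x \<in> {0..<1}" and out: "x \<notin> hole \<beta>" and "\<not> x < 1 / \<beta>"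
            unfolding h1_def h2 hole_def by auto
          then have "greedy_map \<beta> x = \<beta> * x - 1" by (simp add: greedy_map_def)
          moreover have "\<beta> * x - 1 \<in> first_hit \<beta> k" using k(5) \<beta>x by auto
          ultimately show "x \<in> first_hit \<beta> (Suc k)"
            using first_hit_Suc[OF x01 _ out, of k] greedy_map_range[OF \<beta>(1) _ x01] \<beta>(2) by simp
        qed
        moreover have "\<delta> / \<beta> ^ Suc k \<le> (q' + 1) / \<beta> - (p' + 1) / \<beta>"
          using divide_right_mono[OF k(4), of \<beta>] \<beta> by (simp add: diff_divide_distrib add_divide_distrib mult.commute)
        moreover have "r \<le> (p' + 1) / \<beta>" using k(2) \<beta> by (simp add: field_simps)
        moreover have "(q' + 1) / \<beta> \<le> q" using k(3) \<beta> by (simp add: field_simps)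
        ultimately show ?thesis using k(1) r(3)
          by (intro exI[of _ "Suc k"] conjI exI[of _ "(p' + 1) / \<beta>"] exI[of _ "(q' + 1) / \<beta>"]) auto
      qed
    qed
  qed
  obtain K where K: "1 / \<epsilon> < \<gamma> ^ K" using real_arch_pow[OF \<gamma>] by blast
  show ?thesis
  proof (rule exI[of _ K], rule exI[of _ "\<delta> / \<beta> ^ K"], intro conjI allI impI)
    show "0 < \<delta> / \<beta> ^ K" using \<delta> \<beta> by simp
    fix p q assume pq: "0 \<le> p" "q \<le> 1" "\<epsilon> \<le> q - p"
    have "1 \<le> \<gamma> ^ K * \<epsilon>" using K \<epsilon> by (simp add: field_simps)
    also have "\<dots> \<le> \<gamma> ^ K * (q - p)" using pq(3) \<gamma> by (intro mult_left_mono) auto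
    finally obtain k p' q' where k: "k \<le> K" "p \<le> p'" "q' \<le> q" "\<delta> / \<beta> ^ k \<le> q' - p'" "{p'<..<q'} \<subseteq> first_hit \<beta> k"
      using main[OF pq] by blast
    have "\<delta> / \<beta> ^ K \<le> \<delta> / \<beta> ^ k"
      using k(1) \<delta> \<beta> by (intro divide_left_mono power_increasing) auto
    then show "\<exists>k\<le>K. \<exists>p' q'. p \<le> p' \<and> q' \<le> q \<and> \<delta> / \<beta> ^ K \<le> q' - p' \<and> {p'<..<q'} \<subseteq> first_hit \<beta> k"
      using k by (intro exI[of _ k] conjI exI[of _ p'] exI[of _ q']) auto
  qed
qed

text \<open>If \<open>val \<beta> k < 1\<close>, the points coded by \<open>sym_shift k\<close> stay away from the hole by a definite
  distance. So each word of \<open>sym_shift k\<close> is followed by an interval of points that the corresponding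
  iterate maps affinely onto an interval of fixed length.\<close>

lemma shadow_orbit:
  assumes "1 < \<beta>" "\<beta> \<le> 2" "d \<in> sym_shift k" "val \<beta> k < 1" "\<bar>z\<bar> < 1 - val \<beta> k"
    and x: "x = val \<beta> d + z / \<beta> ^ n"
  shows "x \<in> {0..<1}" and "i \<le> n \<Longrightarrow> (greedy_map \<beta> ^^ i) x = val \<beta> (shift i d) + z / \<beta> ^ (n - i)"
    and "i < n \<Longrightarrow> (greedy_map \<beta> ^^ i) x \<notin> hole \<beta>" and "i < n \<Longrightarrow> \<not> (greedy_map \<beta> ^^ i) x < 1 / \<beta> \<longleftrightarrow> d i"
proof -
  define P where "P = val \<beta> k"
  have up: "val \<beta> (shift i d) \<le> P" for i
    using assms(3,4) unfolding sym_shift_def P_def by (intro val_mono_lexle[OF assms(1)]) auto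
  have fl: "val \<beta> (flip (shift i d)) \<le> P" for i
    using assms(3,4) unfolding sym_shift_def P_def
    by (intro val_mono_lexle[OF assms(1)]) auto
  have low: "1 / (\<beta> - 1) - P \<le> val \<beta> (shift i d)" for i
    using val_flip[OF assms(1), of "shift i d"] fl[of i] by linarith
  have one: "1 \<le> 1 / (\<beta> - 1)" using assms(1,2) by simp
  have zb: "\<bar>z / \<beta> ^ j\<bar> < 1 - P" for j
  proof -
    have "\<bar>z / \<beta> ^ j\<bar> \<le> \<bar>z\<bar> / 1"
      unfolding abs_divide using assms(1) by (intro divide_left_mono) auto
    then show ?thesis using assms(5) unfolding P_def by simp
  qed
  have key: "w \<in> {0..<1}" "w \<notin> hole \<beta>" "\<not> w < 1 / \<beta> \<longleftrightarrow> d i" "greedy_map \<beta> w = val \<beta> (shift (Suc i) d) + e"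
    if w: "w = val \<beta> (shift i d) + e / \<beta>" and e: "\<bar>e\<bar> < 1 - P" "\<bar>e / \<beta>\<bar> < 1 - P" for w e i
  proof -
    have "- (1 - P) < e / \<beta>" "e / \<beta> < 1 - P" using e(2) unfolding abs_less_iff by linarith+
    then have "0 \<le> w" "w < 1" using up[of i] low[of i] one unfolding w by linarith+
    then show "w \<in> {0..<1}" by simp
    have \<beta>w: "\<beta> * w = of_bool (d i) + val \<beta> (shift (Suc i) d) + e"
      unfolding w using val_shift_Suc[OF assms(1), of i d] assms(1) by (simp add: distrib_left)
    have t: "1 / (\<beta> - 1) - 1 < val \<beta> (shift (Suc i) d) + e" "val \<beta> (shift (Suc i) d) + e < 1"
      using up[of "Suc i"] low[of "Suc i"] e(1) by linarith+
    have dig: "(\<not> w < 1 / \<beta>) = d i" 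
    proof -
      have "w < 1 / \<beta> \<longleftrightarrow> \<beta> * w < 1" using assms(1) by (simp add: field_simps)
      then show ?thesis unfolding \<beta>w using t one by (cases "d i") auto
    qed
    then show "\<not> w < 1 / \<beta> \<longleftrightarrow> d i" .
    show "w \<notin> hole \<beta>"
    proof (cases "d i")
      case True
      have "1 / (\<beta> - 1) < \<beta> * w" using t True unfolding \<beta>w by simp
      then have "1 / (\<beta> * (\<beta> - 1)) < w" using assms(1) by (simp add: field_simps)
      then show ?thesis by (simp add: hole_def)
    qed (use dig in \<open>simp add: hole_def\<close>)
    show "greedy_map \<beta> w = val \<beta> (shift (Suc i) d) + e"
      using dig \<beta>w by (auto simp: greedy_map_def)
  qed
  have orb: "(greedy_map \<beta> ^^ i) x = val \<beta> (shift i d) + z / \<beta> ^ (n - i)" if "i \<le> n" for i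
    using that
  proof (induction i)
    case (Suc i)
    have "z / \<beta> ^ (n - i) = z / \<beta> ^ (n - Suc i) / \<beta>"
      using Suc.prems by (simp add: Suc_diff_Suc[of i n, symmetric])
    note e = this
    have "greedy_map \<beta> ((greedy_map \<beta> ^^ i) x) = val \<beta> (shift (Suc i) d) + z / \<beta> ^ (n - Suc i)"
    proof (rule key(4))
      show "(greedy_map \<beta> ^^ i) x = val \<beta> (shift i d) + z / \<beta> ^ (n - Suc i) / \<beta>"
        using Suc unfolding e[symmetric] by simp
      show "\<bar>z / \<beta> ^ (n - Suc i) / \<beta>\<bar> < 1 - P" unfolding e[symmetric] by (rule zb)
    qed (rule zb)
    then show ?case by simp
  qed (simp add: x)
  show "(greedy_map \<beta> ^^ i) x = val \<beta> (shift i d) + z / \<beta> ^ (n - i)" if "i \<le> n"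
    using orb[OF that] .
  have "- (1 - P) < z / \<beta> ^ n" "z / \<beta> ^ n < 1 - P" using zb[of n] unfolding abs_less_iff by linarith+
  then have "0 \<le> x" "x < 1" using up[of 0] low[of 0] one unfolding x shift_0 by linarith+
  then show "x \<in> {0..<1}" by simp
  have pre: "(greedy_map \<beta> ^^ i) x = val \<beta> (shift i d) + z / \<beta> ^ (n - Suc i) / \<beta>
      \<and> \<bar>z / \<beta> ^ (n - Suc i)\<bar> < 1 - P \<and> \<bar>z / \<beta> ^ (n - Suc i) / \<beta>\<bar> < 1 - P" if "i < n"
  proof -
    have "z / \<beta> ^ (n - i) = z / \<beta> ^ (n - Suc i) / \<beta>"
      using that by (simp add: Suc_diff_Suc[of i n, symmetric])
    then show ?thesis using orb[of i] that zb[of "n - i"] zb[of "n - Suc i"] by (simp only: less_imp_le)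
  qed
  show "(greedy_map \<beta> ^^ i) x \<notin> hole \<beta>" if "i < n"
    using key(2) pre[OF that] by blast
  show "\<not> (greedy_map \<beta> ^^ i) x < 1 / \<beta> \<longleftrightarrow> d i" if "i < n"
    using key(3) pre[OF that] by blast
qed

proposition measure_first_hit_ge_words:
  assumes "1 < \<beta>" "\<beta> < 2" "val \<beta> k < 1"
  shows "\<exists>c K. 0 < c \<and> (\<forall>n. c * (card (words (sym_shift k) n) / \<beta> ^ n) \<le> measure lborel (first_hit \<beta> (n + K)))"
proof -
  define \<eta> where "\<eta> = 1 - val \<beta> k"
  have \<eta>: "0 < \<eta>" using assms(3) by (simp add: \<eta>_def)
  have \<beta>2: "\<beta> \<le> 2" using assms(2) by simp
  obtain K \<delta> where \<delta>: "0 < \<delta>"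
    and hit: "\<And>p q. 0 \<le> p \<Longrightarrow> q \<le> 1 \<Longrightarrow> 2 * \<eta> \<le> q - p \<Longrightarrow>
      \<exists>j\<le>K. \<exists>p' q'. p \<le> p' \<and> q' \<le> q \<and> \<delta> \<le> q' - p' \<and> {p'<..<q'} \<subseteq> first_hit \<beta> j"
    using interval_hits_hole[OF assms(1,2), of "2 * \<eta>"] \<eta> by (smt (verit))
  have bound: "card (words (sym_shift k) n) * (\<delta> / \<beta> ^ n) \<le> (K + 1) * \<beta> ^ K * measure lborel (first_hit \<beta> (n + K))" for n
  proof -
    define W where "W = words (sym_shift k) n"
    define M where "M = (\<Union>j\<le>K. first_hit \<beta> (n + j))"
    have ex: "\<exists>a. \<forall>x\<in>{a<..<a + \<delta> / \<beta> ^ n}. x \<in> M \<and> hit_word \<beta> n x = w" if wW: "w \<in> W" for w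
    proof -
      obtain d0 m where d0: "w = map d0 [m..<m + n]" "d0 \<in> sym_shift k"
        using wW unfolding W_def words_def by blast
      define d where "d = shift m d0"
      have d: "d \<in> sym_shift k" using d0(2) unfolding d_def sym_shift_def by simp
      have w: "w = map d [0..<n]" unfolding d0(1) d_def by (intro nth_equalityI) (auto simp: shift_apply)
      define y where "y = val \<beta> (shift n d)"
      have y: "y \<le> val \<beta> k"
        using d assms(3) unfolding sym_shift_def y_def by (intro val_mono_lexle[OF assms(1)]) auto
      have "val \<beta> (flip (shift n d)) \<le> val \<beta> k"
        using d assms(3) unfolding sym_shift_def
        by (intro val_mono_lexle[OF assms(1)]) auto
      then have y': "1 / (\<beta> - 1) - val \<beta> k \<le> y"
        using val_flip[OF assms(1), of "shift n d"] unfolding y_def by linarith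
      have "1 \<le> 1 / (\<beta> - 1)" using assms(1) \<beta>2 by simp
      then obtain j p' q' where j: "j \<le> K" "y - \<eta> \<le> p'" "q' \<le> y + \<eta>" "\<delta> \<le> q' - p'" "{p'<..<q'} \<subseteq> first_hit \<beta> j"
        using hit[of "y - \<eta>" "y + \<eta>"] y y' unfolding \<eta>_def by auto
      have "x \<in> M \<and> hit_word \<beta> n x = w"
        if x: "x \<in> {val \<beta> d + (p' - y) / \<beta> ^ n <..< val \<beta> d + (p' - y) / \<beta> ^ n + \<delta> / \<beta> ^ n}" for x
      proof -
        define z where "z = (x - val \<beta> d) * \<beta> ^ n"
        have xz: "x = val \<beta> d + z / \<beta> ^ n" using assms(1) by (simp add: z_def)
        have "(p' - y) / \<beta> ^ n < z / \<beta> ^ n" "z / \<beta> ^ n < (p' - y + \<delta>) / \<beta> ^ n"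
          using x unfolding xz by (auto simp: add_divide_distrib)
        then have z: "p' - y < z" "z < p' - y + \<delta>" using assms(1) by (auto simp: divide_less_cancel)
        then have "\<bar>z\<bar> < 1 - val \<beta> k" using j unfolding \<eta>_def by auto
        note orb = shadow_orbit[OF assms(1) \<beta>2 d assms(3) this xz]
        have "(greedy_map \<beta> ^^ n) x = y + z" using orb(2)[of n] unfolding y_def by simp
        then have "(greedy_map \<beta> ^^ n) x \<in> first_hit \<beta> j" using j(4,5) z by auto
        then have "x \<in> first_hit \<beta> (n + j)" using first_hit_add[OF assms(1) \<beta>2 orb(1)] orb(3) by blast
        moreover have "hit_word \<beta> n x = w" unfolding hit_word_def w using orb(4) by auto
        ultimately show ?thesis using j(1) unfolding M_def by blast
      qed
      then show ?thesis by blast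
    qed
    then obtain a where a: "\<And>w x. w \<in> W \<Longrightarrow> x \<in> {a w<..<a w + \<delta> / \<beta> ^ n} \<Longrightarrow> x \<in> M \<and> hit_word \<beta> n x = w"
      by metis
    have "card W * (\<delta> / \<beta> ^ n) \<le> measure lborel M"
    proof (rule disjoint_intervals_count[where a = a])
      show "M \<in> fmeasurable lborel" unfolding M_def by (intro fmeasurable.finite_UN) auto
      show "{a w<..<a w + \<delta> / \<beta> ^ n} \<subseteq> M" if "w \<in> W" for w using a[OF that] by blast
      show "w = w'" if "w \<in> W" "w' \<in> W" "x \<in> {a w<..<a w + \<delta> / \<beta> ^ n}" "x \<in> {a w'<..<a w' + \<delta> / \<beta> ^ n}" for w w' x
        using a that by blast
    qed (use \<delta> assms(1) in \<open>auto simp: W_def finite_words\<close>)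
    also have "\<dots> \<le> (\<Sum>j\<le>K. measure lborel (first_hit \<beta> (n + j)))"
      unfolding M_def by (intro measure_UNION_le) auto
    \<comment> \<open>the words lead to the hole at different times up to \<open>n + K\<close>; delaying the earlier hits
      makes all of them count for the time \<open>n + K\<close>\<close>
    also have "\<dots> \<le> (\<Sum>j\<le>K. \<beta> ^ K * measure lborel (first_hit \<beta> (n + K)))"
    proof (intro sum_mono)
      fix j assume "j \<in> {..K}"
      then have "measure lborel (first_hit \<beta> (n + j)) \<le> \<beta> ^ (K - j) * measure lborel (first_hit \<beta> (n + K))"
        using measure_first_hit_add[OF assms(1) \<beta>2, of "n + j" "K - j"] by simp
      also have "\<dots> \<le> \<beta> ^ K * measure lborel (first_hit \<beta> (n + K))"
        using assms(1) by (intro mult_right_mono power_increasing) auto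
      finally show "measure lborel (first_hit \<beta> (n + j)) \<le> \<beta> ^ K * measure lborel (first_hit \<beta> (n + K))" .
    qed
    finally show ?thesis unfolding W_def by simp
  qed
  show ?thesis
  proof (intro exI[of _ "\<delta> / ((K + 1) * \<beta> ^ K)"] exI[of _ K] conjI allI)
    show "0 < \<delta> / ((K + 1) * \<beta> ^ K)" using \<delta> assms(1) by simp
    fix n
    have R: "0 < (K + 1) * \<beta> ^ K" using assms(1) by simp
    have "\<delta> / ((K + 1) * \<beta> ^ K) * (card (words (sym_shift k) n) / \<beta> ^ n)
        = card (words (sym_shift k) n) * (\<delta> / \<beta> ^ n) / ((K + 1) * \<beta> ^ K)"
      by (simp add: mult_ac)
    also have "\<dots> \<le> measure lborel (first_hit \<beta> (n + K))"
      unfolding pos_divide_le_eq[OF R] using bound[of n] by (simp only: mult.commute)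
    finally show "\<delta> / ((K + 1) * \<beta> ^ K) * (card (words (sym_shift k) n) / \<beta> ^ n) \<le> measure lborel (first_hit \<beta> (n + K))" .
  qed
qed

section \<open>The slope function\<close>

text \<open>The largest slope for which the Lorenz map fits into the system with base \<open>\<beta>\<close>; its logarithm is
  the entropy of the points that avoid the hole. The value 1 stands for the case that no slope fits.\<close>
definition slope_at :: "real \<Rightarrow> real" where
  "slope_at \<beta> = Sup (insert 1 {s. 1 < s \<and> s \<le> 2 \<and> val \<beta> (knead s) \<le> 1})"

lemma slope_set_bdd: "bdd_above (insert 1 {s. 1 < s \<and> s \<le> 2 \<and> val \<beta> (knead s) \<le> 1})"
  by (intro bdd_aboveI[of _ 2]) auto

lemma slope_at_ge_1: "1 \<le> slope_at \<beta>"
  unfolding slope_at_def by (rule cSup_upper[OF _ slope_set_bdd]) simp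

lemma slope_at_le_2: "slope_at \<beta> \<le> 2"
  unfolding slope_at_def by (rule cSup_least) auto

lemma slope_at_upper: "1 < s \<Longrightarrow> s \<le> 2 \<Longrightarrow> val \<beta> (knead s) \<le> 1 \<Longrightarrow> s \<le> slope_at \<beta>"
  unfolding slope_at_def by (rule cSup_upper[OF _ slope_set_bdd]) simp

lemma val_knead_above: "slope_at \<beta> < s \<Longrightarrow> s \<le> 2 \<Longrightarrow> 1 < val \<beta> (knead s)"
  using slope_at_upper[of s \<beta>] slope_at_ge_1[of \<beta>] by fastforce

lemma val_knead_below:
  assumes "1 < \<beta>" "1 < s" "s < slope_at \<beta>" shows "val \<beta> (knead s) < 1"
proof -
  obtain t where t: "t \<in> insert 1 {s. 1 < s \<and> s \<le> 2 \<and> val \<beta> (knead s) \<le> 1}" "s < t"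
    using assms(3) less_cSup_iff[OF _ slope_set_bdd] unfolding slope_at_def by blast
  then have t': "t \<le> 2" "val \<beta> (knead t) \<le> 1" using assms(2) by auto
  have nle: "\<not> lexle (knead t) (knead s)" using knead_strict_mono[OF assms(2) t(2) t'(1)] .
  then have le: "lexle (knead s) (knead t)" using lexle_total by blast
  have "val \<beta> (knead s) < val \<beta> (knead t)"
  proof (rule val_strict_mono_lexle[OF assms(1) _ t'(2)])
    show "lexle (shift n (knead s)) (knead t)" for n
      using knead_in_sym_shift[of s] assms(2) t(2) t'(1) le lexle_trans unfolding sym_shift_def by auto
    show "knead s \<noteq> knead t" using nle by auto
    show "\<exists>i. knead t (n + i)" for n using knead_infinite[of t n] assms(2) t(2) t'(1) by simp
  qed
  then show ?thesis using t'(2) by simp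
qed

lemma slope_at_lower: "1 < \<beta> \<Longrightarrow> 1 < s \<Longrightarrow> 1 \<le> val \<beta> (knead s) \<Longrightarrow> slope_at \<beta> \<le> s"
  using val_knead_below[of \<beta> s] by fastforce

lemma slope_at_mono: assumes "1 < \<beta>" "\<beta> \<le> \<beta>'" shows "slope_at \<beta> \<le> slope_at \<beta>'"
  unfolding slope_at_def
  by (intro cSup_subset_mono slope_set_bdd)
    (use val_antimono[OF assms] in \<open>auto intro: order.trans\<close>)

text \<open>The kneading sequence depends strictly monotonically, but not continuously, on the slope;
  the generalised inverse of a strictly monotone function is continuous.\<close>

lemma isCont_slope_at: assumes "1 < \<beta>" shows "isCont slope_at \<beta>"
  unfolding isCont_def
proof (rule order_tendstoI)
  have ev1: "\<forall>\<^sub>F x in at \<beta>. 1 < x" using order_tendstoD(1)[OF tendsto_ident_at assms] .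
  have cont: "((\<lambda>x. val x d) \<longlongrightarrow> val \<beta> d) (at \<beta>)" for d
    using isCont_val[OF assms] unfolding isCont_def .
  show "\<forall>\<^sub>F x in at \<beta>. a < slope_at x" if a: "a < slope_at \<beta>" for a
  proof (cases "a < 1")
    case True
    then show ?thesis using slope_at_ge_1 by (intro always_eventually allI) (rule less_le_trans)
  next
    case False
    obtain s where s: "a < s" "s < slope_at \<beta>" using dense[OF a] by blast
    then have s2: "1 < s" "s \<le> 2" using False slope_at_le_2[of \<beta>] by auto
    have "\<forall>\<^sub>F x in at \<beta>. val x (knead s) < 1"
      using order_tendstoD(2)[OF cont val_knead_below[OF assms s2(1) s(2)]] .
    then show ?thesis
    proof eventually_elim
      case (elim x)
      then show ?case using slope_at_upper[OF s2, of x] s(1) by simp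
    qed
  qed
  show "\<forall>\<^sub>F x in at \<beta>. slope_at x < a" if a: "slope_at \<beta> < a" for a
  proof (cases "2 < a")
    case True
    then show ?thesis using slope_at_le_2 by (intro always_eventually allI) (rule le_less_trans)
  next
    case False
    obtain s where s: "slope_at \<beta> < s" "s < a" using dense[OF a] by blast
    then have s2: "1 < s" "s \<le> 2" using False slope_at_ge_1[of \<beta>] by auto
    have "\<forall>\<^sub>F x in at \<beta>. 1 < val x (knead s)"
      using order_tendstoD(1)[OF cont val_knead_above[OF s(1) s2(2)]] .
    then show ?thesis using ev1
    proof eventually_elim
      case (elim x)
      then show ?case using slope_at_lower[of x s] s2(1) s(2) by simp
    qed
  qed
qed

text \<open>The value \<open>s / (2 (s - 1))\<close> of \<open>knead s\<close> in base \<open>s\<close> is greater than 1 for \<open>s < 2\<close>, and this persists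
  in slightly larger bases.\<close>
lemma slope_at_less: assumes "1 < \<beta>" "\<beta> < 2" shows "slope_at \<beta> < \<beta>"
proof -
  \<comment> \<open>half-way between \<open>1 / (\<beta> - 1)\<close> and \<open>2 / (\<beta> - 1) - 1\<close>, which are the bounds needed for
    \<open>s < \<beta>\<close> and for \<open>1 \<le> val \<beta> (knead s)\<close>, where \<open>m = 1 / (s - 1)\<close>\<close>
  define m where "m = (3 / (\<beta> - 1) - 1) / 2"
  define s where "s = 1 + 1 / m"
  have b: "1 < 1 / (\<beta> - 1)" using assms by simp
  have m: "1 / (\<beta> - 1) < m" "m < 2 / (\<beta> - 1) - 1" "1 < m"
    using b by (auto simp: m_def field_simps)
  have s: "1 < s" "s \<le> 2" using m by (auto simp: s_def)
  have "1 / m < 1 / (1 / (\<beta> - 1))" using m assms by (intro divide_strict_left_mono) auto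
  then have s\<beta>: "s < \<beta>" by (simp add: s_def)
  have sm: "1 / (s - 1) = m" using m by (simp add: s_def)
  have "val s (knead s) = (1 + m) / 2" using val_knead[OF s, of 0] sm by simp
  moreover have "val s (knead s) - val \<beta> (knead s) \<le> m - 1 / (\<beta> - 1)"
    using val_diff_le[OF s(1), of \<beta> "knead s"] s\<beta> sm by simp
  ultimately have "1 \<le> val \<beta> (knead s)" using m(2) by (simp add: field_simps)
  then show ?thesis using slope_at_lower[OF assms(1) s(1)] s\<beta> by simp
qed

lemma slope_at_2: "slope_at 2 = 2"
proof -
  have "val 2 (knead 2) = 1" using val_knead[of 2 0] by simp
  then show ?thesis using slope_at_upper[of 2 2] slope_at_le_2[of 2] by simp
qed

lemma komornik_loreti:
  "1 < komornik_loreti" "komornik_loreti < 2" "val komornik_loreti tm = 1"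
proof -
  have tm: "(\<lambda>i. thue_morse (Suc i)) = tm" by (simp add: tm_def fun_eq_iff)
  have "val 2 tm < 1"
  proof -
    have "flip tm 2" using tm_even[of 0] by (simp add: numeral_2_eq_2)
    then have "0 < val 2 (flip tm)" by (intro val_pos) auto
    then show ?thesis using val_flip[of 2 tm] by simp
  qed
  moreover have "1 \<le> val (3/2) tm"
  proof -
    have "tm 1" using tm_odd[of 0] by simp
    then have "1 / (3/2) \<le> val (3/2) (shift 1 tm)"
      using val_unfold[of "3/2" "shift 1 tm"] val_nonneg[of "3/2" "shift 2 tm"]
      by (simp add: shift_apply numeral_2_eq_2)
    then show ?thesis using val_unfold[of "3/2" tm] by simp
  qed
  moreover have "continuous_on {3/2..2} (\<lambda>\<beta>. val \<beta> tm)"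
    by (intro continuous_at_imp_continuous_on ballI isCont_val) auto
  ultimately obtain \<beta> where \<beta>: "3/2 \<le> \<beta>" "\<beta> \<le> 2" "val \<beta> tm = 1"
    using IVT2'[of "\<lambda>\<beta>. val \<beta> tm" 2 1 "3/2"] by auto
  have "\<exists>!\<beta>. 1 < \<beta> \<and> \<beta> < 2 \<and> is_expansion_of_1 \<beta> tm"
  proof (rule ex1I[of _ \<beta>])
    show "1 < \<beta> \<and> \<beta> < 2 \<and> is_expansion_of_1 \<beta> tm"
      using \<beta> \<open>val 2 tm < 1\<close> is_expansion_iff[of \<beta> tm] by (cases "\<beta> = 2") auto
    fix b assume b: "1 < b \<and> b < 2 \<and> is_expansion_of_1 b tm"
    then have "val b tm = 1" using is_expansion_iff by blast
    then show "b = \<beta>"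
      using val_strict_antimono[of b \<beta> tm] val_strict_antimono[of \<beta> b tm] b \<beta>
      by (cases b \<beta> rule: linorder_cases) auto
  qed
  from theI'[OF this] have "1 < komornik_loreti \<and> komornik_loreti < 2 \<and> is_expansion_of_1 komornik_loreti tm"
    unfolding komornik_loreti_def tm .
  then show "1 < komornik_loreti" "komornik_loreti < 2" "val komornik_loreti tm = 1"
    using is_expansion_iff by auto
qed

text \<open>Every kneading sequence is larger than the sequence \<open>tm\<close>, whose value is at least 1 in these bases.\<close>
lemma slope_at_eq_1:
  assumes "1 < \<beta>" "\<beta> \<le> komornik_loreti" shows "slope_at \<beta> = 1"
proof -
  have "1 \<le> val \<beta> (knead s)" if s: "1 < s" "s \<le> 2" for s
  proof (rule ccontr)
    assume "\<not> ?thesis"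
    then have "val komornik_loreti (knead s) < 1"
      using val_antimono[OF assms, of "knead s"] by simp
    then have "val komornik_loreti tm < 1"
      using val_mono_lexle[of komornik_loreti tm "knead s"] tm_less_knead(1)[OF s] komornik_loreti(1) by fastforce
    then show False using komornik_loreti(3) by simp
  qed
  then have "slope_at \<beta> \<le> s" if "1 < s" "s \<le> 2" for s using slope_at_lower assms(1) that by blast
  then have "\<not> 1 < slope_at \<beta>" using dense[of 1 "slope_at \<beta>"] slope_at_le_2[of \<beta>]
    by (metis less_le_trans less_imp_le not_less)
  then show ?thesis using slope_at_ge_1[of \<beta>] by simp
qed

text \<open>The value of \<open>tm\<close> is less than 1 in these bases, and \<open>tm\<close> is a limit of kneading sequences.\<close>
lemma slope_at_gt_1:
  assumes "komornik_loreti < \<beta>" shows "1 < slope_at \<beta>"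
proof -
  have \<beta>: "1 < \<beta>" using assms komornik_loreti by linarith
  have "val \<beta> tm < 1"
    using val_strict_antimono[where d = tm, OF komornik_loreti(1) assms tm_0] komornik_loreti(3) by simp
  then have pos: "0 < 1 - val \<beta> tm" by simp
  obtain n where n: "1 / (\<beta> - 1) / (1 - val \<beta> tm) < \<beta> ^ n" using real_arch_pow[OF \<beta>] by blast
  have "n \<le> 2 ^ n" using less_exp[of n] by simp
  then have "knead (slope n) i = tm i" if "i < n" for i
    using knead_slope[OF less_le_trans[OF that]] by blast
  then have "\<beta> ^ n * (val \<beta> (knead (slope n)) - val \<beta> tm) = val \<beta> (shift n (knead (slope n))) - val \<beta> (shift n tm)"
    using val_agree[OF \<beta>, of n "knead (slope n)" tm] by simp
  also have "\<dots> \<le> 1 / (\<beta> - 1)"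
    using val_le_total[OF \<beta>, of "shift n (knead (slope n))"] val_nonneg[OF \<beta>, of "shift n tm"] by linarith
  also have "\<dots> \<le> \<beta> ^ n * (1 - val \<beta> tm)" 
    using n[unfolded pos_divide_less_eq[OF pos]] by (rule less_imp_le)
  finally have "val \<beta> (knead (slope n)) \<le> 1" using \<beta> by simp
  then have "slope n \<le> slope_at \<beta>" using slope_at_upper slope_range by blast
  then show ?thesis using slope_range(1)[of n] by linarith
qed

section \<open>The escape rate\<close>

lemma lower_rate:
  fixes m :: "nat \<Rightarrow> real"
  assumes "0 < c" "0 < s" "0 < \<beta>" "\<And>n. c * (s / \<beta>) ^ n \<le> m (n + K)" "ln \<beta> - ln s < a"
  shows "\<forall>\<^sub>F n in sequentially. - ln (m n) / real n < a"
proof -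
  have "(\<lambda>n. - ln c * (1 / real n) + (1 - real K * (1 / real n)) * (ln \<beta> - ln s))
      \<longlonglongrightarrow> - ln c * 0 + (1 - real K * 0) * (ln \<beta> - ln s)"
    by (intro tendsto_intros lim_1_over_n)
  then have "\<forall>\<^sub>F n in sequentially. - ln c * (1 / real n) + (1 - real K * (1 / real n)) * (ln \<beta> - ln s) < a"
    using order_tendstoD(2) assms(5) by fastforce
  then show ?thesis using eventually_ge_at_top[of "K + 1"]
  proof eventually_elim
    case (elim n)
    have "0 < c * (s / \<beta>) ^ (n - K)" using assms by simp
    moreover have "c * (s / \<beta>) ^ (n - K) \<le> m n" using assms(4)[of "n - K"] elim by simp
    ultimately have "ln (c * (s / \<beta>) ^ (n - K)) \<le> ln (m n)" by simp
    moreover have "ln (c * (s / \<beta>) ^ (n - K)) = ln c + (real n - real K) * (ln s - ln \<beta>)"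
      using assms elim by (simp add: ln_mult ln_realpow ln_div of_nat_diff)
    ultimately have "- ln (m n) / n \<le> (- ln c + (real n - real K) * (ln \<beta> - ln s)) / n"
      by (intro divide_right_mono) (auto simp: algebra_simps)
    also have "\<dots> = - ln c * (1 / real n) + (1 - real K * (1 / real n)) * (ln \<beta> - ln s)"
      using elim by (simp add: field_simps)
    finally show ?case using elim by simp
  qed
qed

lemma upper_rate:
  fixes m :: "nat \<Rightarrow> real"
  assumes "0 < C" "1 < s" "0 < \<beta>" "\<And>n. m n \<le> (1 + n * (C * s ^ n)) * (2 / \<beta> ^ n)"
    and pos: "\<forall>\<^sub>F n in sequentially. 0 < m n" and "a < ln \<beta> - ln s"
  shows "\<forall>\<^sub>F n in sequentially. a < - ln (m n) / real n"
proof -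
  have "(\<lambda>n. (ln \<beta> - ln s) - ln (2 * (1 + C)) * (1 / real n) - ln (real n) / real n)
      \<longlonglongrightarrow> (ln \<beta> - ln s) - ln (2 * (1 + C)) * 0 - 0"
    by (intro tendsto_intros lim_1_over_n lim_ln_over_n)
  then have "\<forall>\<^sub>F n in sequentially. a < (ln \<beta> - ln s) - ln (2 * (1 + C)) * (1 / real n) - ln (real n) / real n"
    using order_tendstoD(1) assms(6) by fastforce
  then show ?thesis using eventually_ge_at_top[of 1] pos
  proof eventually_elim
    case (elim n)
    have "1 \<le> real n * s ^ n"
      using mult_mono[of 1 "real n" 1 "s ^ n"] elim(2) assms(2) by simp
    then have "1 + n * (C * s ^ n) \<le> (1 + C) * (n * s ^ n)" by (simp add: algebra_simps)
    then have "m n \<le> (1 + C) * (n * s ^ n) * (2 / \<beta> ^ n)"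
      using assms(3,4) by (intro order.trans[OF assms(4)] mult_right_mono) auto
    then have "ln (m n) \<le> ln ((1 + C) * (n * s ^ n) * (2 / \<beta> ^ n))"
      using elim(3) by (intro ln_mono) auto
    also have "(1 + C) * (n * s ^ n) * (2 / \<beta> ^ n) = 2 * (1 + C) * (n * (s ^ n / \<beta> ^ n))" by simp
    also have "ln (2 * (1 + C) * (n * (s ^ n / \<beta> ^ n))) = ln (2 * (1 + C)) + (ln n + (n * ln s - n * ln \<beta>))"
      using assms elim by (simp add: ln_mult ln_div ln_realpow)
    finally have "- (ln (2 * (1 + C)) + (ln n + (n * ln s - n * ln \<beta>))) / n \<le> - ln (m n) / n"
      by (intro divide_right_mono) auto
    moreover have "- (ln (2 * (1 + C)) + (ln n + (n * ln s - n * ln \<beta>))) / n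
        = (ln \<beta> - ln s) - ln (2 * (1 + C)) * (1 / real n) - ln (real n) / real n"
      using elim by (simp add: field_simps)
    ultimately show ?case using elim(1) by linarith
  qed
qed

text \<open>The rate for \<open>s = 1\<close> is obtained by delaying the hits of a single interval.\<close>
lemma measure_first_hit_ge:
  assumes "1 < \<beta>" "\<beta> < 2" "s = 1 \<or> 1 < s \<and> s < slope_at \<beta>"
  shows "\<exists>c K. 0 < c \<and> (\<forall>n. c * (s / \<beta>) ^ n \<le> measure lborel (first_hit \<beta> (n + K)))"
  using assms(3)
proof
  assume s: "s = 1"
  obtain K \<delta> where "0 < \<delta>" and "\<exists>k\<le>K. \<exists>p' q'. 0 \<le> p' \<and> q' \<le> 1 \<and> \<delta> \<le> q' - p' \<and> {p'<..<q'} \<subseteq> first_hit \<beta> k"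
    using interval_hits_hole[OF assms(1,2), of 1] by force
  then obtain k p' q' where k: "\<delta> \<le> q' - p'" "{p'<..<q'} \<subseteq> first_hit \<beta> k" by blast
  have "\<delta> \<le> measure lborel {p'<..<q'}" using k(1) \<open>0 < \<delta>\<close> by simp
  also have "\<dots> \<le> measure lborel (first_hit \<beta> k)" using k(2) by (intro measure_mono_fmeasurable) auto
  finally have "\<delta> * (s / \<beta>) ^ n \<le> measure lborel (first_hit \<beta> (n + k))" for n
    using measure_first_hit_add[of \<beta> k n] assms(1,2) s by (simp add: field_simps)
  then show ?thesis using \<open>0 < \<delta>\<close> by blast
next
  assume s: "1 < s \<and> s < slope_at \<beta>"
  then have s2: "s \<le> 2" using slope_at_le_2[of \<beta>] by simp
  obtain c K where c: "0 < c" "\<And>n. c * (card (words (sym_shift (knead s)) n) / \<beta> ^ n) \<le> measure lborel (first_hit \<beta> (n + K))"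
    using measure_first_hit_ge_words[OF assms(1,2) val_knead_below[OF assms(1)]] s by blast
  have "c / 2 * (s / \<beta>) ^ n \<le> measure lborel (first_hit \<beta> (n + K))" for n
  proof -
    have "c / 2 * (s / \<beta>) ^ n = c * (s ^ n / 2 / \<beta> ^ n)" by (simp add: power_divide)
    also have "\<dots> \<le> c * (card (words (sym_shift (knead s)) n) / \<beta> ^ n)"
      using c(1) assms(1) card_words_ge[of s n] s s2 by (intro mult_left_mono divide_right_mono) auto
    finally show ?thesis using c(2)[of n] by linarith
  qed
  then show ?thesis using c(1) by (intro exI[of _ "c / 2"] exI[of _ K]) auto
qed

text \<open>The bounds for the rates on both sides of \<open>S\<close> determine the exponential rate. With \<open>\<beta> = 1\<close> the
  statement is about growth rates of word counts.\<close>
lemma rate_tendsto: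
  fixes m :: "nat \<Rightarrow> real" and S \<beta> :: real
  assumes S: "1 \<le> S" "S < 2" and "0 < \<beta>"
    and lower: "\<And>s. s = 1 \<or> 1 < s \<and> s < S \<Longrightarrow> \<exists>c K. 0 < c \<and> (\<forall>n. c * (s / \<beta>) ^ n \<le> m (n + K))"
    and upper: "\<And>s. S < s \<Longrightarrow> s \<le> 2 \<Longrightarrow> \<exists>C>0. \<forall>n. m n \<le> (1 + n * (C * s ^ n)) * (2 / \<beta> ^ n)"
  shows "(\<lambda>n. - ln (m n) / real n) \<longlonglongrightarrow> ln \<beta> - ln S"
proof (rule order_tendstoI)
  obtain c K where c: "0 < c" "\<And>n. c * (1 / \<beta>) ^ n \<le> m (n + K)"
    using lower[of 1] by blast
  have pos: "\<forall>\<^sub>F n in sequentially. 0 < m n"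
  proof (rule eventually_sequentiallyI[of K])
    fix n assume "K \<le> n"
    have "0 < c * (1 / \<beta>) ^ (n - K)" using c(1) assms(3) by simp
    then show "0 < m n" using c(2)[of "n - K"] \<open>K \<le> n\<close> by simp
  qed
  show "\<forall>\<^sub>F n in sequentially. a < - ln (m n) / real n" if a: "a < ln \<beta> - ln S" for a
  proof -
    have "S < exp (ln \<beta> - a)" using a S ln_less_cancel_iff[of S "exp (ln \<beta> - a)"] by simp
    then have "S < min (exp (ln \<beta> - a)) 2" using S by simp
    then obtain s where s: "S < s" "s < min (exp (ln \<beta> - a)) 2" using dense by blast
    then have s2: "1 < s" "s \<le> 2" "0 < s" using S by auto
    obtain C where C: "0 < C" "\<And>n. m n \<le> (1 + n * (C * s ^ n)) * (2 / \<beta> ^ n)"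
      using upper[OF s(1) s2(2)] by blast
    have "ln s < ln \<beta> - a" using s s2 ln_less_cancel_iff[of s "exp (ln \<beta> - a)"] by simp
    then show ?thesis using upper_rate[OF C(1) s2(1) assms(3) C(2) pos] by simp
  qed
  show "\<forall>\<^sub>F n in sequentially. - ln (m n) / real n < a" if a: "ln \<beta> - ln S < a" for a
  proof -
    have "\<exists>s. (s = 1 \<or> 1 < s \<and> s < S) \<and> ln \<beta> - ln s < a"
    proof (cases "S = 1")
      case True
      then show ?thesis using a by (intro exI[of _ 1]) simp
    next
      case False
      then have "1 < S" using S by simp
      moreover have "exp (ln \<beta> - a) < S"
        using a S ln_less_cancel_iff[of "exp (ln \<beta> - a)" S] by simp
      ultimately have "max 1 (exp (ln \<beta> - a)) < S" by simp
      then obtain s where s: "max 1 (exp (ln \<beta> - a)) < s" "s < S" using dense by blast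
      then have "ln \<beta> - a < ln s" using ln_less_cancel_iff[of "exp (ln \<beta> - a)" s] by simp
      then show ?thesis using s by (intro exI[of _ s]) auto
    qed
    then obtain s where s: "s = 1 \<or> 1 < s \<and> s < S" "ln \<beta> - ln s < a" by blast
    then obtain c K where "0 < c" "\<And>n. c * (s / \<beta>) ^ n \<le> m (n + K)" using lower by blast
    then show ?thesis using s assms(3) by (intro lower_rate) auto
  qed
qed

theorem escape_seq_tendsto:
  assumes "1 < \<beta>" "\<beta> < 2"
  shows "escape_seq \<beta> \<longlonglongrightarrow> ln \<beta> - ln (slope_at \<beta>)"
  unfolding escape_seq_def[abs_def]
proof (rule rate_tendsto)
  fix s assume s: "slope_at \<beta> < s" "s \<le> 2"
  then have s1: "1 < s" using slope_at_ge_1[of \<beta>] by simp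
  obtain C where "0 < C" "\<And>n. card (core_words \<beta> n) \<le> C * s ^ n"
    using card_core_words_le[OF assms(1) s1 s(2) val_knead_above[OF s]] by blast
  then show "\<exists>C>0. \<forall>n. measure lborel (first_hit \<beta> n) \<le> (1 + n * (C * s ^ n)) * (2 / \<beta> ^ n)"
    using measure_first_hit_le[OF assms(1) _ s1] assms(2) by (intro exI[of _ C]) simp
qed (use slope_at_ge_1 slope_at_less[OF assms] measure_first_hit_ge[OF assms] assms in auto)

text \<open>For \<open>\<beta> = 2\<close> the hole is a single point, so that all first-hit sets are finite.\<close>

lemma escape_seq_2: "escape_seq 2 n = 0"
proof -
  have "measure lborel (first_hit 2 n) \<le> card {u :: bool list. length u = n} * (2 * (0 :: real))"
  proof (rule class_count[where f = "hit_word 2 n"])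
    fix x y assume xy: "x \<in> first_hit 2 n" "y \<in> first_hit 2 n" "hit_word 2 n x = hit_word 2 n y"
    then have "(greedy_map 2 ^^ n) x = 1 / 2" "(greedy_map 2 ^^ n) y = 1 / 2"
      by (auto simp: first_hit_def hole_def)
    then have "2 ^ n * (x - y) = 0" using hit_word_diff[OF _ xy(3)] by linarith
    then show "\<bar>x - y\<bar> \<le> 0" by simp
  qed (use finite_lists_length_eq[of "UNIV :: bool set" n] in \<open>auto simp: hit_word_def\<close>)
  then show ?thesis by (simp add: escape_seq_def measure_le_0_iff)
qed

lemma escape_rate_eq:
  assumes "1 < \<beta>" "\<beta> \<le> 2"
  shows "convergent (escape_seq \<beta>)" "escape_rate \<beta> = ln \<beta> - ln (slope_at \<beta>)"
    "norm_escape_rate \<beta> = 1 - ln (slope_at \<beta>) / ln \<beta>"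
proof -
  have "escape_seq \<beta> \<longlonglongrightarrow> ln \<beta> - ln (slope_at \<beta>)"
  proof (cases "\<beta> = 2")
    case True
    then show ?thesis by (simp add: escape_seq_2[abs_def] slope_at_2)
  qed (use escape_seq_tendsto assms in simp)
  then show "convergent (escape_seq \<beta>)" and *: "escape_rate \<beta> = ln \<beta> - ln (slope_at \<beta>)"
    unfolding escape_rate_def by (auto simp: convergentI limI)
  show "norm_escape_rate \<beta> = 1 - ln (slope_at \<beta>) / ln \<beta>"
    using assms(1) by (simp add: norm_escape_rate_def * diff_divide_distrib)
qed

section \<open>The slope function is locally constant almost everywhere\<close>

text \<open>The bases from which on the Lorenz map of a given slope fits; between them \<open>slope_at\<close> is constant.\<close>
definition bifurcations :: "real set" where
  "bifurcations = {b. \<exists>s. 1 < s \<and> s \<le> 2 \<and> val b (knead s) = 1}"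

lemma slope_at_const:
  assumes "1 < \<beta>" "\<beta> \<le> \<beta>'" "bifurcations \<inter> {\<beta>..\<beta>'} = {}"
  shows "slope_at \<beta> = slope_at \<beta>'"
proof (rule ccontr)
  assume "slope_at \<beta> \<noteq> slope_at \<beta>'"
  then have "slope_at \<beta> < slope_at \<beta>'" using slope_at_mono[OF assms(1,2)] by simp
  then obtain s where s: "slope_at \<beta> < s" "s < slope_at \<beta>'" using dense by blast
  have s2: "1 < s" "s \<le> 2" using s slope_at_ge_1[of \<beta>] slope_at_le_2[of \<beta>'] by auto
  have "val \<beta>' (knead s) \<le> 1" using val_knead_below[OF _ s2(1) s(2)] assms by simp
  moreover have "1 \<le> val \<beta> (knead s)" using val_knead_above[OF s(1) s2(2)] by simp
  moreover have "continuous_on {\<beta>..\<beta>'} (\<lambda>b. val b (knead s))"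
    using assms(1) by (intro continuous_at_imp_continuous_on ballI isCont_val) auto
  ultimately obtain b where "b \<in> {\<beta>..\<beta>'}" "val b (knead s) = 1"
    using IVT2'[of "\<lambda>b. val b (knead s)" \<beta>' 1 \<beta>] assms(2) by auto
  then show False using assms(3) s2 unfolding bifurcations_def by blast
qed

lemma bifurcation_prefix_close:
  assumes "1 < b" "b \<le> b'" "b' \<le> 2" "d 0" "val b d = 1" "val b' d' = 1" "\<And>i. i < n \<Longrightarrow> d i = d' i"
  shows "b' - b \<le> 4 / (b' - 1) / b' ^ n"
proof -
  have b': "1 < b'" using assms by simp
  have "b' ^ n * (val b' d' - val b' d) = val b' (shift n d') - val b' (shift n d)"
    using val_agree[OF b', of n d' d] assms(7) by simp
  also have "\<dots> \<le> 1 / (b' - 1)"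
    using val_le_total[OF b', of "shift n d'"] val_nonneg[OF b', of "shift n d"] by linarith
  finally have "1 - val b' d \<le> 1 / (b' - 1) / b' ^ n"
    using b' assms(6) by (simp add: field_simps)
  then have "1 / b - 1 / b' \<le> 1 / (b' - 1) / b' ^ n"
    using val_diff_ge[of b b' d] assms by simp
  moreover have "(b' - b) / 4 \<le> 1 / b - 1 / b'"
  proof -
    have "b * b' \<le> 2 * 2" using assms by (intro mult_mono) auto
    then have "(b' - b) / 4 \<le> (b' - b) / (b * b')"
      using assms b' by (intro divide_left_mono) auto
    also have "\<dots> = 1 / b - 1 / b'" using assms b' by (simp add: field_simps)
    finally show ?thesis .
  qed
  ultimately have "(b' - b) / 4 \<le> 1 / (b' - 1) / b' ^ n" by (rule order.trans[rotated])
  then have "4 * ((b' - b) / 4) \<le> 4 * (1 / (b' - 1) / b' ^ n)" by (intro mult_left_mono) auto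
  then show ?thesis by simp
qed

text \<open>The bases with a common prefix of length \<open>n\<close> lie in an interval of length of order \<open>b0 ^ - n\<close>. The
  prefixes are core words of base \<open>b1\<close>, so there are at most \<open>C s ^ n\<close> of them, with \<open>s < b0\<close>.\<close>
lemma negligible_bifurcations:
  assumes b: "1 < b0" "b0 < b1" "b1 \<le> 2" "slope_at b1 < b0"
  shows "negligible (closure (bifurcations \<inter> {b0..b1}))"
  unfolding negligible_outer_le
proof (intro allI impI)
  fix e :: real assume e: "0 < e"
  define B where "B = bifurcations \<inter> {b0..b1}"
  obtain s where s: "slope_at b1 < s" "s < b0" using dense[OF b(4)] by blast
  have s2: "1 < s" "s \<le> 2" using s slope_at_ge_1[of b1] b by auto
  have b1: "1 < b1" using b by simp
  obtain C where C: "0 < C" "\<And>n. card (core_words b1 n) \<le> C * s ^ n"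
    using card_core_words_le[OF b1 s2 val_knead_above[OF s(1) s2(2)]] by blast
  define r where "r n = 4 / (b0 - 1) / b0 ^ n" for n
  have "\<exists>\<sigma>. \<forall>b\<in>B. 1 < \<sigma> b \<and> \<sigma> b \<le> 2 \<and> val b (knead (\<sigma> b)) = 1"
    unfolding B_def bifurcations_def by (intro bchoice) auto
  then obtain \<sigma> where \<sigma>: "\<And>b. b \<in> B \<Longrightarrow> 1 < \<sigma> b \<and> \<sigma> b \<le> 2 \<and> val b (knead (\<sigma> b)) = 1" by blast
  have cover: "\<exists>c. B \<subseteq> (\<Union>w\<in>core_words b1 n. {c w - r n..c w + r n})" for n
  proof (rule class_cover[where f = "\<lambda>b. map (knead (\<sigma> b)) [0..<n]"])
    fix b assume bB: "b \<in> B"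
    then have bb: "b0 \<le> b" "b \<le> b1" by (auto simp: B_def)
    have "val b1 (knead (\<sigma> b)) \<le> 1"
      using val_antimono[of b b1 "knead (\<sigma> b)"] \<sigma>[OF bB] bb b by simp
    moreover have "map (knead (\<sigma> b)) [0..<n] \<in> words (sym_shift (knead (\<sigma> b))) n"
      using knead_in_sym_shift \<sigma>[OF bB] by (intro words_prefix) auto
    ultimately show "map (knead (\<sigma> b)) [0..<n] \<in> core_words b1 n"
      using words_sym_shift_core[OF b1] by blast
  next
    have main: "\<bar>b - b'\<bar> \<le> r n"
      if bb: "b \<in> B" "b' \<in> B" "map (knead (\<sigma> b)) [0..<n] = map (knead (\<sigma> b')) [0..<n]" "b \<le> b'" for b b'
    proof -
      have "b' - b \<le> 4 / (b' - 1) / b' ^ n"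
      proof (rule bifurcation_prefix_close)
        fix i assume "i < n"
        then show "knead (\<sigma> b) i = knead (\<sigma> b') i" using bb(3) by auto
      qed (use bb \<sigma> b in \<open>auto simp: B_def\<close>)
      also have "\<dots> \<le> r n"
        unfolding r_def using bb b by (intro frac_le divide_left_mono power_mono) (auto simp: B_def)
      finally show ?thesis using bb(4) by simp
    qed
    fix b b' assume "b \<in> B" "b' \<in> B" "map (knead (\<sigma> b)) [0..<n] = map (knead (\<sigma> b')) [0..<n]"
    then show "\<bar>b - b'\<bar> \<le> r n"
      using main[of b b'] main[of b' b] by (cases "b \<le> b'") (auto simp: abs_minus_commute)
  qed
  have "(\<lambda>n. C * 2 * (4 / (b0 - 1)) * (s / b0) ^ n) \<longlonglongrightarrow> C * 2 * (4 / (b0 - 1)) * 0"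
    using s s2 b by (intro tendsto_intros LIMSEQ_power_zero) auto
  then have "\<forall>\<^sub>F n in sequentially. C * 2 * (4 / (b0 - 1)) * (s / b0) ^ n < e"
    using order_tendstoD(2) e by fastforce
  then obtain n where n: "C * 2 * (4 / (b0 - 1)) * (s / b0) ^ n < e"
    by (auto simp: eventually_sequentially)
  obtain c where c: "B \<subseteq> (\<Union>w\<in>core_words b1 n. {c w - r n..c w + r n})" (is "_ \<subseteq> ?T")
    using cover by blast
  have r0: "0 \<le> r n" using b by (simp add: r_def)
  have "closed ?T" using finite_core_words by (intro closed_UN) auto
  then have "closure B \<subseteq> ?T" using c by (rule closure_minimal[rotated])
  moreover have "?T \<in> lmeasurable"
    by (intro fmeasurable.finite_UN finite_core_words lmeasurable_interval)
  moreover have "measure lebesgue ?T \<le> e"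
  proof -
    have "measure lebesgue ?T \<le> (\<Sum>w\<in>core_words b1 n. measure lebesgue {c w - r n..c w + r n})"
      using finite_core_words by (intro measure_UNION_le) auto
    also have "\<dots> = card (core_words b1 n) * (2 * r n)" using r0 by simp
    also have "\<dots> \<le> C * s ^ n * (2 * r n)" using C r0 by (intro mult_right_mono) auto
    also have "\<dots> = C * 2 * (4 / (b0 - 1)) * (s / b0) ^ n" by (simp add: r_def power_divide)
    finally show ?thesis using n by simp
  qed
  ultimately show "\<exists>T. closure (bifurcations \<inter> {b0..b1}) \<subseteq> T \<and> T \<in> lmeasurable \<and> measure lebesgue T \<le> e"
    unfolding B_def by blast
qed

lemma slope_at_locally_const:
  assumes "1 < b0" "x \<in> {b0<..<b1}" "x \<notin> closure (bifurcations \<inter> {b0..b1})"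
  shows "\<exists>e>0. \<forall>y\<in>ball x e. slope_at y = slope_at x"
proof -
  have "open ({b0<..<b1} - closure (bifurcations \<inter> {b0..b1}))" by (intro open_Diff) auto
  then obtain e where e: "0 < e" "ball x e \<subseteq> {b0<..<b1} - closure (bifurcations \<inter> {b0..b1})"
    using assms(2,3) unfolding open_contains_ball by blast
  have const: "slope_at y = slope_at z" if yz: "y \<in> ball x e" "z \<in> ball x e" "y \<le> z" for y z
  proof (rule slope_at_const)
    have "w \<in> ball x e" if "w \<in> {y..z}" for w using yz that by (auto simp: dist_real_def)
    then show "bifurcations \<inter> {y..z} = {}"
      using e(2) closure_subset[of "bifurcations \<inter> {b0..b1}"] by fastforce
    show "1 < y" using yz(1) e(2) assms(1) by force
  qed (rule yz(3))
  have "slope_at y = slope_at x" if "y \<in> ball x e" for y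
  proof -
    have "x \<in> ball x e" using e(1) by simp
    then show ?thesis using const[OF that] const[OF _ that] linear[of y x] by metis
  qed
  then show ?thesis using e(1) by blast
qed

proposition AE_slope_at_locally_const:
  "AE \<beta> in lborel. 1 < \<beta> \<longrightarrow> \<beta> < 2 \<longrightarrow> (\<exists>e>0. \<forall>y\<in>ball \<beta> e. slope_at y = slope_at \<beta>)"
proof -
  define N where "N = {\<beta>. 1 < \<beta> \<and> \<beta> < 2 \<and> \<not> (\<exists>e>0. \<forall>y\<in>ball \<beta> e. slope_at y = slope_at \<beta>)}"
  have "negligible N"
  proof (rule iffD2[OF locally_negligible_alt], rule ballI)
    fix \<beta> assume "\<beta> \<in> N"
    then have \<beta>: "1 < \<beta>" "\<beta> < 2" by (auto simp: N_def)
    obtain b0 where b0: "slope_at \<beta> < b0" "b0 < \<beta>" using dense[OF slope_at_less[OF \<beta>]] by blast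
    have b01: "1 < b0" using b0 slope_at_ge_1[of \<beta>] by simp
    have "\<forall>\<^sub>F x in at \<beta>. slope_at x < b0"
      using order_tendstoD(2) isCont_slope_at[OF \<beta>(1)] b0(1) unfolding isCont_def by blast
    then obtain \<delta> where \<delta>: "0 < \<delta>" "\<And>x. x \<noteq> \<beta> \<Longrightarrow> dist x \<beta> < \<delta> \<Longrightarrow> slope_at x < b0"
      unfolding eventually_at by auto
    define b1 where "b1 = min 2 (\<beta> + \<delta> / 2)"
    have b1: "\<beta> < b1" "b1 \<le> 2" "slope_at b1 < b0"
      using \<beta> \<delta> by (auto simp: b1_def dist_real_def intro!: \<delta>(2))
    have "N \<inter> {b0<..<b1} \<subseteq> closure (bifurcations \<inter> {b0..b1})"
    proof
      fix x assume x: "x \<in> N \<inter> {b0<..<b1}"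
      then have "\<not> (\<exists>e>0. \<forall>y\<in>ball x e. slope_at y = slope_at x)" by (simp add: N_def)
      then show "x \<in> closure (bifurcations \<inter> {b0..b1})"
        using slope_at_locally_const[OF b01, of x b1] x by blast
    qed
    then have "negligible (N \<inter> {b0<..<b1})"
      by (rule negligible_subset[OF negligible_bifurcations[OF b01 _ b1(2,3)], rotated])
        (use b0 b1 in linarith)
    moreover have "openin (top_of_set N) (N \<inter> {b0<..<b1})" by (intro openin_open_Int) auto
    ultimately show "\<exists>U. openin (top_of_set N) U \<and> \<beta> \<in> U \<and> negligible U"
      using \<open>\<beta> \<in> N\<close> b0 b1 by (intro exI[of _ "N \<inter> {b0<..<b1}"]) auto
  qed
  then have "AE \<beta> in lebesgue. 1 < \<beta> \<longrightarrow> \<beta> < 2 \<longrightarrow> (\<exists>e>0. \<forall>y\<in>ball \<beta> e. slope_at y = slope_at \<beta>)"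
    by (intro AE_I'[of N]) (auto simp: negligible_iff_null_sets N_def)
  then show ?thesis by (simp add: AE_completion_iff)
qed

proposition AE_norm_escape_rate_deriv:
  "AE \<beta> in lborel. \<beta> \<in> {komornik_loreti<..2} \<longrightarrow> (\<exists>D>0. (norm_escape_rate has_real_derivative D) (at \<beta>))"
proof -
  have "AE \<beta> in lborel. \<beta> \<noteq> (2::real)" by (rule AE_lborel_singleton)
  then show ?thesis using AE_slope_at_locally_const
  proof eventually_elim
    case (elim \<beta>)
    show ?case
    proof
      assume "\<beta> \<in> {komornik_loreti<..2}"
      then have \<beta>: "1 < \<beta>" "\<beta> < 2" "1 < slope_at \<beta>"
        using elim(1) komornik_loreti slope_at_gt_1 by auto
      then obtain e where e: "0 < e" "\<And>y. y \<in> ball \<beta> e \<Longrightarrow> slope_at y = slope_at \<beta>" using elim(2) by blast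
      define D where "D = ln (slope_at \<beta>) / (\<beta> * ln \<beta> ^ 2)"
      have "((\<lambda>x. 1 - ln (slope_at \<beta>) / ln x) has_real_derivative D) (at \<beta>)"
        unfolding D_def using \<beta> by (auto intro!: derivative_eq_intros simp: power2_eq_square)
      moreover have "open (ball \<beta> e \<inter> {1<..<2})" by auto
      moreover have "\<beta> \<in> ball \<beta> e \<inter> {1<..<2}" using e(1) \<beta> by auto
      moreover have "1 - ln (slope_at \<beta>) / ln x = norm_escape_rate x" if "x \<in> ball \<beta> e \<inter> {1<..<2}" for x
        using escape_rate_eq(3)[of x] e(2)[of x] that by auto
      ultimately have "(norm_escape_rate has_real_derivative D) (at \<beta>)"
        by (rule has_field_derivative_transform_within_open)
      moreover have "0 < D" unfolding D_def using \<beta> by simp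
      ultimately show "\<exists>D>0. (norm_escape_rate has_real_derivative D) (at \<beta>)" by blast
    qed
  qed
qed

section \<open>Quasi-greedy expansions\<close>

text \<open>The quasi-greedy algorithm: its remainders \<open>r\<close> stay positive, so the digit 1 keeps occurring.\<close>
lemma infinite_expansion_exists:
  assumes "1 < q" "q \<le> 2" "0 < y" "y \<le> 1 / (q - 1)"
  shows "\<exists>b. infinite {i. b i} \<and> val q b = y"
proof -
  define r where "r i = ((\<lambda>x. q * x - of_bool (1 / q < x)) ^^ i) y" for i
  define b where "b i \<longleftrightarrow> 1 / q < r i" for i
  have r: "r 0 = y" "r (Suc i) = q * r i - of_bool (b i)" for i by (auto simp: r_def b_def)
  have rpos: "0 < r i \<and> r i \<le> 1 / (q - 1)" for i
  proof (induction i)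
    case (Suc i)
    show ?case
    proof (cases "b i")
      case True
      then have "1 < q * r i" using assms(1) by (simp add: b_def field_simps)
      moreover have "q * r i \<le> q * (1 / (q - 1))" using Suc assms(1) by (intro mult_left_mono) auto
      moreover have "q * (1 / (q - 1)) - 1 = 1 / (q - 1)" using assms(1) by (simp add: field_simps)
      ultimately show ?thesis using True by (simp add: r(2))
    next
      case False
      then have "q * r i \<le> 1" using assms(1) by (simp add: b_def field_simps)
      moreover have "1 \<le> 1 / (q - 1)" using assms(1,2) by simp
      ultimately have "q * r i \<le> 1 / (q - 1)" by linarith
      then show ?thesis using False Suc assms(1) by (simp add: r(2))
    qed
  qed (use assms r in auto)
  have rabs: "\<bar>r i\<bar> \<le> 1 / (q - 1)" for i using rpos[of i] by simp
  have rval: "r n = val q (shift n b)" for n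
    using val_unique[of q "\<lambda>i. r (n + i)" "shift n b" "1 / (q - 1)"] assms(1) r(2) rabs
    by (simp add: shift_apply)
  have "\<exists>i\<ge>n. b i" for n
  proof (rule ccontr)
    assume "\<not> ?thesis"
    then have "val q (shift n b) = 0" by (simp add: val_def shift_apply)
    then show False using rpos[of n] rval by simp
  qed
  then have "infinite {i. b i}" by (simp add: infinite_nat_iff_unbounded_le)
  then show ?thesis using rval[of 0] r(1) by auto
qed

text \<open>Otherwise the digit 0 could be replaced by 1 and the remainder expanded again, which would
  give a larger expansion of 1.\<close>

lemma quasi_greedy_tail:
  assumes "quasi_greedy q a" "1 < q" "q \<le> 2" "\<not> a j"
  shows "val q (shift (Suc j) a) \<le> 1"
proof (rule ccontr)
  assume "\<not> ?thesis"
  then have y: "0 < val q (shift (Suc j) a) - 1" by simp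
  have "val q (shift (Suc j) a) - 1 \<le> 1 / (q - 1)"
    using val_le_total[OF assms(2), of "shift (Suc j) a"] by linarith
  then obtain b where b: "infinite {i. b i}" "val q b = val q (shift (Suc j) a) - 1"
    using infinite_expansion_exists[OF assms(2,3) y] by blast
  define c where "c i = (if i < j then a i else if i = j then True else b (i - Suc j))" for i
  have sc: "shift (Suc j) c = b" by (simp add: fun_eq_iff shift_apply c_def)
  have "q ^ Suc j * (val q c - val q a) = 1 + val q (shift (Suc j) c) - val q (shift (Suc j) a)"
    by (rule val_diff_first_difference) (use assms in \<open>auto simp: c_def\<close>)
  then have "val q c = val q a" using sc b(2) assms(2) by simp
  moreover have "val q a = 1" using assms(1,2) is_expansion_iff unfolding quasi_greedy_def by blast
  ultimately have "is_expansion_of_1 q c" using is_expansion_iff[OF assms(2)] by simp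
  moreover have "infinite {i. c i}"
  proof
    assume "finite {i. c i}"
    then have "finite ((\<lambda>i. i - Suc j) ` {i. c i})" by simp
    moreover have "{i. b i} \<subseteq> (\<lambda>i. i - Suc j) ` {i. c i}"
    proof
      fix i assume "i \<in> {i. b i}"
      then have "c (Suc j + i)" by (simp add: c_def)
      then show "i \<in> (\<lambda>i. i - Suc j) ` {i. c i}" by force
    qed
    ultimately show False using b(1) finite_subset by blast
  qed
  ultimately have "c = a \<or> less_fun c a" using assms(1) unfolding quasi_greedy_def by blast
  moreover have "c \<noteq> a" using assms(4) unfolding c_def by (auto simp: fun_eq_iff)
  moreover have "lexle a c"
    unfolding lexle_def
  proof (intro allI impI)
    fix n assume n: "\<forall>i<n. a i = c i" "a n"
    have "c j" by (simp add: c_def)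
    then have "\<not> j < n" using n(1) assms(4) by auto
    then show "c n" using n(2) by (auto simp: c_def)
  qed
  ultimately show False using less_fun_iff by blast
qed

lemma quasi_greedy_val_ge:
  assumes "quasi_greedy q a" "1 < q" "q \<le> 2" "lexle a k"
  shows "1 \<le> val q k"
proof (cases "a = k")
  case True
  then show ?thesis using assms(1,2) is_expansion_iff[of q a] unfolding quasi_greedy_def by auto
next
  case False
  then obtain j where j: "\<forall>i<j. a i = k i" "\<not> a j" "k j" using lexle_first_difference assms(4) by blast
  have "0 \<le> q ^ Suc j * (val q k - val q a)"
    unfolding val_diff_first_difference[OF assms(2) j]
    using quasi_greedy_tail[OF assms(1-3) j(2)] val_nonneg[OF assms(2), of "shift (Suc j) k"] by simp
  moreover have "0 < q ^ Suc j" using assms(2) by simp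
  ultimately have "0 \<le> val q k - val q a" by (simp only: zero_le_mult_iff) linarith
  moreover have "val q a = 1" using assms(1,2) is_expansion_iff unfolding quasi_greedy_def by blast
  ultimately show ?thesis by simp
qed

section \<open>Admissible intervals\<close>

lemma list_le_iff:
  fixes u v :: "bool list"
  assumes "length u = length v"
  shows "u \<le> v \<longleftrightarrow> (\<forall>m<length u. (\<forall>i<m. u ! i = v ! i) \<longrightarrow> u ! m \<longrightarrow> v ! m)"
  using assms
proof (induction u v rule: list_induct2)
  case (Cons x u y v)
  have "(\<forall>m<length (x # u). (\<forall>i<m. (x # u) ! i = (y # v) ! i) \<longrightarrow> (x # u) ! m \<longrightarrow> (y # v) ! m)
      \<longleftrightarrow> (x \<longrightarrow> y) \<and> (\<forall>m<length u. x = y \<longrightarrow> (\<forall>i<m. u ! i = v ! i) \<longrightarrow> u ! m \<longrightarrow> v ! m)"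
    by (auto simp: All_less_Suc2)
  also have "\<dots> \<longleftrightarrow> x < y \<or> x = y \<and> u \<le> v" unfolding Cons.IH by (cases x; cases y) auto
  finally show ?case by simp
qed simp

text \<open>In the direction from windows to shifts, the first difference from the periodic sequence is
  located in one of the consecutive windows of length \<open>length t\<close>.\<close>
lemma window_le_iff:
  assumes "t \<noteq> []"
  shows "(\<forall>n. map d [n..<n + length t] \<le> t) \<longleftrightarrow> (\<forall>n. lexle (shift n d) (periodic_seq t))"
proof -
  have w: "map d [n..<n + length t] \<le> t \<longleftrightarrow>
      (\<forall>m<length t. (\<forall>i<m. d (n + i) = t ! i) \<longrightarrow> d (n + m) \<longrightarrow> t ! m)" for n
    by (subst list_le_iff) auto
  show ?thesis unfolding w
  proof (intro iffI allI impI)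
    fix n assume a: "\<forall>n m. m < length t \<longrightarrow> (\<forall>i<m. d (n + i) = t ! i) \<longrightarrow> d (n + m) \<longrightarrow> t ! m"
    show "lexle (shift n d) (periodic_seq t)"
      unfolding lexle_def
    proof (intro allI impI)
      fix m assume m: "\<forall>i<m. shift n d i = periodic_seq t i" "shift n d m"
      define k where "k = length t * (m div length t)"
      have mk: "m = k + m mod length t" by (simp add: k_def)
      have r: "m mod length t < length t" using assms by simp
      have "d (n + k + i) = t ! i" if "i < m mod length t" for i
      proof -
        have "shift n d (k + i) = periodic_seq t (k + i)" using m(1) that mk by auto
        moreover have "i < length t" using that r by linarith
        ultimately show ?thesis by (simp add: shift_apply periodic_seq_def k_def add.assoc)
      qed
      moreover have "d (n + k + m mod length t)" using m(2) mk by (simp add: shift_apply add.assoc)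
      ultimately show "periodic_seq t m" using a r unfolding periodic_seq_def by blast
    qed
  next
    fix n m assume "\<forall>n. lexle (shift n d) (periodic_seq t)" and m: "m < length t"
      "\<forall>i<m. d (n + i) = t ! i" "d (n + m)"
    then have "(\<forall>i<m. d (n + i) = periodic_seq t i) \<longrightarrow> d (n + m) \<longrightarrow> periodic_seq t m"
      unfolding lexle_def shift_apply by blast
    then show "t ! m" using m by (simp add: periodic_seq_def)
  qed
qed

lemma block_subshift_eq:
  assumes "t \<noteq> []" shows "block_subshift t = sym_shift (periodic_seq t)"
proof -
  have "bar t \<le> map d [n..<n + length t] \<longleftrightarrow> map (flip d) [n..<n + length t] \<le> t" for d n
    by (subst (1 2) list_le_iff) (auto simp: nth_append)
  then have "block_subshift t = {d. (\<forall>n. map (flip d) [n..<n + length t] \<le> t) \<and> (\<forall>n. map d [n..<n + length t] \<le> t)}"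
    unfolding block_subshift_def by auto
  then show ?thesis unfolding window_le_iff[OF assms] sym_shift_def by auto
qed

lemma length_block_plus [simp]: "c \<noteq> [] \<Longrightarrow> length (block_plus c) = length c"
  by (simp add: block_plus_def)

lemma doubling_block_not_Nil [simp]: "doubling_block t n \<noteq> []"
  by (induction n) (auto simp: block_plus_def)

lemma length_doubling_block: "t \<noteq> [] \<Longrightarrow> length (doubling_block t n) = 2 ^ n * length t"
  by (induction n) auto

lemma doubling_block_prefix:
  assumes "t \<noteq> []" "m \<le> n" "i < length (doubling_block t m)"
  shows "doubling_block t n ! i = doubling_block t m ! i"
  using assms(2)
proof (induction rule: dec_induct)
  case (step n)
  have "2 ^ m * length t \<le> 2 ^ n * length t" using step(1) by (intro mult_right_mono power_increasing) auto
  then have "i < length (doubling_block t n)" 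
    using assms(3) unfolding length_doubling_block[OF assms(1)] by linarith
  then show ?case using step by (simp add: nth_append)
qed simp

lemma doubling_limit_nth:
  assumes "t \<noteq> []" "i < length (doubling_block t n)"
  shows "doubling_limit t i = doubling_block t n ! i"
proof -
  have "i < 2 ^ i * 1" by simp
  also have "\<dots> \<le> 2 ^ i * length t" using assms(1) by (intro mult_left_mono) (auto simp: Suc_le_eq)
  finally have i: "i < length (doubling_block t i)" using length_doubling_block[OF assms(1)] by simp
  show ?thesis
    unfolding doubling_limit_def
    using doubling_block_prefix[OF assms(1), of i n i] doubling_block_prefix[OF assms(1), of n i i] i assms(2)
    by (cases "i \<le> n") auto
qed

text \<open>Antiperiodicity would mean that the critical orbit reaches the point \<open>-1\<close>.\<close>

lemma knead_not_antiperiodic: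
  assumes "1 < s" "s \<le> 2" shows "shift l (knead s) \<noteq> flip (knead s)"
proof
  assume "shift l (knead s) = flip (knead s)"
  then have "val s (shift l (knead s)) = 1 / (s - 1) - val s (knead s)"
    using val_flip[OF assms(1)] by simp
  then have "crit s l = - 1"
    using val_knead[OF assms, of l] val_knead[OF assms, of 0] by (simp add: field_simps)
  then show False using crit_range[OF assms, of l] by simp
qed

text \<open>If the relation \<open>k (l + i) = (\<not> k i)\<close> first failed at a position \<open>j\<close>, the shift of \<open>k\<close> by \<open>2 l\<close> would
  exceed \<open>k\<close> at the position \<open>j - l\<close>.\<close>
lemma antiperiodic_of_prefix:
  assumes k: "\<And>n. lexle (shift n k) k" "\<And>n. lexle (flip (shift n k)) k"
    and l: "0 < l" "\<And>i. i < l \<Longrightarrow> k (l + i) = (\<not> k i)"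
  shows "shift l k = flip k"
proof (rule ccontr)
  assume "shift l k \<noteq> flip k"
  then have "flip (shift l k) \<noteq> k" by (metis flip_flip)
  then obtain j where j: "\<forall>i<j. flip (shift l k) i = k i" "\<not> flip (shift l k) j" "k j"
    using lexle_first_difference[OF k(2)] by blast
  have before: "k (l + i) = (\<not> k i)" if "i < j" for i
    using j(1) that by (auto simp: shift_apply)
  have kj: "k (l + j)" using j(2) by (simp add: shift_apply)
  then have "l \<le> j" using l(2)[of j] j(3) by fastforce
  have "\<forall>i<j - l. shift (l + l) k i = k i"
  proof (intro allI impI)
    fix i assume "i < j - l"
    then have "l + i < j" "i < j" by simp_all
    then show "shift (l + l) k i = k i"
      using before[of "l + i"] before[of i] by (simp add: shift_apply add.assoc)
  qed
  moreover have "shift (l + l) k (j - l)" using kj \<open>l \<le> j\<close> by (simp add: shift_apply)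
  ultimately have "k (j - l)" using k(1)[of "l + l"] unfolding lexle_def by blast
  moreover have "k (l + (j - l)) = (\<not> k (j - l))" using \<open>l \<le> j\<close> l(1) j(3) by (intro before) (cases j, auto)
  ultimately show False using \<open>l \<le> j\<close> j(3) by simp
qed

text \<open>Suppose that \<open>k = knead s\<close> is greater than the periodic sequence but smaller than the doubling
  limit. If \<open>k\<close> starts with the block \<open>B\<close> obtained after \<open>n\<close> doublings, the lexicographic bounds leave
  two choices for the next block of the same length. The reflection of \<open>B\<close> would make \<open>k\<close>
  antiperiodic. The other choice is the next doubling; so \<open>k\<close> starts with all doublings and
  equals their limit.\<close>
lemma knead_above_periodic:
  assumes t: "t \<noteq> []" "\<not> last t" and s: "1 < s" "s \<le> 2"
    and above: "\<not> lexle (knead s) (periodic_seq t)"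
  shows "lexle (doubling_limit t) (knead s)"
proof (rule ccontr)
  define k where "k = knead s"
  define u where "u = doubling_limit t"
  define p where "p = length t"
  assume "\<not> lexle (doubling_limit t) (knead s)"
  then have nle: "\<not> lexle u k" and le: "lexle k u" using lexle_total unfolding k_def u_def by blast+
  have self: "lexle (shift n k) k" "lexle (flip (shift n k)) k" for n
    using knead_in_sym_shift[OF s] unfolding sym_shift_def k_def by auto
  have p: "0 < p" using t(1) by (simp add: p_def)
  have "k i = doubling_block t n ! i" if "i < length (doubling_block t n)" for n i
    using that
  proof (induction n arbitrary: i)
    case 0
    have u0: "u i = (if i < p - 1 then t ! i else True)" if "i < p" for i
      using doubling_limit_nth[OF t(1), of i 0] that p t(1)
      by (auto simp: u_def p_def block_plus_def nth_append nth_butlast)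
    define e where "e i = (if i < p then t ! i else True)" for i
    have "\<not> lexle k e"
    proof
      assume "lexle k e"
      have "map k [n..<n + length t] \<le> t" for n
      proof (subst list_le_iff)
        have "lexle (shift n k) e" using self(1) \<open>lexle k e\<close> by (rule lexle_trans)
        then have "(\<forall>i<m. k (n + i) = e i) \<longrightarrow> k (n + m) \<longrightarrow> e m" for m
          unfolding lexle_def shift_apply by blast
        note e = this
        show "\<forall>m<length (map k [n..<n + length t]).
            (\<forall>i<m. map k [n..<n + length t] ! i = t ! i) \<longrightarrow> map k [n..<n + length t] ! m \<longrightarrow> t ! m"
        proof (intro allI impI)
          fix m assume m: "m < length (map k [n..<n + length t])"
            "\<forall>i<m. map k [n..<n + length t] ! i = t ! i" "map k [n..<n + length t] ! m"
          then have "k (n + i) = e i" if "i < m" for i using that by (simp add: e_def p_def)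
          then have "e m" using e[of m] m by simp
          then show "t ! m" using m(1) by (simp add: e_def p_def)
        qed
      qed simp
      then have "lexle (shift 0 k) (periodic_seq t)" using window_le_iff[OF t(1)] by blast
      then show False using above unfolding k_def by simp
    qed
    then obtain m where m: "\<forall>i<m. k i = e i" "k m" "\<not> e m" unfolding lexle_def by blast
    then have mp: "m < p" by (simp add: e_def split: if_splits)
    have "m = p - 1"
    proof (rule ccontr)
      assume "m \<noteq> p - 1"
      then have "m < p - 1" using mp by simp
      have "k i = u i" if "i < m" for i
        using m(1) that u0[of i] mp \<open>m < p - 1\<close> by (simp add: e_def)
      moreover have "\<not> u m" using m(3) u0[OF mp] mp \<open>m < p - 1\<close> by (simp add: e_def)
      ultimately show False using le m(2) unfolding lexle_def by blast
    qed
    then have "k i = u i" if "i < p" for i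
      using that m u0[of i] by (cases "i = m") (auto simp: e_def)
    then show ?case
      using 0 doubling_limit_nth[OF t(1), of i 0] t(1) by (simp add: u_def p_def)
  next
    case (Suc n)
    define B where "B = doubling_block t n"
    define l where "l = length B"
    have l: "0 < l" by (simp add: l_def B_def)
    have IH: "k i = B ! i" if "i < l" for i using Suc.IH that unfolding B_def l_def by blast
    have lenS: "length (doubling_block t (Suc n)) = l + l" by (simp add: B_def l_def)
    have nthS: "doubling_block t (Suc n) ! i = (if i < l then B ! i else if i = l + l - 1 then True else \<not> B ! (i - l))"
      if "i < l + l" for i
      using that l by (auto simp: nth_append block_plus_def B_def[symmetric] l_def nth_butlast nth_Cons')
    have u: "u i = doubling_block t (Suc n) ! i" if "i < l + l" for i
      using doubling_limit_nth[OF t(1), of i "Suc n"] that lenS unfolding u_def by simp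
    have "k i = u i" if "i < l + l" for i
    proof (rule ccontr)
      assume ne: "k i \<noteq> u i"
      then have "k \<noteq> u" by auto
      then obtain m where m: "\<forall>i<m. k i = u i" "\<not> k m" "u m" using lexle_first_difference[OF le] by blast
      have "m \<le> i" using m(1) ne by (meson not_le)
      then have m2: "m < l + l" using that by simp
      have lm: "l \<le> m"
      proof (rule ccontr)
        assume "\<not> l \<le> m"
        then show False using m(2,3) IH[of m] u[of m] nthS[of m] by simp
      qed
      have opp: "k (l + j) = (\<not> k j)" if "l + j < m" for j
      proof -
        have "j < l" "l + j < l + l" "l + j \<noteq> l + l - 1" using that m2 by auto
        then show ?thesis using m(1) that u[of "l + j"] nthS[of "l + j"] IH[of j] by simp
      qed
      have "\<not> flip (shift l k) (m - l) \<or> k (m - l)"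
      proof -
        have "\<forall>i<m - l. flip (shift l k) i = k i" using opp by (auto simp: shift_apply)
        then show ?thesis using self(2)[of l] unfolding lexle_def by blast
      qed
      then have "k (m - l)" using m(2) lm by (simp add: shift_apply)
      moreover have "m = l + l - 1"
      proof (rule ccontr)
        assume "m \<noteq> l + l - 1"
        then have "u m = (\<not> B ! (m - l))" using u[OF m2] nthS[OF m2] lm by simp
        then show False using m(3) \<open>k (m - l)\<close> IH[of "m - l"] m2 lm by simp
      qed
      ultimately have "k (l + j) = (\<not> k j)" if "j < l" for j
        using opp[of j] m(2) that l by (cases "j = l - 1") auto
      then have "shift l k = flip k" using antiperiodic_of_prefix[OF self l] by blast
      then show False using knead_not_antiperiodic[OF s] unfolding k_def by blast
    qed
    then show ?case using Suc.prems u lenS by simp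
  qed
  moreover have "u i = doubling_block t i ! i" "i < length (doubling_block t i)" for i
  proof -
    have "i < 2 ^ i * 1" by simp
    also have "\<dots> \<le> 2 ^ i * length t" using t(1) by (intro mult_left_mono) (auto simp: Suc_le_eq)
    finally show "i < length (doubling_block t i)" using length_doubling_block[OF t(1)] by simp
    then show "u i = doubling_block t i ! i" using doubling_limit_nth[OF t(1)] unfolding u_def by simp
  qed
  ultimately have "k = u" by (simp add: fun_eq_iff)
  then show False using nle by simp
qed

lemma lexle_shift_knead:
  "1 < s \<Longrightarrow> s \<le> 2 \<Longrightarrow> lexle (knead s) a \<Longrightarrow> lexle (shift n (knead s)) a"
  using knead_in_sym_shift[of s] lexle_trans unfolding sym_shift_def by auto

text \<open>A slope between those at the two endpoints would have a kneading sequence above the periodic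
  sequence but below the doubling limit.\<close>
lemma slope_at_admissible:
  assumes adm: "admissible_interval t L U" and \<beta>: "L \<le> \<beta>" "\<beta> \<le> U"
  shows "slope_at \<beta> = slope_at L"
proof -
  have t: "t \<noteq> []" "\<not> last t" and L: "1 < L" "L \<le> 2" and U: "1 < U" "U \<le> 2"
    and qL: "quasi_greedy L (periodic_seq t)" and qU: "quasi_greedy U (doubling_limit t)"
    using adm unfolding admissible_interval_def admissible_block_def by auto
  have vL: "val L (periodic_seq t) = 1" using qL is_expansion_iff[OF L(1)] unfolding quasi_greedy_def by blast
  have "slope_at U \<le> slope_at L"
  proof (rule ccontr)
    assume "\<not> ?thesis"
    then have "slope_at L < slope_at U" by simp
    then obtain s where s: "slope_at L < s" "s < slope_at U" using dense by blast
    have s2: "1 < s" "s \<le> 2" using s slope_at_ge_1[of L] slope_at_le_2[of U] by auto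
    have "\<not> lexle (knead s) (periodic_seq t)"
    proof
      assume "lexle (knead s) (periodic_seq t)"
      then have "val L (knead s) \<le> val L (periodic_seq t)"
        using lexle_shift_knead[OF s2] vL by (intro val_mono_lexle[OF L(1)]) auto
      then show False using val_knead_above[OF s(1) s2(2)] vL by simp
    qed
    then have "lexle (doubling_limit t) (knead s)" by (rule knead_above_periodic[OF t s2])
    then have "1 \<le> val U (knead s)" by (rule quasi_greedy_val_ge[OF qU U])
    then show False using val_knead_below[OF U(1) s2(1) s(2)] by simp
  qed
  moreover have "slope_at L \<le> slope_at \<beta>" "slope_at \<beta> \<le> slope_at U"
    using slope_at_mono \<beta> L(1) by auto
  ultimately show ?thesis by linarith
qed

text \<open>The subshift consists of the sequences bounded by the expansion of 1 in base \<open>L\<close>. It contains the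
  itineraries of all slopes below \<open>slope_at L\<close>, and its words are core words of base \<open>L\<close>.\<close>
lemma subshift_entropy_admissible:
  assumes adm: "admissible_interval t L U"
  shows "subshift_entropy (block_subshift t) = ln (slope_at L)"
proof -
  have t: "t \<noteq> []" "\<not> last t" and L: "1 < L" "L \<le> 2" and qL: "quasi_greedy L (periodic_seq t)"
    using adm unfolding admissible_interval_def admissible_block_def by auto
  define a where "a = periodic_seq t"
  have vL: "val L a = 1" using qL is_expansion_iff[OF L(1)] unfolding quasi_greedy_def a_def by blast
  have L2: "L < 2"
  proof (rule ccontr)
    assume "\<not> L < 2"
    then have "L = 2" using L by simp
    have "flip a (length t - 1)" using t by (simp add: a_def periodic_seq_def last_conv_nth)
    then have "0 < val L (flip a)" by (rule val_pos[OF L(1)])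
    then show False using val_flip[OF L(1), of a] vL \<open>L = 2\<close> by simp
  qed
  \<comment> \<open>the maximum does not change the logarithm, because \<open>ln 0 = 0 = ln 1\<close>, and makes the bounds
    from below independent of whether the subshift is empty\<close>
  define m where "m n = max 1 (real (card (words (sym_shift a) n)))" for n
  have "(\<lambda>n. - ln (m n) / real n) \<longlonglongrightarrow> ln 1 - ln (slope_at L)"
  proof (rule rate_tendsto)
    show "slope_at L < 2" using slope_at_less[OF L(1) L2] L2 by simp
    fix s assume "s = 1 \<or> 1 < s \<and> s < slope_at L"
    then have "1 / 2 * s ^ n \<le> m n" for n
    proof
      assume s: "1 < s \<and> s < slope_at L"
      then have s2: "1 < s" "s \<le> 2" using slope_at_le_2[of L] by auto
      have "\<not> lexle a (knead s)"
        using quasi_greedy_val_ge[OF qL L] val_knead_below[OF L(1) s2(1)] s unfolding a_def by fastforce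
      then have "lexle (knead s) a" using lexle_total by blast
      then have "sym_shift (knead s) \<subseteq> sym_shift a" unfolding sym_shift_def using lexle_trans by blast
      then have "words (sym_shift (knead s)) n \<subseteq> words (sym_shift a) n" unfolding words_def by blast
      then have "card (words (sym_shift (knead s)) n) \<le> card (words (sym_shift a) n)"
        by (intro card_mono finite_words)
      then show ?thesis using card_words_ge[OF s2, of n] unfolding m_def by linarith
    qed (simp add: m_def)
    then show "\<exists>c K. 0 < c \<and> (\<forall>n. c * (s / 1) ^ n \<le> m (n + K))"
      by (intro exI[of _ "1/2"] exI[of _ 0]) auto
  next
    fix s assume s: "slope_at L < s" "s \<le> 2"
    then have s1: "1 < s" using slope_at_ge_1[of L] by simp
    obtain C where C: "0 < C" "\<And>n. card (core_words L n) \<le> C * s ^ n"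
      using card_core_words_le[OF L(1) s1 s(2) val_knead_above[OF s]] by blast
    have "m n \<le> (1 + n * (C * s ^ n)) * (2 / 1 ^ n)" for n
    proof (cases "n = 0")
      case True
      have "words (sym_shift a) n \<subseteq> {[]}" using True by (auto simp: words_def)
      then have "card (words (sym_shift a) n) \<le> 1" 
        using card_mono[of "{[]}" "words (sym_shift a) n"] by simp
      then show ?thesis using True by (simp add: m_def)
    next
      case False
      have "card (words (sym_shift a) n) \<le> card (core_words L n)"
        using words_sym_shift_core[OF L(1)] vL by (intro card_mono finite_core_words) auto
      then have "card (words (sym_shift a) n) \<le> C * s ^ n" using C(2)[of n] by linarith
      moreover have "0 \<le> C * s ^ n" using C(1) s1 by simp
      moreover from this have "1 * (C * s ^ n) \<le> n * (C * s ^ n)" using False by (intro mult_right_mono) auto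
      ultimately show ?thesis unfolding m_def by auto
    qed
    then show "\<exists>C>0. \<forall>n. m n \<le> (1 + n * (C * s ^ n)) * (2 / 1 ^ n)" using C(1) by blast
  qed (use slope_at_ge_1 in auto)
  then have "(\<lambda>n. ln (m n) / real n) \<longlonglongrightarrow> ln (slope_at L)"
    using tendsto_minus by fastforce
  moreover have "ln (m n) = ln (card (words (block_subshift t) n))" for n
    unfolding m_def block_subshift_eq[OF t(1)] a_def
    by (cases "card (words (sym_shift (periodic_seq t)) n) = 0") (auto simp: max_def)
  ultimately show ?thesis unfolding subshift_entropy_def by (simp add: limI)
qed

theorem corollary1p8:
  shows
    "(\<forall>\<beta>\<in>{1<..2}. convergent (escape_seq \<beta>)) \<and>
     (\<forall>\<beta>\<in>{1<..komornik_loreti}. norm_escape_rate \<beta> = 1 \<and> escape_rate \<beta> = ln \<beta>) \<and>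
     (continuous_on {komornik_loreti<..2} norm_escape_rate \<and>
      (\<forall>t L U. admissible_interval t L U \<longrightarrow>
         mono_on ({L..U} \<inter> {komornik_loreti<..2}) norm_escape_rate) \<and>
      mono_on {komornik_loreti<..2} (\<lambda>\<beta>. ln \<beta> - escape_rate \<beta>) \<and>
      (AE \<beta> in lborel. \<beta> \<in> {komornik_loreti<..2} \<longrightarrow>
         (\<exists>D>0. (norm_escape_rate has_real_derivative D) (at \<beta>))) \<and>
      (norm_escape_rate \<longlongrightarrow> 1) (at komornik_loreti) \<and>
      norm_escape_rate 2 = 0) \<and>
     (\<forall>t L U. admissible_interval t L U \<longrightarrow>
        (\<forall>\<beta>\<in>{L..U}. norm_escape_rate \<beta> = 1 - subshift_entropy (block_subshift t) / ln \<beta>))"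
proof (intro conjI ballI allI impI)
  note rate = escape_rate_eq
  show "convergent (escape_seq \<beta>)" if "\<beta> \<in> {1<..2}" for \<beta> using rate(1) that by simp
  show "norm_escape_rate \<beta> = 1" "escape_rate \<beta> = ln \<beta>" if "\<beta> \<in> {1<..komornik_loreti}" for \<beta>
    using rate(2,3)[of \<beta>] slope_at_eq_1[of \<beta>] komornik_loreti that by auto
  have cont: "isCont (\<lambda>\<beta>. 1 - ln (slope_at \<beta>) / ln \<beta>) \<beta>" if "1 < \<beta>" for \<beta>
    using isCont_slope_at[OF that] slope_at_ge_1[of \<beta>] that by (intro continuous_intros) auto
  have "continuous_on {komornik_loreti<..2} (\<lambda>\<beta>. 1 - ln (slope_at \<beta>) / ln \<beta>)"
    using cont komornik_loreti by (intro continuous_at_imp_continuous_on) auto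
  then show "continuous_on {komornik_loreti<..2} norm_escape_rate"
    using rate(3) komornik_loreti by (subst continuous_on_cong[OF refl]) auto
  have part3: "norm_escape_rate \<beta> = 1 - subshift_entropy (block_subshift t) / ln \<beta>"
    if "admissible_interval t L U" "\<beta> \<in> {L..U}" for t L U \<beta>
  proof -
    have "1 < \<beta>" "\<beta> \<le> 2" using that unfolding admissible_interval_def by auto
    then show ?thesis
      using rate(3)[of \<beta>] slope_at_admissible[OF that(1), of \<beta>] subshift_entropy_admissible[OF that(1)] that(2) by simp
  qed
  then show "norm_escape_rate \<beta> = 1 - subshift_entropy (block_subshift t) / ln \<beta>"
    if "admissible_interval t L U" "\<beta> \<in> {L..U}" for t L U \<beta> using that by blast
  show "mono_on ({L..U} \<inter> {komornik_loreti<..2}) norm_escape_rate" if adm: "admissible_interval t L U" for t L U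
  proof (rule mono_onI)
    fix x y assume xy: "x \<in> {L..U} \<inter> {komornik_loreti<..2}" "y \<in> {L..U} \<inter> {komornik_loreti<..2}" "x \<le> y"
    then have "1 < x" using komornik_loreti by auto
    moreover have "0 \<le> subshift_entropy (block_subshift t)"
      using subshift_entropy_admissible[OF adm] slope_at_ge_1[of L] by simp
    ultimately have "subshift_entropy (block_subshift t) / ln y \<le> subshift_entropy (block_subshift t) / ln x"
      using xy(3) by (intro divide_left_mono) auto
    then show "norm_escape_rate x \<le> norm_escape_rate y" using part3[OF adm] xy by simp
  qed
  show "mono_on {komornik_loreti<..2} (\<lambda>\<beta>. ln \<beta> - escape_rate \<beta>)"
  proof (rule mono_onI)
    fix x y assume xy: "x \<in> {komornik_loreti<..2}" "y \<in> {komornik_loreti<..2}" "x \<le> y"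
    then have "1 < x" "1 < y" using komornik_loreti by auto
    then show "ln x - escape_rate x \<le> ln y - escape_rate y"
      using rate(2) slope_at_mono[of x y] slope_at_ge_1[of x] xy by simp
  qed
  show "AE \<beta> in lborel. \<beta> \<in> {komornik_loreti<..2} \<longrightarrow>
      (\<exists>D>0. (norm_escape_rate has_real_derivative D) (at \<beta>))"
    by (rule AE_norm_escape_rate_deriv)
  show "(norm_escape_rate \<longlongrightarrow> 1) (at komornik_loreti)"
  proof (rule Lim_transform_within_open)
    show "((\<lambda>\<beta>. 1 - ln (slope_at \<beta>) / ln \<beta>) \<longlongrightarrow> 1) (at komornik_loreti)"
      using cont[OF komornik_loreti(1)] slope_at_eq_1[of komornik_loreti] komornik_loreti unfolding isCont_def by simp
    show "open {1<..<2::real}" "komornik_loreti \<in> {1<..<2}" using komornik_loreti by auto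
  qed (use rate(3) in auto)
  show "norm_escape_rate 2 = 0" using rate(3)[of 2] slope_at_2 by simp
qed

end
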